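(* Let $r\ge 0$ be an integer and $k=4r+4$. Then for every integer $i$ with $0\le i\le\lfloor\frac{k-1}{2}\rfloor$, \[ \sum_{j=0}^{r}\binom{k/2}{2j}(-1)^{j}\pi^{2j}\,\mathrm{IKM}_{k}(2j,2i) = \begin{cases} (-1)^r\pi^{2r+2}\,\mathrm{IKM}_{k}(2r+2,2i) & \text{if } 0\leq i\leq r, \\ (-1)^r\pi^{2r+2}\,\mathrm{IKM}_{k}^{\mathrm{reg}}(2r+2,2i) & \text{if } r+1\leq i\leq \lfloor\frac{k-1}{2}\rfloor . \end{cases} \]
   Context: $I_0(t),K_0(t)$ are the modified Bessel functions of order $0$. The Bessel moments are $\mathrm{IKM}_{k}(a,b)=\int_{0}^{\infty}I_{0}(t)^{a}K_{0}(t)^{k-a}t^{b}\,\mathrm{d}t$ (whenever the integral converges). For $k$ even, the rational numbers $\gamma_{k,n}$ ($n\ge 0$) are defined by the formal power series identity $\Big(\sum_{n\ge 0}\frac{((2n-1)!!)^3}{2^{5n}\,n!}w^n\Big)^{k/2}=\sum_{n\ge0}\gamma_{k,n}w^n$, with $(-1)!!=1$. Equivalently, $(I_0(t)K_0(t))^{k/2}\sim 2^{-k/2}\sum_{n\ge 0}\gamma_{k,n}4^n t^{-2n-k/2}$ as $t\to+\infty$. For $k=4r+4$ and $2j\ge \lfloor\frac{k-1}{2}\rfloor=2r+1$ (i.e. $j\ge r+1$), the regularized Bessel moment is \[ \mathrm{IKM}^{\mathrm{reg}}_{k}\left(\tfrac{k}{2},2j\right)=\lim_{t\rightarrow\infty}\left(\int_{0}^{t}(I_{0}(s)K_{0}(s))^{2r+2}s^{2j}\,\mathrm{d}s-\sum_{m=0}^{j-r-1}\frac{\gamma_{k,j-r-1-m}\,t^{2m+1}}{2^{k-2j+2m}(2m+1)}\right).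 \] *)

theory Defs
  imports "HOL-Analysis.Analysis" "HOL-Computational_Algebra.Formal_Power_Series"
begin

definition bessel_I0 :: "real \<Rightarrow> real" where
  "bessel_I0 t = (\<Sum>n. (t / 2) ^ (2 * n) / (fact n)\<^sup>2)"

(* Schlaefli's integral for the modified Bessel function of the second kind, valid for t > 0;
   K_0 is only ever used on the open half-line. *)
definition bessel_K0 :: "real \<Rightarrow> real" where
  "bessel_K0 t = integral {0..} (\<lambda>u. exp (- t * cosh u))"

(* Meaningful for a \<le> k, since k - a is truncated. *)
definition IKM :: "nat \<Rightarrow> nat \<Rightarrow> nat \<Rightarrow> real" where
  "IKM k a b = integral {0<..} (\<lambda>t. bessel_I0 t ^ a * bessel_K0 t ^ (k - a) * t ^ b)"

(* (2n-1)!!, with (-1)!! = 1 *)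
definition odd_dfact :: "nat \<Rightarrow> nat" where
  "odd_dfact n = (\<Prod>l<n. 2 * l + 1)"

(* Meaningful for k even. *)
definition IKM_gamma :: "nat \<Rightarrow> nat \<Rightarrow> rat" where
  "IKM_gamma k n =
     fps_nth ((Abs_fps (\<lambda>n. of_nat (odd_dfact n) ^ 3 / (2 ^ (5 * n) * fact n))) ^ (k div 2)) n"

(* IKM_reg r j is the regularized moment of index k = 4r+4 at (k/2, 2j), for j \<ge> r+1. *)
definition IKM_reg :: "nat \<Rightarrow> nat \<Rightarrow> real" where
  "IKM_reg r j = (let k = 4 * r + 4 in
     Lim at_top (\<lambda>t::real.
       integral {0<..t} (\<lambda>s. (bessel_I0 s * bessel_K0 s) ^ (2 * r + 2) * s ^ (2 * j))
       - (\<Sum>m = 0..j - r - 1.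
            of_rat (IKM_gamma k (j - r - 1 - m)) * t ^ (2 * m + 1)
            / (2 powi (int k - 2 * int j + 2 * int m) * of_nat (2 * m + 1)))))"

end

(* Write K, I for K_0, I_0. For t > 0 the product K(t) (K(t) + i pi I(t)) is the boundary value at w = -i t
   of a function Q that is holomorphic in a half-plane containing the closed fourth quadrant minus 0, real on the
   positive real axis, of logarithmic growth at 0, and there Q(w) ~ sum_n q_n w^(-2n-1) uniformly, where
   q_n = (pi/2) (-1)^n (2n-1)!!^3 / (8^n n!). Put M = 2r+2 = k/2. After subtraction of an even polynomial with real
   coefficients, Q(w)^M w^(2i) is O(|w|^(-2)) in the quadrant, so Cauchy's theorem on the boundary of the
   quadrant shows that the real part of its integral over the negative imaginary axis vanishes. Expanding the
   real part of (K^2 + i pi I K)^M by the binomial theorem gives the sum rule; the subtracted polynomial is exactly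
   the regularization.

   Q is a Laplace transform. With L(w) = int_0^oo exp(-w s) / sqrt(1 + s^2) ds one has
   Q(w) = 2 int_0^oo L(2 w cosh x) dx, and rotating the s-integral to the ray of argument pi/4 makes everything
   absolutely convergent and the asymptotic expansion elementary. Rotating further to the imaginary axis gives
   L(-i t) = K(t) + i int_0^(pi/2) exp(-t sin y) dy, so the boundary values of Q come down to the product formulas
   K(t)^2 = 2 int_0^oo K(2 t cosh x) dx and pi I(t) K(t) = int_0^pi K(2 t sin y) dy. *)

theory Submission
  imports Defs "HOL-Complex_Analysis.Complex_Analysis" "HOL-Real_Asymp.Real_Asymp"
begin

section \<open>Lebesgue measure on the half-line and Laplace transforms\<close>

text \<open>Bessel functions are never continued to complex arguments: \<open>bessel_K0\<close> is
  used on the open half-line only, and Q alone carries the complex analysis. Along the real ray the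
  Laplace integral of 1 / sqrt (1 + s^2) converges absolutely only for Re w > 0, which leaves the
  negative imaginary axis on the boundary. The angle pi/4 is the symmetric choice between the two
  edges of the quadrant: both then lie inside the half-plane Re (\<open>om\<close> w) > 0, and the
  decay rate Re (\<open>om\<close> w) is comparable to |w| on the whole quadrant, so every estimate
  is uniform up to its edges. The parity of M makes the subtraction complete: M is even, so Q^M
  w^(2i) expands in even powers only. No 1/w term is left over, and the remainder drops at once to
  |w|^(-2). At 0 the logarithm is replaced by a power |w|^(-\<eta>) with \<eta> = 1/(2M), so that
  Q^M is bounded by a multiple of |w|^(-1/2). For i \<le> r nothing is subtracted, and convergence
  of the central moment is a result of the argument: its integrand is nonnegative and its truncated
  integrals have a limit.\<close>

definition HL :: "real measure" where
  "HL = restrict_space lborel {0..}"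

lemma sigma_finite_HL: "sigma_finite_measure HL"
  unfolding HL_def by (rule sigma_finite_measure_restrict_space) (auto intro: sigma_finite_lborel)

interpretation HL: sigma_finite_measure HL
  by (rule sigma_finite_HL)

interpretation HL2: pair_sigma_finite HL HL ..

lemma space_HL [simp]: "space HL = {0..}"
  by (simp add: HL_def space_restrict_space)

lemma ident_measurable_HL [measurable]: "(\<lambda>x. x) \<in> HL \<rightarrow>\<^sub>M borel"
  unfolding HL_def by (rule measurable_restrict_space1) simp

lemma borel_measurable_HL: "f \<in> borel_measurable borel \<Longrightarrow> f \<in> borel_measurable HL"
  using measurable_compose[OF ident_measurable_HL] by blast

lemma AE_HL_pos: "AE x in HL. x > 0"
proof -
  have "AE x in lborel. (x::real) \<noteq> 0"
    by (rule AE_lborel_singleton)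
  then show ?thesis
    unfolding HL_def by (subst AE_restrict_space_iff) (auto elim!: eventually_mono)
qed

lemma integral_HL:
  fixes f :: "real \<Rightarrow> 'a::euclidean_space"
  assumes "integrable HL f"
  shows "(f has_integral (\<integral>x. f x \<partial>HL)) {0..}" "(f has_integral (\<integral>x. f x \<partial>HL)) {0<..}"
proof -
  have 1: "set_integrable lborel {0..} f"
    using assms by (simp add: HL_def integrable_restrict_space set_integrable_def)
  have 2: "(\<integral>x. f x \<partial>HL) = set_lebesgue_integral lborel {0..} f"
    by (simp add: HL_def integral_restrict_space set_lebesgue_integral_def)
  show 3: "(f has_integral (\<integral>x. f x \<partial>HL)) {0..}"
    using set_borel_integral_eq_integral[OF 1] 2 by (simp add: has_integral_iff)
  have "negligible {x \<in> {0..} - {0<..} :: real set. f x \<noteq> 0}"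
    by (rule negligible_subset[of "{0}"]) auto
  moreover have "negligible {x \<in> {0<..} - {0..} :: real set. f x \<noteq> 0}"
    by (rule negligible_subset[of "{}"]) auto
  ultimately show "(f has_integral (\<integral>x. f x \<partial>HL)) {0<..}"
    using 3 has_integral_spike_set_eq[of "{0..}" "{0<..}" f] by blast
qed

text \<open>For a nonnegative integrand a gauge integral is a Lebesgue integral. This carries
  integrals evaluated with \<open>has_integral\<close> over to the Bochner integral, where Fubini
  and majorants are available.\<close>

lemma integrable_restrict_space_nonneg:
  fixes f :: "real \<Rightarrow> real"
  assumes "f \<in> borel_measurable (restrict_space lborel A)" "A \<in> sets borel"
    "\<And>x. x \<in> A \<Longrightarrow> 0 \<le> f x" "(f has_integral I) A"
  shows "integrable (restrict_space lborel A) f"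
proof -
  have "(\<integral>\<^sup>+x. f x \<partial>restrict_space lborel A) = (\<integral>\<^sup>+x. ennreal (f x) * indicator A x \<partial>lborel)"
    using assms(2) by (subst nn_integral_restrict_space) auto
  also have "\<dots> = ennreal I"
    using assms by (intro nn_integral_has_integral_lebesgue') auto
  finally show ?thesis
    by (intro integrableI_nn_integral_finite[OF assms(1)]) (auto simp: space_restrict_space assms(3))
qed

lemma integrable_HL_I:
  fixes f :: "real \<Rightarrow> real"
  assumes "f \<in> borel_measurable HL" "\<And>x. x \<ge> 0 \<Longrightarrow> 0 \<le> f x" "(f has_integral I) {0..}"
  shows "integrable HL f" "(\<integral>x. f x \<partial>HL) = I"
proof -
  show 1: "integrable HL f"
    using assms unfolding HL_def by (intro integrable_restrict_space_nonneg) auto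
  show "(\<integral>x. f x \<partial>HL) = I"
    using integral_HL(1)[OF 1] assms(3) has_integral_unique by blast
qed

lemma HL_tendsto:
  fixes f :: "real \<Rightarrow> 'a::euclidean_space"
  assumes "integrable HL f"
  shows "((\<lambda>R. integral {0..R} f) \<longlongrightarrow> (\<integral>x. f x \<partial>HL)) at_top"
proof -
  have 1: "integrable lborel (\<lambda>x. indicator {0..} x *\<^sub>R f x)"
    using assms by (simp add: HL_def integrable_restrict_space)
  have "((\<lambda>y. \<integral>x. indicator {..y} x *\<^sub>R (indicator {0..} x *\<^sub>R f x) \<partial>lborel) \<longlongrightarrow> (\<integral>x. indicator {0..} x *\<^sub>R f x \<partial>lborel)) at_top"
    by (rule tendsto_integral_at_top[OF _ 1]) simp
  moreover have "(\<integral>x. indicator {..y} x *\<^sub>R (indicator {0..} x *\<^sub>R f x) \<partial>lborel) = integral {0..y} f" for y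
  proof -
    have "set_integrable lborel {0..y} f"
      by (rule set_integrable_subset[of _ "{0..}"]) (use 1 in \<open>auto simp: set_integrable_def\<close>)
    then have "set_lebesgue_integral lborel {0..y} f = integral {0..y} f"
      by (rule set_borel_integral_eq_integral)
    moreover have "(\<lambda>x. indicator {..y} x *\<^sub>R (indicator {0..} x *\<^sub>R f x)) = (\<lambda>x. indicator {0..y} x *\<^sub>R f x)"
      by (auto simp: indicator_def)
    ultimately show ?thesis
      unfolding set_lebesgue_integral_def by (simp only:)
  qed
  ultimately show ?thesis
    by (simp add: HL_def integral_restrict_space)
qed

lemma HL_scale:
  fixes f :: "real \<Rightarrow> 'a::euclidean_space"
  assumes "c > 0"
  shows "integrable HL (\<lambda>x. f (c * x)) \<longleftrightarrow> integrable HL f"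
    "(\<integral>x. f x \<partial>HL) = c *\<^sub>R (\<integral>x. f (c * x) \<partial>HL)"
proof -
  have i: "indicator {0..} (c * x) = (indicator {0..} x :: real)" for x
    using assms by (auto simp: indicator_def zero_le_mult_iff)
  show "integrable HL (\<lambda>x. f (c * x)) \<longleftrightarrow> integrable HL f"
    using lborel_integrable_real_affine_iff[of c "\<lambda>x. indicator {0..} x *\<^sub>R f x" 0] assms
    by (simp add: HL_def integrable_restrict_space i)
  show "(\<integral>x. f x \<partial>HL) = c *\<^sub>R (\<integral>x. f (c * x) \<partial>HL)"
    using lborel_integral_real_affine[of c "\<lambda>x. indicator {0..} x *\<^sub>R f x" 0] assms
    by (simp add: HL_def integral_restrict_space i)
qed

lemma Gamma_HL:
  assumes "c > 0" "s > (0::real)"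
  shows "integrable HL (\<lambda>x. x powr (s - 1) * exp (- c * x))"
    "(\<integral>x. x powr (s - 1) * exp (- c * x) \<partial>HL) = Gamma s / c powr s"
proof -
  have m: "(\<lambda>x. x powr (s - 1) / exp x) \<in> borel_measurable HL"
    by measurable
  note G = integrable_HL_I[OF m _ Gamma_integral_real[OF assms(2)]]
  have eq: "(\<lambda>x. (c * x) powr (s - 1) / exp (c * x)) = (\<lambda>x. c powr (s - 1) * (x powr (s - 1) * exp (- c * x)))"
    using assms by (auto simp: powr_mult exp_minus field_simps)
  have 1: "integrable HL (\<lambda>x. c powr (s - 1) * (x powr (s - 1) * exp (- c * x)))"
    using HL_scale(1)[OF assms(1), of "\<lambda>x. x powr (s - 1) / exp x"] G(1) unfolding eq by simp
  then show "integrable HL (\<lambda>x. x powr (s - 1) * exp (- c * x))"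
    using assms by simp
  have "Gamma s = c * (c powr (s - 1) * (\<integral>x. x powr (s - 1) * exp (- c * x) \<partial>HL))"
    using HL_scale(2)[OF assms(1), of "\<lambda>x. x powr (s - 1) / exp x"] G(2) unfolding eq by simp
  then show "(\<integral>x. x powr (s - 1) * exp (- c * x) \<partial>HL) = Gamma s / c powr s"
    using assms by (simp add: powr_diff)
qed

lemma power_exp_HL:
  assumes "c > 0"
  shows "integrable HL (\<lambda>x. x ^ n * exp (- c * x))"
    "(\<integral>x. x ^ n * exp (- c * x) \<partial>HL) = fact n / c ^ Suc n"
proof -
  have eq: "AE x in HL. x powr (real (Suc n) - 1) * exp (- c * x) = x ^ n * exp (- c * x)"
    using AE_HL_pos by eventually_elim (simp add: powr_realpow)
  have m: "(\<lambda>x. x powr (real (Suc n) - 1) * exp (- c * x)) \<in> borel_measurable HL"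
    "(\<lambda>x. x ^ n * exp (- c * x)) \<in> borel_measurable HL"
    by measurable
  have "real (Suc n) > 0" by simp
  note G = Gamma_HL[OF assms this]
  show "integrable HL (\<lambda>x. x ^ n * exp (- c * x))"
    using G(1) integrable_cong_AE[OF m eq] by blast
  show "(\<integral>x. x ^ n * exp (- c * x) \<partial>HL) = fact n / c ^ Suc n"
    using G(2) integral_cong_AE[OF m eq] Gamma_fact[of n, where 'a=real] assms
      powr_realpow[OF assms, of "Suc n"]
    by (simp add: add.commute)
qed

lemma integrable_HL_exp:
  assumes "c > 0" shows "integrable HL (\<lambda>x. exp (- c * x))"
  using power_exp_HL(1)[OF assms, of 0] by simp

lemma norm_lebesgue_integral_le:
  fixes f :: "'a \<Rightarrow> 'b::{banach, second_countable_topology}"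
  assumes "integrable M g" "\<And>x. x \<in> space M \<Longrightarrow> norm (f x) \<le> g x"
  shows "norm (\<integral>x. f x \<partial>M) \<le> (\<integral>x. g x \<partial>M)"
proof -
  have g: "g x \<ge> 0" if "x \<in> space M" for x
    using assms(2)[OF that] norm_ge_zero order_trans by blast
  show ?thesis
  proof (cases "integrable M f")
    case True
    have "norm (\<integral>x. f x \<partial>M) \<le> (\<integral>x. norm (f x) \<partial>M)"
      by (rule integral_norm_bound)
    also have "\<dots> \<le> (\<integral>x. g x \<partial>M)"
      by (rule integral_mono) (use True assms in auto)
    finally show ?thesis .
  next
    \<comment> \<open>A non-integrable \<open>f\<close> has Bochner integral 0 by default, and
      \<open>g\<close> is nonnegative.\<close>
    case False
    then show ?thesis
      using g by (auto simp: not_integrable_integral_eq intro!: integral_nonneg_AE)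
  qed
qed

section \<open>Laplace transforms at complex arguments\<close>

definition Laplace :: "(real \<Rightarrow> complex) \<Rightarrow> complex \<Rightarrow> complex" where
  "Laplace g v = (\<integral>x. exp (- v * of_real x) * g x \<partial>HL)"

lemma integrable_Laplace:
  assumes "g \<in> borel_measurable HL" "integrable HL (\<lambda>x. exp (- c * x) * norm (g x))" "c \<le> Re v"
  shows "integrable HL (\<lambda>x. exp (- v * of_real x) * g x)"
proof (rule Bochner_Integration.integrable_bound[OF assms(2)])
  show "(\<lambda>x. exp (- v * of_real x) * g x) \<in> borel_measurable HL"
    using assms(1) by measurable
  show "AE x in HL. norm (exp (- v * of_real x) * g x) \<le> norm (exp (- c * x) * norm (g x))"
    by (rule AE_I2) (use assms(3) in \<open>auto simp: norm_mult intro!: mult_right_mono\<close>)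
qed

text \<open>Differentiation under the integral sign: the second-order Taylor remainder of exp (- h
  x) bounds the error of the difference quotient by a constant times |h|.\<close>

lemma Laplace_deriv:
  assumes m [measurable]: "g \<in> borel_measurable HL"
    and I: "\<And>c. c > 0 \<Longrightarrow> integrable HL (\<lambda>x. exp (- c * x) * norm (g x))"
    and v: "Re v > 0"
  shows "(Laplace g has_field_derivative Laplace (\<lambda>x. - of_real x * g x) v) (at v)"
proof -
  let ?D = "Laplace (\<lambda>x. - of_real x * g x) v"
  let ?D = "?D"
  \<comment> \<open>A quarter of \<open>Re v\<close> leaves room for two losses of exp (c x), one
    from the Taylor remainder with |h| \<le> c and one from absorbing x^2, while an integrable
    exponential remains.\<close>
  define c where "c = Re v / 4"
  have c: "c > 0" using v by (simp add: c_def)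
  let ?b = "\<lambda>x. 2 / c\<^sup>2 * (exp (- c * x) * norm (g x))"
  let ?e = "\<lambda>h x. exp (- (v + h) * of_real x) * g x - exp (- v * of_real x) * g x - h * (exp (- v * of_real x) * (- of_real x * g x))"
  have ax: "x \<le> exp (c * x) / c" "x\<^sup>2 \<le> 2 * exp (c * x) / c\<^sup>2" if "x \<ge> 0" for x
  proof -
    have "c * x \<le> exp (c * x)" using exp_ge_add_one_self[of "c * x"] by linarith
    then show "x \<le> exp (c * x) / c" using c by (simp add: field_simps)
    have "exp (c * x) \<ge> 1 + c * x + (c * x)\<^sup>2 / 2" using c that by (intro exp_lower_Taylor_quadratic) simp
    moreover have "0 \<le> c * x" using c that by simp
    ultimately have "(c * x)\<^sup>2 \<le> 2 * exp (c * x)" by linarith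
    then show "x\<^sup>2 \<le> 2 * exp (c * x) / c\<^sup>2" using c by (simp add: field_simps power_mult_distrib)
  qed
  have I1: "integrable HL (\<lambda>x. exp (- (2 * c) * x) * norm (- of_real x * g x))"
  proof (rule Bochner_Integration.integrable_bound[OF integrable_mult_right[OF I[OF c], of "1 / c"]])
    show "AE x in HL. norm (exp (- (2 * c) * x) * norm (- of_real x * g x)) \<le> norm (1 / c * (exp (- c * x) * norm (g x)))"
    proof (rule AE_I2)
      fix x assume "x \<in> space HL"
      then have x: "x \<ge> 0" by simp
      have "exp (- (2 * c) * x) * x \<le> exp (- (2 * c) * x) * (exp (c * x) / c)"
        using ax(1)[OF x] by (intro mult_left_mono) auto
      also have "\<dots> = 1 / c * exp (- c * x)"
        by (simp add: mult_exp_exp[symmetric] field_simps flip: exp_add)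
      finally have "exp (- (2 * c) * x) * x * norm (g x) \<le> 1 / c * exp (- c * x) * norm (g x)"
        by (rule mult_right_mono) simp
      then show "norm (exp (- (2 * c) * x) * norm (- of_real x * g x)) \<le> norm (1 / c * (exp (- c * x) * norm (g x)))"
        using x c by (simp add: norm_mult mult.assoc abs_mult)
    qed
  qed measurable
  define K where "K = (\<integral>x. ?b x \<partial>HL)"
  have bnd: "norm (Laplace g (v + h) - Laplace g v - h * ?D) \<le> K * (norm h)\<^sup>2"
    if h: "norm h \<le> c" for h
  proof -
    have Rh: "Re (v + h) \<ge> c" using h abs_Re_le_cmod[of h] c by (simp add: c_def)
    have i1: "integrable HL (\<lambda>x. exp (- (v + h) * of_real x) * g x)"
      using integrable_Laplace[OF m I[OF c] Rh] .
    have i2: "integrable HL (\<lambda>x. exp (- v * of_real x) * g x)"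
      using integrable_Laplace[OF m I[OF c], of v] v by (simp add: c_def)
    have i3: "integrable HL (\<lambda>x. exp (- v * of_real x) * (- of_real x * g x))"
      by (rule integrable_Laplace[OF _ I1]) (use v in \<open>auto simp: c_def\<close>)
    have "Laplace g (v + h) - Laplace g v - h * ?D
      = (\<integral>x. ?e h x \<partial>HL)"
      unfolding Laplace_def using i1 i2 i3 by simp
    also have "norm \<dots> \<le> (\<integral>x. (norm h)\<^sup>2 * (?b x) \<partial>HL)"
    proof (rule norm_lebesgue_integral_le)
      show "integrable HL (\<lambda>x. (norm h)\<^sup>2 * (?b x))"
        using I[OF c] by simp
      fix x assume "x \<in> space HL"
      then have x: "x \<ge> 0" by simp
      have T: "norm (exp (- h * of_real x) - 1 + h * of_real x) \<le> exp (c * x) * (norm h * x)\<^sup>2"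
      proof -
        have "norm (exp (- h * of_real x) - (\<Sum>k\<le>1. (- h * of_real x) ^ k / fact k)) \<le> exp \<bar>Re (- h * of_real x)\<bar> * norm (- h * of_real x) ^ Suc 1 / fact 1"
          by (rule Taylor_exp)
        also have "\<dots> \<le> exp (c * x) * (norm h * x)\<^sup>2"
        proof -
          have "\<bar>Re (- h * of_real x)\<bar> \<le> c * x"
            using h abs_Re_le_cmod[of h] x by (auto simp: abs_mult intro!: mult_right_mono)
          then show ?thesis using x
            by (auto simp: norm_mult power2_eq_square intro!: mult_right_mono)
        qed
        finally show ?thesis by (simp add: algebra_simps)
      qed
      have "?e h x
        = exp (- v * of_real x) * (exp (- h * of_real x) - 1 + h * of_real x) * g x"
        by (simp add: algebra_simps exp_add exp_diff exp_minus divide_inverse)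
      also have "norm \<dots> \<le> exp (- Re v * x) * (exp (c * x) * (norm h * x)\<^sup>2) * norm (g x)"
        unfolding norm_mult unfolding norm_mult by (rule mult_right_mono[OF mult_mono[OF _ T]]) auto
      also have "\<dots> = (norm h)\<^sup>2 * (exp (- (3 * c) * x) * x\<^sup>2 * norm (g x))"
        by (simp add: c_def power_mult_distrib mult_ac flip: exp_add)
      also have "\<dots> \<le> (norm h)\<^sup>2 * (exp (- (3 * c) * x) * (2 * exp (c * x) / c\<^sup>2) * norm (g x))"
        using ax(2)[OF x] by (intro mult_left_mono mult_right_mono) auto
      also have "\<dots> = (norm h)\<^sup>2 * (2 / c\<^sup>2 * (exp (- (2*c) * x) * norm (g x)))"
        by (simp add: mult_ac flip: exp_add) 
      also have "\<dots> \<le> (norm h)\<^sup>2 * (?b x)"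
        using x c by (intro mult_left_mono mult_right_mono) auto
      finally show "norm (?e h x)
        \<le> (norm h)\<^sup>2 * (?b x)" .
    qed
    also have "\<dots> = K * (norm h)\<^sup>2"
      by (simp add: K_def)
    finally show ?thesis .
  qed
  show ?thesis
    unfolding DERIV_def
  proof (rule LIM_zero_cancel, rule Lim_null_comparison[where g="\<lambda>h. K * norm h"])
    show "((\<lambda>h::complex. K * norm h) \<longlongrightarrow> 0) (at 0)"
      by (auto intro!: tendsto_eq_intros)
    show "\<forall>\<^sub>F h in at 0. norm ((Laplace g (v + h) - Laplace g v) / h - ?D) \<le> K * norm h"
      unfolding eventually_at
    proof (intro exI[of _ c] conjI ballI impI c)
      fix h :: complex assume "h \<noteq> 0 \<and> dist h 0 < c"
      then have h: "h \<noteq> 0" "norm h \<le> c" by auto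
      have "norm ((Laplace g (v + h) - Laplace g v) / h - ?D)
        = norm ((Laplace g (v + h) - Laplace g v - h * ?D) / h)"
        using h by (simp add: diff_divide_distrib)
      also have "\<dots> \<le> K * norm h"
        using bnd[OF h(2)] h(1) by (simp add: norm_divide field_simps power2_eq_square)
      finally show "norm ((Laplace g (v + h) - Laplace g v) / h - ?D) \<le> K * norm h" .
    qed
  qed
qed

text \<open>\<open>power_exp_HL\<close> covers real rates only. For complex \<open>v\<close> each
  differentiation in \<open>v\<close> brings down a factor - x, so the formula for n + 1 is the
  derivative of the formula for n.\<close>

lemma Laplace_power:
  assumes "Re v > 0"
  shows "Laplace (\<lambda>x. of_real (x ^ n)) v = fact n / v ^ Suc n"
  using assms
proof (induction n arbitrary: v)
  case 0
  have v: "v \<noteq> 0" using 0 by auto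
  let ?h = "\<lambda>x. exp (- v * of_real x) * 1"
  have i: "integrable HL ?h"
    by (rule integrable_Laplace[of _ "Re v"]) (use 0 integrable_HL_exp[of "Re v"] in auto)
  have "integral {0..R} ?h = (1 - exp (- v * of_real R)) / v" if "R \<ge> 0" for R
  proof (rule integral_unique)
    have "(?h has_integral (- exp (- v * of_real R) / v) - (- exp (- v * of_real 0) / v)) {0..R}"
      by (rule fundamental_theorem_of_calculus[OF that])
         (use v in \<open>auto intro!: derivative_eq_intros has_vector_derivative_real_field\<close>)
    then show "(?h has_integral (1 - exp (- v * of_real R)) / v) {0..R}"
      by (simp add: diff_divide_distrib)
  qed
  then have "\<forall>\<^sub>F R in at_top. integral {0..R} ?h = (1 - exp (- v * of_real R)) / v"
    by (rule eventually_at_top_linorderI)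
  then have "((\<lambda>R. (1 - exp (- v * of_real R)) / v) \<longlongrightarrow> Laplace (\<lambda>x. 1) v) at_top"
    using HL_tendsto[OF i] unfolding Laplace_def by (rule Lim_transform_eventually[rotated])
  moreover have "((\<lambda>R. exp (- v * of_real R)) \<longlongrightarrow> 0) at_top"
  proof (rule tendsto_norm_zero_cancel)
    have "((\<lambda>R. exp (- Re v * R)) \<longlongrightarrow> 0) at_top"
      using 0 by real_asymp
    then show "((\<lambda>R. norm (exp (- v * of_real R))) \<longlongrightarrow> 0) at_top" by simp
  qed
  then have "((\<lambda>R. (1 - exp (- v * of_real R)) / v) \<longlongrightarrow> (1 - 0) / v) at_top"
    by (intro tendsto_intros v)
  ultimately have "Laplace (\<lambda>x. 1) v = (1 - 0) / v"
    by (rule tendsto_unique[OF trivial_limit_at_top_linorder])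
  then show ?case by simp
next
  case (Suc n)
  have D: "(Laplace (\<lambda>x. of_real (x ^ n)) has_field_derivative Laplace (\<lambda>x. - of_real x * of_real (x ^ n)) v) (at v)"
  proof (rule Laplace_deriv)
    show "integrable HL (\<lambda>x. exp (- c * x) * norm (complex_of_real (x ^ n)))" if "c > 0" for c
    proof -
      have "integrable HL (\<lambda>x. x ^ n * exp (- c * x))" by (rule power_exp_HL(1)[OF that])
      then have "integrable HL (\<lambda>x. norm (x ^ n * exp (- c * x)))" by (rule integrable_norm)
      then show ?thesis by (simp add: abs_mult mult.commute norm_power power_abs)
    qed
  qed (use Suc.prems in auto)
  have v: "v \<noteq> 0" using Suc.prems by auto
  have E: "\<forall>\<^sub>F z in nhds v. Laplace (\<lambda>x. of_real (x ^ n)) z = fact n / z ^ Suc n"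
    using eventually_nhds_in_open[OF open_halfspace_Re_gt[of 0], of v] Suc.prems
    by (auto elim!: eventually_mono dest!: Suc.IH simp del: power_Suc of_real_power)
  have "(Laplace (\<lambda>x. of_real (x ^ n)) has_field_derivative - (fact (Suc n) / v ^ Suc (Suc n))) (at v)"
  proof (subst DERIV_cong_ev[OF refl E refl])
    have vn: "v ^ Suc n \<noteq> 0" using v by simp
    show "((\<lambda>z. fact n / z ^ Suc n) has_field_derivative - (fact (Suc n) / v ^ Suc (Suc n))) (at v)"
      unfolding divide_inverse
      by (rule DERIV_cong[OF DERIV_cmult[OF DERIV_inverse_fun[OF DERIV_power_Suc[OF DERIV_ident] vn]]])
         (use v in \<open>simp add: field_simps\<close>)
  qed
  with D have "Laplace (\<lambda>x. - of_real x * of_real (x ^ n)) v = - (fact (Suc n) / v ^ Suc (Suc n))"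
    by (rule DERIV_unique)
  moreover have "Laplace (\<lambda>x. - of_real x * of_real (x ^ n)) v = - Laplace (\<lambda>x. of_real (x ^ Suc n)) v"
    unfolding Laplace_def by (simp flip: integral_minus)
  ultimately show ?case by simp
qed

section \<open>The integrand on the ray of argument pi / 4\<close>

declare csqrt.simps [simp del]

text \<open>\<open>isq y\<close> is \<open>1 / sqrt (1 + s\<^sup>2)\<close> at the point \<open>s = om * y\<close> of the ray of argument \<open>\<pi> / 4\<close>.\<close>
definition isq :: "real \<Rightarrow> complex" where
  "isq y = inverse (csqrt (1 + \<i> * of_real (y\<^sup>2)))"

definition om :: complex where "om = cis (pi / 4)"

lemma om_power2: "om\<^sup>2 = \<i>"
  by (simp add: om_def Complex.DeMoivre)

lemma om_mult_om: "om * om = \<i>"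
  using om_power2 by (simp add: power2_eq_square)

lemma norm_om [simp]: "norm om = 1"
  by (simp add: om_def)

lemma om_nonzero [simp]: "om \<noteq> 0"
  by (simp add: om_def)

lemma Re_om: "Re om = sqrt 2 / 2" and Im_om: "Im om = sqrt 2 / 2"
  by (simp_all add: om_def cos_45 sin_45)

lemma one_plus_i_notin_nonpos: "1 + \<i> * of_real x \<notin> \<real>\<^sub>\<le>\<^sub>0"
  by (auto simp: complex_nonpos_Reals_iff)

lemma one_plus_i_nonzero: "1 + \<i> * of_real x \<noteq> 0"
  by (simp add: complex_eq_iff)

lemma continuous_on_isq: "continuous_on A isq"
  unfolding isq_def
  by (intro continuous_intros continuous_on_compose2[OF continuous_on_csqrt])
     (auto simp: one_plus_i_notin_nonpos one_plus_i_nonzero simp del: of_real_power)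

lemma isq_measurable [measurable]: "isq \<in> borel_measurable borel"
  by (intro borel_measurable_continuous_onI continuous_on_isq)

lemma norm_isq_le_1: "norm (isq y) \<le> 1"
  and norm_isq_le_inverse: "y > 0 \<Longrightarrow> norm (isq y) \<le> 1 / y"
proof -
  have n: "norm (1 + \<i> * of_real (y\<^sup>2)) = sqrt (1 + (y\<^sup>2)\<^sup>2)"
    by (simp add: cmod_def)
  define q where "q = sqrt (sqrt (1 + (y\<^sup>2)\<^sup>2))"
  have e: "norm (isq y) = 1 / q"
    unfolding isq_def norm_inverse norm_csqrt n q_def by (simp add: divide_inverse)
  have q: "1 \<le> q" unfolding q_def by simp
  then show "norm (isq y) \<le> 1" unfolding e by simp
  have "y \<le> q" if "y > 0"
    unfolding q_def using that by (intro real_le_rsqrt) auto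
  then show "norm (isq y) \<le> 1 / y" if "y > 0"
    unfolding e using that q by (intro divide_left_mono) auto
qed

text \<open>Interpolation between the bounds 1 and 1 / y. At y = \<rho> / (2 cosh x) the bound 1 / y
  would cancel the factor 1 / cosh x of \<open>psi\<close>; a positive \<eta> keeps some decay in
  x.\<close>

lemma norm_isq_le_powr:
  assumes "y > 0" "0 \<le> \<eta>" "\<eta> \<le> 1"
  shows "norm (isq y) \<le> y powr (- (1 - \<eta>))"
proof (cases "y \<le> 1")
  case True
  have "1 powr (- (1 - \<eta>)) \<le> y powr (- (1 - \<eta>))"
    using assms True by (intro powr_mono2') auto
  then show ?thesis using norm_isq_le_1[of y] by simp
next
  case False
  then have "y powr (-1) \<le> y powr (- (1 - \<eta>))"
    using assms by (intro powr_mono) auto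
  then show ?thesis using norm_isq_le_inverse[of y] assms by (simp add: powr_minus_divide)
qed

text \<open>The binomial coefficient of \<open>-1/2\<close> over \<open>n\<close>.\<close>
definition bcoef :: "nat \<Rightarrow> real" where
  "bcoef n = (-1) ^ n * of_nat (odd_dfact n) / (2 ^ n * fact n)"

text \<open>Taylor's formula for (1 + z)^(-1/2) on the half-plane Re z \<ge> 0. There |1 + z| \<ge>
  1, so every derivative is bounded and the remainder estimate holds for all y, not only inside the
  disc of convergence. This is what later makes the asymptotic expansion of Q elementary.\<close>

lemma isq_expansion:
  "\<exists>C\<ge>0. \<forall>y. norm (isq y - (\<Sum>n<N. of_real (bcoef n) * (\<i> * of_real (y\<^sup>2)) ^ n)) \<le> C * \<bar>y\<bar> ^ (2 * N)"
proof (cases N)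
  case 0
  then show ?thesis using norm_isq_le_1 by (intro exI[of _ 1]) auto
next
  case (Suc m)
  let ?p = "\<lambda>z. inverse (csqrt (1 + z))"
  let ?z = "\<lambda>y::real. \<i> * complex_of_real (y\<^sup>2)"
  let ?E = "\<lambda>y::real. \<Sum>n<N. of_real (bcoef n) * (?z y) ^ n"
  define S where "S = {z. Re z \<ge> (0::real)}"
  \<comment> \<open>The n-th derivative of (1 + z)^(-1/2), written with integer powers so that only
    \<open>csqrt\<close> has a branch cut.\<close>
  define f :: "nat \<Rightarrow> complex \<Rightarrow> complex" where
    "f = (\<lambda>n z. of_real (bcoef n * fact n) * (inverse (csqrt (1 + z)) * inverse (1 + z) ^ n))"
  have D: "(f n has_field_derivative f (Suc n) z) (at z within S)" if "z \<in> S" for n z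
  proof -
    have z: "1 + z \<notin> \<real>\<^sub>\<le>\<^sub>0" using that by (auto simp: complex_nonpos_Reals_iff S_def)
    have z0: "1 + z \<noteq> 0" using z by auto
    define s where "s = csqrt (1 + z)"
    have s: "s \<noteq> 0" "1 + z = s\<^sup>2" using z0 by (auto simp: s_def)
    have "((\<lambda>z. csqrt (1 + z)) has_field_derivative 1 / (2 * s)) (at z within S)"
      unfolding s_def by (rule has_field_derivative_csqrt'[where f="\<lambda>z. 1 + z", OF _ z]) (auto intro!: derivative_eq_intros)
    then have "(?p has_field_derivative
        - (1 / (2 * s) * inverse (csqrt (1 + z) ^ Suc (Suc 0)))) (at z within S)"
      by (rule DERIV_inverse_fun) (rule s(1)[unfolded s_def])
    moreover have "- (1 / (2 * s) * inverse (csqrt (1 + z) ^ Suc (Suc 0))) = - (1 / (2 * s)) / s\<^sup>2"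
      unfolding s_def[symmetric] by (simp only: numeral_2_eq_2 divide_inverse mult_minus_left)
    ultimately have "(?p has_field_derivative - (1 / (2 * s)) / s\<^sup>2) (at z within S)"
      by simp
    note this[THEN DERIV_mult]
    moreover have "((\<lambda>z. inverse (1 + z) ^ n) has_field_derivative - of_nat n * inverse (1 + z) ^ Suc n) (at z within S)"
    proof (cases n)
      case (Suc k)
      have "((\<lambda>z. inverse (1 + z)) has_field_derivative - (1 * inverse ((1 + z) ^ Suc (Suc 0)))) (at z within S)"
        by (rule DERIV_inverse_fun[where f="\<lambda>z. 1 + z", OF _ z0]) (auto intro!: derivative_eq_intros)
      from DERIV_power_Suc[OF this, of k] show ?thesis
        unfolding Suc
      proof (rule DERIV_cong)
        have "(1 + of_nat k) * (- (1 * q ^ Suc (Suc 0)) * q ^ k) = - of_nat (Suc k) * q ^ Suc (Suc k)" for q :: complex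
          by (simp add: algebra_simps)
        from this[of "inverse (1 + z)"]
        show "(1 + of_nat k) * (- (1 * inverse ((1 + z) ^ Suc (Suc 0))) * inverse (1 + z) ^ k) =
            - of_nat (Suc k) * inverse (1 + z) ^ Suc (Suc k)"
          by (simp only: power_inverse)
      qed
    qed simp
    ultimately have "((\<lambda>z. inverse (csqrt (1 + z)) * inverse (1 + z) ^ n) has_field_derivative
        (- (1 / (2 * s)) / s\<^sup>2) * inverse (1 + z) ^ n + - of_nat n * inverse (1 + z) ^ Suc n * inverse s) (at z within S)"
      unfolding s_def by blast
    moreover have "(- (1 / (2 * s)) / s\<^sup>2) * inverse (1 + z) ^ n + - of_nat n * inverse (1 + z) ^ Suc n * inverse s
       = of_real (- (of_nat (2 * n + 1) / 2)) * (inverse s * inverse (1 + z) ^ Suc n)"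
      unfolding s(2) using s(1) by (simp add: field_simps)
    ultimately have "(f n has_field_derivative of_real (bcoef n * fact n) *
        (of_real (- (of_nat (2 * n + 1) / 2)) * (inverse s * inverse (1 + z) ^ Suc n))) (at z within S)"
      unfolding f_def by (intro DERIV_cmult) simp
    moreover have E: "bcoef (Suc n) * fact (Suc n) = bcoef n * fact n * (- (of_nat (2 * n + 1) / 2))"
    proof -
      have b: "bcoef n * fact n = (-1) ^ n * of_nat (odd_dfact n) / 2 ^ n" for n
        by (simp add: bcoef_def)
      have "odd_dfact (Suc n) = odd_dfact n * (2 * n + 1)"
        by (simp add: odd_dfact_def)
      then show ?thesis unfolding b by (simp add: field_simps)
    qed
    ultimately show ?thesis
      unfolding f_def E by (simp only: s_def of_real_mult mult.assoc)
  qed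
  define B where "B = \<bar>bcoef N * fact N\<bar>"
  have Bd: "norm (f N z) \<le> B" if "z \<in> S" for z
  proof -
    have "1 \<le> norm (1 + z)"
      using that complex_Re_le_cmod[of "1 + z"] by (simp add: S_def)
    then have "inverse (sqrt (norm (1 + z))) * inverse (norm (1 + z)) ^ N \<le> 1 * 1"
      by (intro mult_mono power_le_one) (auto simp: inverse_le_1_iff)
    then show ?thesis
      unfolding f_def B_def norm_mult norm_power norm_inverse norm_csqrt norm_of_real
      by (intro mult_left_le) auto
  qed
  have "norm (isq y - ?E y) \<le> B / fact m * \<bar>y\<bar> ^ (2 * N)" for y
  proof -
    have "norm (f 0 (?z y) - (\<Sum>i\<le>m. f i 0 * (?z y - 0) ^ i / fact i))
       \<le> B * norm (?z y - 0) ^ Suc m / fact m"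
    proof (rule complex_Taylor[of S])
      show "convex S" unfolding S_def by (rule convex_halfspace_Re_ge)
    qed (use D Bd Suc in \<open>auto simp: S_def\<close>)
    moreover have "f 0 (?z y) = isq y"
      by (simp add: f_def isq_def bcoef_def odd_dfact_def)
    moreover have "(\<Sum>i\<le>m. f i 0 * (?z y - 0) ^ i / fact i) = ?E y"
      unfolding Suc lessThan_Suc_atMost by (rule sum.cong) (auto simp: f_def)
    moreover have "norm (?z y - 0) ^ Suc m = \<bar>y\<bar> ^ (2 * N)"
    proof -
      have "norm (?z y - 0) = \<bar>y\<bar>\<^sup>2" by (simp add: norm_mult norm_power)
      then show ?thesis by (simp only: Suc power_mult)
    qed
    ultimately show ?thesis by (simp add: mult.commute)
  qed
  then show ?thesis by (intro exI[of _ "B / fact m"]) (auto simp: B_def)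
qed

lemma integrable_exp_isq:
  assumes "c > 0" shows "integrable HL (\<lambda>x. exp (- c * x) * norm (om * isq x))"
proof (rule Bochner_Integration.integrable_bound[OF integrable_HL_exp[OF assms]])
  show "(\<lambda>x. exp (- c * x) * norm (om * isq x)) \<in> borel_measurable HL"
    by measurable
  show "AE x in HL. norm (exp (- c * x) * norm (om * isq x)) \<le> norm (exp (- c * x))"
    by (rule AE_I2) (simp add: norm_mult norm_isq_le_1 mult_left_le)
qed

text \<open>The transform L with the path parametrised by s = \<open>om\<close> x; the factor
  \<open>om\<close> beside \<open>isq\<close> is ds / dx.\<close>

definition Lfun :: "complex \<Rightarrow> complex" where
  "Lfun w = Laplace (\<lambda>x. om * isq x) (om * w)"

section \<open>The substitution s = sinh z on the ray\<close>

lemma sinh_complex_Re_Im: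
  "sinh (Complex x y) = Complex (sinh x * cos y) (cosh x * sin y)"
proof -
  have "sinh (Complex x y) = sinh (of_real x + \<i> * of_real y)"
    by (simp add: Complex_eq)
  also have "\<dots> = sinh (of_real x) * cosh (\<i> * of_real y) + cosh (of_real x) * sinh (\<i> * of_real y)"
    by (rule sinh_add)
  also have "cosh (\<i> * of_real y) = of_real (cos y)"
    by (simp add: cosh_conv_cos flip: cos_of_real)
  also have "sinh (\<i> * of_real y) = \<i> * of_real (sin y)"
    by (simp add: sinh_conv_sin flip: sin_of_real)
  finally show ?thesis
    by (simp add: complex_eq_iff sinh_def cosh_def Re_exp Im_exp)
qed

text \<open>\<open>asinh_ray R\<close> is the inverse hyperbolic sine of the point \<open>om * R\<close> of the ray.\<close>
definition asinh_ray :: "real \<Rightarrow> complex" where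
  "asinh_ray R = Ln (om * of_real R + csqrt (1 + \<i> * of_real (R\<^sup>2)))"

context
  fixes R :: real and s z :: complex
  assumes R: "R \<ge> 0"
  defines "s \<equiv> csqrt (1 + \<i> * of_real (R\<^sup>2))"
  defines "z \<equiv> om * of_real R + s"
begin

lemma s_square: "s\<^sup>2 = 1 + \<i> * of_real (R\<^sup>2)" by (simp add: s_def)

lemma s_pos: "Re s > 0" "Im s \<ge> 0"
proof -
  have "Re s \<ge> 0" unfolding s_def using csqrt_principal[of "1 + \<i> * of_real (R\<^sup>2)"] by linarith
  moreover have "Re (s\<^sup>2) = 1" unfolding s_square by simp
  then have "Re s \<noteq> 0" by (auto simp: power2_eq_square) (smt (verit) zero_le_square)
  ultimately show "Re s > 0" by simp
  have "Im (s\<^sup>2) \<ge> 0" unfolding s_square by simp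
  then show "Im s \<ge> 0" using \<open>Re s > 0\<close> by (simp add: power2_eq_square zero_le_mult_iff)
qed

lemma z_pos: "Re z > 0" "Im z \<ge> 0" 
  using s_pos R by (auto simp: z_def Re_om Im_om intro: add_nonneg_pos add_nonneg_nonneg)

lemma z_inverse: "inverse z = s - om * of_real R"
proof -
  have "z * (s - om * of_real R) = s\<^sup>2 - om\<^sup>2 * of_real (R\<^sup>2)"
    by (simp add: z_def algebra_simps power2_eq_square)
  also have "\<dots> = 1" by (simp add: s_square om_power2)
  finally show ?thesis by (rule inverse_unique)
qed

lemma sinh_asinh_ray: "sinh (asinh_ray R) = om * of_real R"
proof -
  have "asinh_ray R = Ln z" by (simp add: asinh_ray_def z_def s_def)
  moreover have "z \<noteq> 0" using z_pos by auto
  ultimately show ?thesis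
    using z_inverse by (simp add: sinh_def exp_minus scaleR_conv_of_real) (simp add: z_def)
qed

lemma asinh_ray_Im: "0 \<le> Im (asinh_ray R)" "Im (asinh_ray R) \<le> pi / 2"
proof -
  have e: "asinh_ray R = Ln z" by (simp add: asinh_ray_def z_def s_def)
  have z: "z \<noteq> 0" using z_pos by auto
  show "0 \<le> Im (asinh_ray R)" using z_pos z unfolding e using Im_Ln_pos_le by blast
  show "Im (asinh_ray R) \<le> pi / 2" using z_pos(1) Re_Ln_pos_lt[OF z] unfolding e by auto
qed

lemma asinh_ray_deriv:
  "(asinh_ray has_vector_derivative om * isq R) (at R within A)"
proof -
  have s: "s \<noteq> 0" using s_pos by auto
  have z: "z \<notin> \<real>\<^sub>\<le>\<^sub>0" "z \<noteq> 0" using z_pos by (auto simp: complex_nonpos_Reals_iff)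
  have n: "1 + \<i> * (of_real R)\<^sup>2 \<notin> \<real>\<^sub>\<le>\<^sub>0" using one_plus_i_notin_nonpos[of "R\<^sup>2"] by simp
  have "((\<lambda>x. 1 + \<i> * x\<^sup>2) has_field_derivative \<i> * (2 * of_real R)) (at (of_real R))"
    by (auto intro!: derivative_eq_intros)
  from has_field_derivative_csqrt'[OF this n]
  have "((\<lambda>x. om * x + csqrt (1 + \<i> * x\<^sup>2)) has_field_derivative om + (\<i> * (2 * of_real R)) / (2 * s)) (at (of_real R))"
    by (intro DERIV_add) (auto intro!: derivative_eq_intros simp: s_def)
  then have "((\<lambda>x. Ln (om * x + csqrt (1 + \<i> * x\<^sup>2))) has_field_derivative
    inverse z * (om + (\<i> * (2 * of_real R)) / (2 * s))) (at (of_real R))"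
    by (rule DERIV_chain2[rotated]) (use z in \<open>auto intro!: has_field_derivative_Ln simp: z_def s_def\<close>)
  moreover have "inverse z * (om + (\<i> * (2 * of_real R)) / (2 * s)) = om * isq R"
  proof -
    have "om + (\<i> * (2 * of_real R)) / (2 * s) = om * z / s"
    proof -
      have "om * z = om * s + \<i> * of_real R"
        by (simp add: z_def distrib_left om_mult_om flip: mult.assoc)
      then have "om * z / s = (om * s + \<i> * of_real R) / s" by (simp only:)
      also have "\<dots> = om + \<i> * of_real R / s"
        using s by (metis add_divide_distrib nonzero_mult_div_cancel_right)
      also have "\<i> * of_real R / s = 2 * (\<i> * of_real R) / (2 * s)"
        by (rule mult_divide_mult_cancel_left[symmetric]) simp
      also have "2 * (\<i> * of_real R) = \<i> * (2 * of_real R)"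
        by (rule mult.left_commute)
      finally show ?thesis by (rule sym)
    qed
    then have "inverse z * (om + (\<i> * (2 * of_real R)) / (2 * s)) = inverse z * (om * z / s)"
      by (simp only:)
    also have "\<dots> = om * inverse s"
      proof -
      have "inverse z * (om * z / s) = (inverse z * z) * (om * inverse s)"
        by (simp only: divide_inverse mult_ac)
      then show ?thesis using z(2) by simp
    qed
    also have "inverse s = isq R"
      by (simp add: isq_def s_def)
    finally show ?thesis .
  qed
  ultimately have "((\<lambda>x. Ln (om * x + csqrt (1 + \<i> * x\<^sup>2))) has_field_derivative om * isq R) (at (of_real R))"
    by simp
  from has_vector_derivative_real_field[OF this]
  show ?thesis unfolding asinh_ray_def by simp
qed

text \<open>Real and imaginary parts of sinh z = \<open>om\<close> R. They are the exact decay
  exponents on the vertical segments that join \<open>asinh_ray R\<close> to the edges Im z = 0 and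
  Im z = pi/2 of the strip; the last bound forces the real part to infinity with R.\<close>

lemma asinh_ray_parts:
  "sinh (Re (asinh_ray R)) * cos (Im (asinh_ray R)) = R * sqrt 2 / 2"
  "cosh (Re (asinh_ray R)) * sin (Im (asinh_ray R)) = R * sqrt 2 / 2"
  "Re (asinh_ray R) \<ge> 0"
  "cosh (Re (asinh_ray R)) \<ge> R"
proof -
  let ?a = "asinh_ray R"
  have e: "Complex (sinh (Re ?a) * cos (Im ?a)) (cosh (Re ?a) * sin (Im ?a)) = om * of_real R"
    using sinh_complex_Re_Im[of "Re ?a" "Im ?a"] sinh_asinh_ray by simp
  show 1: "sinh (Re ?a) * cos (Im ?a) = R * sqrt 2 / 2"
    using arg_cong[OF e, of Re] by (simp add: Re_om)
  show 2: "cosh (Re ?a) * sin (Im ?a) = R * sqrt 2 / 2"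
    using arg_cong[OF e, of Im] by (simp add: Im_om)
  show 3: "Re (asinh_ray R) \<ge> 0"
  proof (rule ccontr)
    assume neg: "\<not> Re ?a \<ge> 0"
    have "asinh_ray R = Ln z" by (simp add: asinh_ray_def z_def s_def)
    moreover have "norm z \<ge> 1"
    proof -
      \<comment> \<open>\<open>z\<close> and its inverse are \<open>s\<close> plus and minus
        \<open>om * R\<close>. Both summands lie in the closed first quadrant, so their inner
        product is nonnegative and the sum is at least as long as the difference.\<close>
      have "Re s * Re (om * of_real R) + Im s * Im (om * of_real R) \<ge> 0"
        using s_pos R by (auto simp: Re_om Im_om)
      then have "norm (s - om * of_real R) \<le> norm (s + om * of_real R)"
        unfolding cmod_def by (intro real_sqrt_le_mono) (simp add: power2_diff power2_sum algebra_simps)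
      then have "norm (inverse z) \<le> norm z"
        unfolding z_inverse by (simp add: z_def add.commute)
      moreover have "norm (inverse z) * norm z = 1" using z_pos(1) by (cases "z = 0") (simp_all add: norm_inverse)
      ultimately have "1 \<le> norm z * norm z"
        by (metis mult_right_mono norm_ge_zero)
      then have "1\<^sup>2 \<le> (norm z)\<^sup>2"
        by (simp add: power2_eq_square)
      then show ?thesis
        by (rule power2_le_imp_le) simp
    qed
    ultimately show False using neg z_pos(1) by (cases "z = 0") (simp_all add: ln_ge_zero)
  qed
  have "R\<^sup>2 = (sinh (Re ?a) * cos (Im ?a))\<^sup>2 + (cosh (Re ?a) * sin (Im ?a))\<^sup>2"
    unfolding 1 2 by (simp add: power_divide power_mult_distrib)
  also have "\<dots> \<le> (cosh (Re ?a))\<^sup>2 * ((cos (Im ?a))\<^sup>2 + (sin (Im ?a))\<^sup>2)"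
    unfolding distrib_left power_mult_distrib
    by (intro add_mono mult_right_mono) (simp_all add: cosh_square_eq)
  finally have "R\<^sup>2 \<le> (cosh (Re ?a))\<^sup>2"
    by (simp only: sin_cos_squared_add2 mult_1_right)
  then show "cosh (Re (asinh_ray R)) \<ge> R"
    by (rule power2_le_imp_le) simp
qed

end

section \<open>The Struve-type transform\<close>

text \<open>Contour shifts of entire integrands are carried out with a primitive: independence of
  the path becomes a telescoping of its values at the corners.\<close>

lemma entire_primitive:
  assumes "f holomorphic_on UNIV"
  obtains \<Psi> where "\<And>z. (\<Psi> has_field_derivative f z) (at z)"
  using holomorphic_convex_primitive'[of UNIV f] assms by auto

context
  fixes \<Psi> f :: "complex \<Rightarrow> complex"
  assumes prim: "\<And>z. (\<Psi> has_field_derivative f z) (at z)"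
begin

lemma primitive_horizontal:
  assumes "a \<le> b"
  shows "((\<lambda>x. f (Complex x y)) has_integral \<Psi> (Complex b y) - \<Psi> (Complex a y)) {a..b}"
proof (rule fundamental_theorem_of_calculus[OF assms])
  fix x
  have "((\<lambda>x. Complex x y) has_vector_derivative 1) (at x within {a..b})"
    unfolding Complex_eq by (auto intro!: derivative_eq_intros)
  from field_vector_diff_chain_within[OF this has_field_derivative_at_within[OF prim]]
  show "((\<lambda>x. \<Psi> (Complex x y)) has_vector_derivative f (Complex x y)) (at x within {a..b})"
    by (simp add: o_def)
qed

lemma primitive_vertical:
  assumes "a \<le> b"
  shows "((\<lambda>y. \<i> * f (Complex x y)) has_integral \<Psi> (Complex x b) - \<Psi> (Complex x a)) {a..b}"
proof (rule fundamental_theorem_of_calculus[OF assms])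
  fix y
  have "((\<lambda>y. Complex x y) has_vector_derivative \<i>) (at y within {a..b})"
    unfolding Complex_eq by (auto intro!: derivative_eq_intros)
  from field_vector_diff_chain_within[OF this has_field_derivative_at_within[OF prim]]
  show "((\<lambda>y. \<Psi> (Complex x y)) has_vector_derivative \<i> * f (Complex x y)) (at y within {a..b})"
    by (simp add: o_def)
qed

lemma primitive_vertical_bound:
  assumes "a \<le> b" "\<And>y. y \<in> {a..b} \<Longrightarrow> norm (f (Complex x y)) \<le> B"
  shows "norm (\<Psi> (Complex x b) - \<Psi> (Complex x a)) \<le> B * (b - a)"
proof -
  have "norm (f (Complex x a)) \<le> B" using assms(1) by (intro assms(2)) simp
  then have "B \<ge> 0" by (rule order_trans[OF norm_ge_zero])
  moreover have "\<forall>y\<in>{a..b} - {}. norm (\<i> * f (Complex x y)) \<le> B"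
    using assms(2) by (simp add: norm_mult)
  ultimately have "norm (\<Psi> (Complex x b) - \<Psi> (Complex x a)) \<le> B * measure lborel {a..b}"
    by (intro has_integral_bound_real[OF _ finite.emptyI primitive_vertical[OF assms(1)]]) auto
  then show ?thesis using assms(1) by simp
qed

end

context
  fixes w :: complex and \<Psi> :: "complex \<Rightarrow> complex"
  assumes w: "Re (om * w) > 0"
  assumes prim: "\<And>z. (\<Psi> has_field_derivative exp (- w * sinh z)) (at z)"
begin

text \<open>The substitution \<open>om\<close> x = sinh z cancels the square root and turns the ray
  into the curve \<open>asinh_ray\<close>, along which the entire function exp (- w sinh z) is
  integrated.\<close>

lemma Lfun_limit: "((\<lambda>R. \<Psi> (asinh_ray R) - \<Psi> 0) \<longlongrightarrow> Lfun w) at_top"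
proof (rule Lim_transform_eventually)
  let ?h = "\<lambda>x. exp (- (om * w) * of_real x) * (om * isq x)"
  have "integrable HL ?h"
    by (rule integrable_Laplace[OF _ integrable_exp_isq[OF w]]) (auto simp: borel_measurable_HL)
  from HL_tendsto[OF this]
  show "((\<lambda>R. integral {0..R} ?h) \<longlongrightarrow> Lfun w) at_top"
    by (simp add: Lfun_def Laplace_def)
  have "integral {0..R} ?h = \<Psi> (asinh_ray R) - \<Psi> 0" if "R \<ge> 0" for R
  proof (rule integral_unique)
    have "(?h has_integral \<Psi> (asinh_ray R) - \<Psi> (asinh_ray 0)) {0..R}"
    proof (rule fundamental_theorem_of_calculus[OF that])
      fix x assume "x \<in> {0..R}"
      then have x: "x \<ge> 0" by simp
      from field_vector_diff_chain_within[OF asinh_ray_deriv[OF x] has_field_derivative_at_within[OF prim]]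
      show "((\<lambda>x. \<Psi> (asinh_ray x)) has_vector_derivative exp (- (om * w) * of_real x) * (om * isq x)) (at x within {0..R})"
        by (simp add: o_def sinh_asinh_ray[OF x] mult_ac)
    qed
    moreover have "asinh_ray 0 = 0" by (simp add: asinh_ray_def)
    ultimately show "(?h has_integral \<Psi> (asinh_ray R) - \<Psi> 0) {0..R}"
      by simp
  qed
  then show "\<forall>\<^sub>F R in at_top. integral {0..R} ?h = \<Psi> (asinh_ray R) - \<Psi> 0"
    by (rule eventually_at_top_linorderI)
qed

end

lemma exp_sinh_holomorphic: "(\<lambda>z. exp (- w * sinh z)) holomorphic_on A"
  unfolding sinh_def by (intro holomorphic_intros)

text \<open>The curve is replaced by the segment from 0 to Re (\<open>asinh_ray R\<close>), where
  the integrand is real, followed by a vertical segment. On the latter cos y \<ge> cos Y, so Re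
  (sinh z) is at least R sqrt 2 / 2 and the contribution vanishes as R grows.\<close>

lemma Lfun_real:
  assumes "x > 0" shows "Im (Lfun (of_real x)) = 0"
proof -
  let ?B = "\<lambda>R. exp (- x * (R * sqrt 2 / 2))"
  obtain \<Psi> where P: "\<And>z. (\<Psi> has_field_derivative exp (- complex_of_real x * sinh z)) (at z)"
    by (rule entire_primitive[OF exp_sinh_holomorphic[of "of_real x"]]) (rule that) 
  let ?d = "\<lambda>R. \<Psi> (asinh_ray R) - \<Psi> 0"
  have "Re (om * of_real x) > 0" using assms by (simp add: Re_om)
  from tendsto_Im[OF Lfun_limit[OF this P]]
  have 1: "((\<lambda>R. Im (?d R)) \<longlongrightarrow> Im (Lfun (of_real x))) at_top" .
  have "((\<lambda>R. Im (?d R)) \<longlongrightarrow> 0) at_top"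
  proof (rule Lim_null_comparison)
    show "((\<lambda>R. ?B R * (pi / 2)) \<longlongrightarrow> 0) at_top"
      using assms by real_asymp
    have "norm (Im (?d R)) \<le> ?B R * (pi / 2)" if R: "R \<ge> 0" for R
    proof -
      define X where "X = Re (asinh_ray R)"
      define Y where "Y = Im (asinh_ray R)"
      have XY: "asinh_ray R = Complex X Y" by (simp add: X_def Y_def)
      have X: "X \<ge> 0" "sinh X * cos Y = R * sqrt 2 / 2" using asinh_ray_parts[OF R] by (simp_all add: X_def Y_def)
      have Y: "0 \<le> Y" "Y \<le> pi / 2" using asinh_ray_Im[OF R] by (simp_all add: Y_def)
      have "norm (\<Psi> (Complex X Y) - \<Psi> (Complex X 0)) \<le> ?B R * (Y - 0)"
      proof (rule primitive_vertical_bound[OF P Y(1)])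
        fix y assume y: "y \<in> {0..Y}"
        have "cos Y \<le> cos y" using y Y by (intro cos_monotone_0_pi_le) auto
        then have "sinh X * cos Y \<le> sinh X * cos y" using X by (intro mult_left_mono) auto
        then show "norm (exp (- of_real x * sinh (Complex X y))) \<le> ?B R"
          using assms X(2) by (simp add: sinh_complex_Re_Im)
      qed
      also have "\<dots> \<le> ?B R * (pi / 2)" using Y by (intro mult_left_mono) auto
      finally have 2: "norm (\<Psi> (Complex X Y) - \<Psi> (Complex X 0)) \<le> ?B R * (pi / 2)" .
      have "((\<lambda>u. exp (- of_real x * sinh (Complex u 0))) has_integral \<Psi> (Complex X 0) - \<Psi> (Complex 0 0)) {0..X}"
        by (rule primitive_horizontal[OF P X(1)])
      then have "((\<lambda>u. Im (exp (- of_real x * sinh (Complex u 0)))) has_integral Im (\<Psi> (Complex X 0) - \<Psi> (Complex 0 0))) {0..X}"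
        by (rule has_integral_Im)
      moreover have "(\<lambda>u. Im (exp (- of_real x * sinh (Complex u 0)))) = (\<lambda>u. 0)"
        by (simp add: sinh_complex_Re_Im Im_exp)
      ultimately have "Im (\<Psi> (Complex X 0) - \<Psi> (Complex 0 0)) = 0"
        using has_integral_unique[OF has_integral_0] by metis
      then have "Im (?d R) = Im (\<Psi> (Complex X Y) - \<Psi> (Complex X 0))"
        by (simp add: XY complex_eq_0 flip: zero_complex.code)
      then show ?thesis using 2 abs_Im_le_cmod[of "\<Psi> (Complex X Y) - \<Psi> (Complex X 0)"] by simp
    qed
    then show "\<forall>\<^sub>F R in at_top. norm (Im (?d R)) \<le> ?B R * (pi / 2)"
      by (rule eventually_at_top_linorderI)
  qed
  with 1 show ?thesis using tendsto_unique[OF trivial_limit_at_top_linorder] by blast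
qed

lemma cosh_ge_self: "x \<le> cosh (x::real)"
proof (cases "x \<ge> 0")
  case True
  have "1 + x + x\<^sup>2 / 2 \<le> exp x" by (rule exp_lower_Taylor_quadratic[OF True])
  moreover have "0 \<le> (x - 1)\<^sup>2" by (rule zero_le_power2)
  moreover have "2 * cosh x = exp x + exp (- x)" by (simp add: cosh_def)
  ultimately show ?thesis using exp_ge_zero[of "- x"] unfolding power2_diff power_one mult_1_right by linarith
next
  case False
  then show ?thesis using cosh_real_pos[of x] by linarith
qed

lemma integrable_K0:
  assumes "t > 0" shows "integrable HL (\<lambda>u. exp (- t * cosh u))"
proof (rule Bochner_Integration.integrable_bound[OF integrable_HL_exp[OF assms]])
  show "AE x in HL. norm (exp (- t * cosh x)) \<le> norm (exp (- t * x))"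
    using assms cosh_ge_self by (intro AE_I2) simp
qed (auto intro!: borel_measurable_HL borel_measurable_continuous_onI continuous_intros)

lemma bessel_K0_eq: "t > 0 \<Longrightarrow> bessel_K0 t = (\<integral>u. exp (- t * cosh u) \<partial>HL)"
  unfolding bessel_K0_def using integral_HL(1)[OF integrable_K0] by (rule integral_unique)

lemma bessel_K0_nonneg: "t > 0 \<Longrightarrow> bessel_K0 t \<ge> 0"
  unfolding bessel_K0_eq by (rule integral_nonneg_AE) simp

lemma exp_sinh_imag_axis: "exp (\<i> * of_real t * sinh (Complex 0 y)) = of_real (exp (- (t * sin y)))"
proof -
  have "\<i> * of_real t * sinh (Complex 0 y) = of_real (- (t * sin y))"
    by (simp add: sinh_complex_Re_Im complex_eq_iff)
  then show ?thesis by (simp only: exp_of_real)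
qed

lemma exp_sinh_shifted_axis: "exp (\<i> * of_real t * sinh (Complex u (pi / 2))) = of_real (exp (- (t * cosh u)))"
proof -
  have "\<i> * of_real t * sinh (Complex u (pi / 2)) = of_real (- (t * cosh u))"
    by (simp add: sinh_complex_Re_Im complex_eq_iff)
  then show ?thesis by (simp only: exp_of_real)
qed

text \<open>For w = - i t the integrand is exp (i t sinh z). The path first climbs from 0 to i pi/2,
  where the exponent is - t sin y, and then runs along Im z = pi/2, where it is - t cosh u and
  yields \<open>bessel_K0\<close>. The closing vertical segment is small because sin is increasing
  up to pi/2, which bounds t cosh X sin y below by t R sqrt 2 / 2.\<close>

lemma Lfun_imag:
  assumes "t > 0"
  shows "Lfun (- \<i> * of_real t) = of_real (bessel_K0 t) + \<i> * of_real (integral {0..pi / 2} (\<lambda>y. exp (- t * sin y)))"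
proof -
  let ?B = "\<lambda>R. exp (- t * (R * sqrt 2 / 2))"
  let ?w = "- \<i> * complex_of_real t"
  let ?g = "(\<lambda>u. exp (- t * cosh u))"
  obtain \<Psi> where P: "\<And>z. (\<Psi> has_field_derivative exp (- (?w) * sinh z)) (at z)"
    by (rule entire_primitive[OF exp_sinh_holomorphic[of "?w"]]) (rule that)
  let ?d = "\<lambda>R. \<Psi> (asinh_ray R) - \<Psi> 0"
  have "Re (om * (?w)) > 0" using assms by (simp add: Im_om)
  note 1 = Lfun_limit[OF this P]
  define V where "V = integral {0..pi / 2} (\<lambda>y. exp (- t * sin y))"
  let ?l = "\<lambda>X. complex_of_real (integral {0..X} ?g) + \<i> * of_real V"
  have V: "\<Psi> (Complex 0 (pi / 2)) - \<Psi> (Complex 0 0) = \<i> * of_real V"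
  proof -
    have "((\<lambda>y. \<i> * exp (- (?w) * sinh (Complex 0 y))) has_integral \<Psi> (Complex 0 (pi / 2)) - \<Psi> (Complex 0 0)) {0..pi / 2}"
      by (rule primitive_vertical[OF P]) simp
    moreover have "(\<lambda>y. \<i> * exp (- (?w) * sinh (Complex 0 y))) = (\<lambda>y. \<i> * of_real (exp (- t * sin y)))"
      by (simp add: exp_sinh_imag_axis)
    moreover have "((\<lambda>y. exp (- t * sin y)) has_integral V) {0..pi / 2}"
      unfolding V_def by (intro integrable_integral integrable_continuous_interval continuous_intros)
    then have "((\<lambda>y. \<i> * of_real (exp (- t * sin y))) has_integral (\<i> * of_real V)) {0..pi / 2}"
      by (intro has_integral_mult_right has_integral_of_real)
    ultimately show ?thesis using has_integral_unique by metis
  qed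
  have "((\<lambda>R. ?d R) \<longlongrightarrow> of_real (bessel_K0 t) + \<i> * of_real V) at_top"
  proof (rule Lim_transform[rotated])
    have "((\<lambda>R. integral {0..R} ?g) \<longlongrightarrow> bessel_K0 t) at_top"
      using HL_tendsto[OF integrable_K0[OF assms]] bessel_K0_eq[OF assms] by simp
    moreover have "filterlim (\<lambda>R. Re (asinh_ray R)) at_top at_top"
    proof (rule filterlim_at_top_mono)
      show "filterlim (\<lambda>R. ln R) at_top (at_top :: real filter)" by (rule ln_at_top)
      have "ln R \<le> Re (asinh_ray R)" if "R \<ge> 1" for R
      proof -
        have R: "R \<ge> 0" using that by simp
        have "R \<le> cosh (Re (asinh_ray R))" by (rule asinh_ray_parts(4)[OF R])
        also have "\<dots> \<le> exp (Re (asinh_ray R))" using asinh_ray_parts(3)[OF R] by (simp add: cosh_def)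
        finally show ?thesis using that by (metis ln_exp ln_le_cancel_iff exp_gt_zero less_le_trans zero_less_one)
      qed
      then show "\<forall>\<^sub>F R in at_top. ln R \<le> Re (asinh_ray R)" by (rule eventually_at_top_linorderI)
    qed
    ultimately have "((\<lambda>R. integral {0..Re (asinh_ray R)} ?g) \<longlongrightarrow> bessel_K0 t) at_top"
      by (rule filterlim_compose)
    then show "((\<lambda>R. of_real (integral {0..Re (asinh_ray R)} ?g) + \<i> * of_real V) \<longlongrightarrow> of_real (bessel_K0 t) + \<i> * of_real V) at_top"
      by (intro tendsto_intros)
    show "((\<lambda>R. ?d R - ?l (Re (asinh_ray R))) \<longlongrightarrow> 0) at_top"
    proof (rule Lim_null_comparison)
      show "((\<lambda>R. ?B R * (pi / 2)) \<longlongrightarrow> 0) at_top"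
        using assms by real_asymp
      have "norm (?d R - ?l (Re (asinh_ray R)))
         \<le> ?B R * (pi / 2)" if R: "R \<ge> 0" for R
      proof -
        define X where "X = Re (asinh_ray R)"
        define Y where "Y = Im (asinh_ray R)"
        have XY: "asinh_ray R = Complex X Y" by (simp add: X_def Y_def)
        have X: "X \<ge> 0" "cosh X * sin Y = R * sqrt 2 / 2" using asinh_ray_parts[OF R] by (simp_all add: X_def Y_def)
        have Y: "0 \<le> Y" "Y \<le> pi / 2" using asinh_ray_Im[OF R] by (simp_all add: Y_def)
        have "norm (\<Psi> (Complex X (pi / 2)) - \<Psi> (Complex X Y)) \<le> ?B R * (pi / 2 - Y)"
        proof (rule primitive_vertical_bound[OF P Y(2)])
          fix y assume y: "y \<in> {Y..pi/2}"
          have "sin Y \<le> sin y" using y Y by (intro sin_monotone_2pi_le) auto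
          then have "cosh X * sin Y \<le> cosh X * sin y" by (intro mult_left_mono) auto
          then show "norm (exp (- (?w) * sinh (Complex X y))) \<le> ?B R"
            using assms X(2) by (simp add: sinh_complex_Re_Im)
        qed
        also have "\<dots> \<le> ?B R * (pi / 2)" using Y by (intro mult_left_mono) auto
        finally have 2: "norm (\<Psi> (Complex X (pi / 2)) - \<Psi> (Complex X Y)) \<le> ?B R * (pi / 2)" .
        have "((\<lambda>u. exp (- (?w) * sinh (Complex u (pi / 2)))) has_integral \<Psi> (Complex X (pi / 2)) - \<Psi> (Complex 0 (pi / 2))) {0..X}"
          by (rule primitive_horizontal[OF P X(1)])
        moreover have "(\<lambda>u. exp (- (?w) * sinh (Complex u (pi / 2)))) = (\<lambda>u. of_real (exp (- t * cosh u)))"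
          by (simp add: exp_sinh_shifted_axis)
        moreover have "(?g has_integral (integral {0..X} ?g)) {0..X}"
          by (intro integrable_integral integrable_continuous_interval continuous_intros)
        then have "((\<lambda>u. complex_of_real (exp (- t * cosh u))) has_integral of_real (integral {0..X} ?g)) {0..X}"
          by (rule has_integral_of_real)
        ultimately have 3: "\<Psi> (Complex X (pi / 2)) - \<Psi> (Complex 0 (pi / 2)) = of_real (integral {0..X} ?g)"
          using has_integral_unique by metis
        have "?d R - ?l X
          = - (\<Psi> (Complex X (pi / 2)) - \<Psi> (Complex X Y))"
          unfolding V[symmetric] 3[symmetric] XY zero_complex.code[symmetric] by simp
        then show ?thesis using 2 unfolding X_def by (simp only: norm_minus_cancel)
      qed
      then show "\<forall>\<^sub>F R in at_top. norm (?d R - ?l (Re (asinh_ray R)))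
         \<le> ?B R * (pi / 2)"
        by (rule eventually_at_top_linorderI)
    qed
  qed
  with 1 show ?thesis unfolding V_def using tendsto_unique[OF trivial_limit_at_top_linorder] by blast
qed

section \<open>Product formulas for Bessel functions\<close>

declare ident_measurable_HL [measurable del]

lemma nn_integral_even:
  fixes f :: "real \<Rightarrow> real"
  assumes m [measurable]: "f \<in> borel_measurable borel" and even: "\<And>x. f (- x) = f x"
  shows "(\<integral>\<^sup>+x. ennreal (f x) \<partial>lborel) = 2 * (\<integral>\<^sup>+x. ennreal (f x) \<partial>HL)"
proof -
  let ?i = "\<integral>\<^sup>+x. ennreal (f x) * indicator {0..} x \<partial>lborel"
  have H: "(\<integral>\<^sup>+x. ennreal (f x) \<partial>HL) = ?i"
    unfolding HL_def by (subst nn_integral_restrict_space) auto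
  have "(\<integral>\<^sup>+x. ennreal (f x) \<partial>lborel) = (\<integral>\<^sup>+x. ennreal (f x) * indicator {0..} x + ennreal (f x) * indicator {..0} x \<partial>lborel)"
  proof (rule nn_integral_cong_AE)
    show "AE x in lborel. ennreal (f x) = ennreal (f x) * indicator {0..} x + ennreal (f x) * indicator {..0} x"
      using AE_lborel_singleton[of 0] by eventually_elim (auto simp: indicator_def)
  qed
  also have "\<dots> = ?i + (\<integral>\<^sup>+x. ennreal (f x) * indicator {..0} x \<partial>lborel)"
    by (rule nn_integral_add) measurable
  also have "(\<integral>\<^sup>+x. ennreal (f x) * indicator {..0} x \<partial>lborel) = ?i"
    by (subst nn_integral_real_affine[where c="-1" and t=0]) (auto simp: even indicator_def intro!: nn_integral_cong)
  finally show ?thesis unfolding H by (simp add: mult_2)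
qed

lemma nn_integral_K0:
  assumes "t > 0"
  shows "(\<integral>\<^sup>+u. ennreal (exp (- t * cosh u)) \<partial>lborel) = ennreal (2 * bessel_K0 t)"
proof -
  have "(\<integral>\<^sup>+u. ennreal (exp (- t * cosh u)) \<partial>lborel) = 2 * (\<integral>\<^sup>+u. ennreal (exp (- t * cosh u)) \<partial>HL)"
    by (rule nn_integral_even) (auto intro!: borel_measurable_continuous_onI continuous_intros)
  also have "(\<integral>\<^sup>+u. ennreal (exp (- t * cosh u)) \<partial>HL) = ennreal (bessel_K0 t)"
    unfolding bessel_K0_eq[OF assms] by (rule nn_integral_eq_integral[OF integrable_K0[OF assms]]) simp
  finally show ?thesis using bessel_K0_nonneg[OF assms] by (simp add: ennreal_mult' flip: ennreal_numeral)
qed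

text \<open>The identity maps the restricted measures measurably into \<open>borel\<close>, so
  measurability of a two-variable integrand can be proved over Borel pairs and pulled back.\<close>

lemma measurable_pair_coarser:
  assumes "(\<lambda>x. x) \<in> M \<rightarrow>\<^sub>M M'" "(\<lambda>x. x) \<in> N \<rightarrow>\<^sub>M N'" "f \<in> borel_measurable (M' \<Otimes>\<^sub>M N')"
  shows "f \<in> borel_measurable (M \<Otimes>\<^sub>M N)"
proof -
  have "(\<lambda>p. (fst p, snd p)) \<in> M \<Otimes>\<^sub>M N \<rightarrow>\<^sub>M M' \<Otimes>\<^sub>M N'"
    by (intro measurable_Pair measurable_compose[OF measurable_fst assms(1)] measurable_compose[OF measurable_snd assms(2)])
  from measurable_compose[OF this assms(3)] show ?thesis by simp
qed

lemmas measurable_pair_HL = measurable_pair_coarser[OF measurable_ident_sets[OF refl] ident_measurable_HL]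
lemmas measurable_pair_HLHL = measurable_pair_coarser[OF ident_measurable_HL ident_measurable_HL]

lemma cosh_pos [simp]: "cosh (x::real) > 0"
  by (rule cosh_real_pos)

lemma cosh_measurable [measurable]: "(cosh :: real \<Rightarrow> real) \<in> borel_measurable borel"
  by (intro borel_measurable_continuous_onI continuous_intros)

lemma bessel_K0_measurable: "(\<lambda>x. bessel_K0 (c * cosh x)) \<in> borel_measurable borel" if "c > 0"
proof -
  have "(\<lambda>x. \<integral>u. exp (- (c * cosh x) * cosh u) \<partial>HL) \<in> borel_measurable borel"
    by (rule HL.borel_measurable_lebesgue_integral, rule measurable_pair_HL) measurable
  moreover have "(\<lambda>x. bessel_K0 (c * cosh x)) = (\<lambda>x. \<integral>u. exp (- (c * cosh x) * cosh u) \<partial>HL)"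
    using that by (intro ext bessel_K0_eq) simp
  ultimately show ?thesis by (simp only:)
qed

text \<open>Four times the square is the integral of exp (- t (cosh u + cosh v)) over the plane.
  With u = a + b and v = a - b the sum becomes 2 cosh a cosh b, and integrating over a leaves
  \<open>bessel_K0\<close>. The change of variables is done one variable at a time, u = v + 2 b with
  factor 2 and then v = a - b. Working with nonnegative integrals makes integrability a consequence
  of finiteness.\<close>

lemma bessel_K0_square:
  assumes t: "t > 0"
  shows "integrable HL (\<lambda>x. bessel_K0 (2 * t * cosh x))"
    and "(bessel_K0 t)\<^sup>2 = 2 * (\<integral>x. bessel_K0 (2 * t * cosh x) \<partial>HL)"
proof -
  let ?k = "\<lambda>b. 2 * bessel_K0 (2 * t * cosh b)"
  define e where "e = (\<lambda>u. exp (- t * cosh u))"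
  have e [measurable]: "e \<in> borel_measurable borel" unfolding e_def by measurable
  let ?e = "\<lambda>v b. e v * e (v + 2 * b)"
  have m: "(\<lambda>x. bessel_K0 (2 * t * cosh x)) \<in> borel_measurable borel"
    by (rule bessel_K0_measurable) (use t in simp)
  have "ennreal (2 * bessel_K0 t) * ennreal (2 * bessel_K0 t)
      = (\<integral>\<^sup>+v. ennreal (e v) * (\<integral>\<^sup>+u. ennreal (e u) \<partial>lborel) \<partial>lborel)"
    unfolding e_def nn_integral_K0[OF t, symmetric] by (rule nn_integral_multc[symmetric]) measurable
  also have "\<dots> = (\<integral>\<^sup>+v. (\<integral>\<^sup>+u. ennreal (e v * e u) \<partial>lborel) \<partial>lborel)"
    by (intro nn_integral_cong) (simp add: nn_integral_cmult[symmetric] ennreal_mult' e_def)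
  also have "\<dots> = (\<integral>\<^sup>+v. 2 * (\<integral>\<^sup>+b. ennreal (?e v b) \<partial>lborel) \<partial>lborel)"
  proof (intro nn_integral_cong)
    fix v
    show "(\<integral>\<^sup>+u. ennreal (e v * e u) \<partial>lborel) = 2 * (\<integral>\<^sup>+b. ennreal (?e v b) \<partial>lborel)"
      by (subst nn_integral_real_affine[where c=2 and t=v]) (auto simp flip: ennreal_numeral)
  qed
  also have "\<dots> = 2 * (\<integral>\<^sup>+v. (\<integral>\<^sup>+b. ennreal (?e v b) \<partial>lborel) \<partial>lborel)"
    by (rule nn_integral_cmult) measurable
  also have "(\<integral>\<^sup>+v. (\<integral>\<^sup>+b. ennreal (?e v b) \<partial>lborel) \<partial>lborel)
      = (\<integral>\<^sup>+b. (\<integral>\<^sup>+v. ennreal (?e v b) \<partial>lborel) \<partial>lborel)"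
    by (rule lborel_pair.Fubini') measurable
  also have "\<dots> = (\<integral>\<^sup>+b. ennreal (?k b) \<partial>lborel)"
  proof (intro nn_integral_cong)
    fix b :: real
    have "(\<integral>\<^sup>+v. ennreal (?e v b) \<partial>lborel) = (\<integral>\<^sup>+a. ennreal (e (- b + a) * e (- b + a + 2 * b)) \<partial>lborel)"
      by (subst nn_integral_real_affine[where c=1 and t="- b"]) auto
    also have "\<dots> = (\<integral>\<^sup>+a. ennreal (exp (- (2 * t * cosh b) * cosh a)) \<partial>lborel)"
    proof (intro nn_integral_cong arg_cong[where f=ennreal])
      fix a
      have "cosh (- b + a) + cosh (- b + a + 2 * b) = 2 * cosh b * cosh a"
        using cosh_add[of a b] cosh_diff[of a b] by (simp add: algebra_simps)
      then show "e (- b + a) * e (- b + a + 2 * b) = exp (- (2 * t * cosh b) * cosh a)"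
        unfolding e_def mult_exp_exp by (simp add: algebra_simps flip: distrib_left)
    qed
    also have "\<dots> = ennreal (?k b)"
      by (rule nn_integral_K0) (use t in simp)
    finally show "(\<integral>\<^sup>+v. ennreal (?e v b) \<partial>lborel) = ennreal (?k b)" .
  qed
  also have "\<dots> = 2 * (\<integral>\<^sup>+b. ennreal (?k b) \<partial>HL)"
    by (rule nn_integral_even) (use m in auto)
  finally have "ennreal (2 * bessel_K0 t) * ennreal (2 * bessel_K0 t)
      = 2 * (2 * (\<integral>\<^sup>+b. ennreal (?k b) \<partial>HL))" .
  moreover have "ennreal (2 * bessel_K0 t) * ennreal (2 * bessel_K0 t) = ennreal (4 * (bessel_K0 t)\<^sup>2)"
    by (subst ennreal_mult[symmetric]) (use bessel_K0_nonneg[OF t] in \<open>auto simp: power2_eq_square\<close>)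
  ultimately have 1: "ennreal (4 * (bessel_K0 t)\<^sup>2) = 4 * (\<integral>\<^sup>+b. ennreal (?k b) \<partial>HL)"
    by (simp flip: mult.assoc)
  have pos: "bessel_K0 (2 * t * cosh b) \<ge> 0" for b using t by (intro bessel_K0_nonneg) simp
  have i: "integrable HL (?k)"
  proof (rule integrableI_nonneg)
    show "(\<integral>\<^sup>+b. ennreal (?k b) \<partial>HL) < \<infinity>"
      using 1 by (metis ennreal_less_top ennreal_mult_eq_top_iff ennreal_zero_neq_top infinity_ennreal_def top.not_eq_extremum zero_neq_numeral)
    show "(?k) \<in> borel_measurable HL"
      by (intro borel_measurable_HL borel_measurable_times m) simp
  qed (simp add: pos)
  then show "integrable HL (\<lambda>x. bessel_K0 (2 * t * cosh x))" by simp
  define J where "J = (\<integral>b. ?k b \<partial>HL)"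
  have "(\<integral>\<^sup>+b. ennreal (?k b) \<partial>HL) = ennreal J"
    unfolding J_def by (rule nn_integral_eq_integral[OF i]) (simp add: pos)
  with 1 have "ennreal (4 * (bessel_K0 t)\<^sup>2) = 4 * ennreal J" by (simp only:)
  also have "\<dots> = ennreal (4 * J)"
    by (subst ennreal_mult') simp_all
  finally have "ennreal (4 * (bessel_K0 t)\<^sup>2) = ennreal (4 * J)" .
  moreover have "0 \<le> J"
    unfolding J_def by (rule integral_nonneg_AE) (simp add: pos)
  ultimately have "(bessel_K0 t)\<^sup>2 = J" by (subst (asm) ennreal_inj) auto
  then show "(bessel_K0 t)\<^sup>2 = 2 * (\<integral>x. bessel_K0 (2 * t * cosh x) \<partial>HL)"
    by (simp add: J_def)
qed

section \<open>The interval from 0 to pi and the integral representation of I_0\<close>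

definition PI :: "real measure" where "PI = restrict_space lborel {0..pi}"

lemma finite_measure_PI: "finite_measure PI"
  unfolding PI_def by (rule finite_measureI) (auto simp: emeasure_restrict_space space_restrict_space)

interpretation PI: finite_measure PI
  by (rule finite_measure_PI)

interpretation HP: pair_sigma_finite HL PI ..

lemma space_PI [simp]: "space PI = {0..pi}"
  by (simp add: PI_def space_restrict_space)

lemma ident_measurable_PI: "(\<lambda>x. x) \<in> PI \<rightarrow>\<^sub>M borel"
  unfolding PI_def by (rule measurable_restrict_space1) simp

lemma borel_measurable_PI: "f \<in> borel_measurable borel \<Longrightarrow> f \<in> borel_measurable PI"
  using measurable_compose[OF ident_measurable_PI] by blast

lemma integral_PI:
  fixes f :: "real \<Rightarrow> 'a::euclidean_space"
  assumes "continuous_on {0..pi} f"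
  shows "integrable PI f" "(\<integral>x. f x \<partial>PI) = integral {0..pi} f"
proof -
  have 1: "set_integrable lborel {0..pi} f"
    by (rule borel_integrable_compact[OF compact_Icc assms, folded set_integrable_def])
  then show "integrable PI f" by (simp add: PI_def integrable_restrict_space set_integrable_def)
  show "(\<integral>x. f x \<partial>PI) = integral {0..pi} f"
    using set_borel_integral_eq_integral(2)[OF 1]
    by (simp add: PI_def integral_restrict_space set_lebesgue_integral_def)
qed

text \<open>The doubled angle gives the integrand period pi, on which the contour shift in
  \<open>integral_exp_cos_shift\<close> rests.\<close>

definition cmom :: "nat \<Rightarrow> real" where "cmom m = integral {0..pi} (\<lambda>y. cos (2 * y) ^ m)"

lemma cmom_has_integral: "((\<lambda>y. cos (2 * y) ^ m) has_integral cmom m) {0..pi}"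
  unfolding cmom_def by (intro integrable_integral integrable_continuous_interval continuous_intros)

lemma cmom_0: "cmom 0 = pi"
  by (simp add: cmom_def)

lemma cmom_1: "cmom (Suc 0) = 0"
proof -
  have "((\<lambda>y. cos (2 * y)) has_integral sin (2 * pi) / 2 - sin (2 * 0) / 2) {0..pi}"
    by (rule fundamental_theorem_of_calculus)
       (auto intro!: derivative_eq_intros simp flip: has_real_derivative_iff_has_vector_derivative)
  then have "((\<lambda>y. cos (2 * y) ^ Suc 0) has_integral 0) {0..pi}" by simp
  with cmom_has_integral[of "Suc 0"] show ?thesis by (rule has_integral_unique)
qed

text \<open>Integration of the derivative of sin (2 y) cos (2 y)^(m + 1), a function that vanishes
  at 0 and at pi.\<close>

lemma cmom_Suc_Suc: "real (m + 2) * cmom (m + 2) = real (m + 1) * cmom m"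
proof -
  let ?F = "\<lambda>y. sin (2 * y) * cos (2 * y) ^ Suc m"
  let ?f = "\<lambda>y. 2 * real (m + 2) * cos (2 * y) ^ (m + 2) - 2 * real (m + 1) * cos (2 * y) ^ m"
  have "(?f has_integral sin (2 * pi) * cos (2 * pi) ^ Suc m - sin (2 * 0) * cos (2 * 0) ^ Suc m) {0..pi}"
  proof (rule fundamental_theorem_of_calculus)
    fix y
    have "(?F has_real_derivative
       (cos (2 * y) * 2) * cos (2 * y) ^ Suc m + ((1 + of_nat m) * ((- sin (2 * y) * 2) * cos (2 * y) ^ m)) * sin (2 * y)) (at y within {0..pi})"
      by (intro DERIV_mult DERIV_power_Suc) (auto intro!: derivative_eq_intros)
    moreover have "(cos (2 * y) * 2) * cos (2 * y) ^ Suc m + ((1 + of_nat m) * ((- sin (2 * y) * 2) * cos (2 * y) ^ m)) * sin (2 * y) = ?f y"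
    proof -
      have "(c * 2) * c ^ Suc m + ((1 + real m) * ((- s * 2) * c ^ m)) * s = 2 * real (m + 2) * c ^ (m + 2) - 2 * real (m + 1) * c ^ m"
        if "s * s = 1 - c * c" for c s :: real
      proof -
        have "((1 + real m) * ((- s * 2) * c ^ m)) * s = - 2 * (1 + real m) * c ^ m * (s * s)"
          by (simp add: algebra_simps)
        also have "\<dots> = - 2 * (1 + real m) * c ^ m * (1 - c * c)"
          by (simp only: that)
        finally have X: "((1 + real m) * ((- s * 2) * c ^ m)) * s = - 2 * (1 + real m) * c ^ m * (1 - c * c)" .
        show ?thesis
          by (simp only: X) (simp add: algebra_simps)
      qed
      moreover have "sin (2 * y) * sin (2 * y) = 1 - cos (2 * y) * cos (2 * y)"
        using sin_squared_eq[of "2 * y"] by (simp add: power2_eq_square)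
      ultimately show ?thesis by blast
    qed
    ultimately show "(?F has_vector_derivative ?f y) (at y within {0..pi})"
      by (simp only: has_real_derivative_iff_has_vector_derivative)
  qed simp
  moreover have "(?f has_integral 2 * real (m + 2) * cmom (m + 2) - 2 * real (m + 1) * cmom m) {0..pi}"
    by (intro has_integral_diff has_integral_mult_right cmom_has_integral)
  ultimately have "2 * real (m + 2) * cmom (m + 2) - 2 * real (m + 1) * cmom m
      = sin (2 * pi) * cos (2 * pi) ^ Suc m - sin (2 * 0) * cos (2 * 0) ^ Suc m"
    by (rule has_integral_unique[rotated])
  then show ?thesis by (simp add: algebra_simps)
qed

lemma cmom_odd: "cmom (2 * n + 1) = 0"
proof (induction n)
  case (Suc n)
  have "real (2 * n + 1 + 2) * cmom (2 * n + 1 + 2) = 0"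
    unfolding cmom_Suc_Suc Suc.IH by simp
  then show ?case by simp
qed (simp add: cmom_1)

lemma cmom_even: "cmom (2 * n) / fact (2 * n) = pi / (4 ^ n * (fact n)\<^sup>2)"
proof (induction n)
  case (Suc n)
  have c: "cmom (2 * Suc n) = real (2 * n + 1) * cmom (2 * n) / real (2 * n + 2)"
    using cmom_Suc_Suc[of "2 * n"] by (simp add: field_simps)
  have f: "fact (2 * Suc n) = real (2 * n + 2) * (real (2 * n + 1) * fact (2 * n))"
    by (simp add: algebra_simps)
  have "cmom (2 * Suc n) / fact (2 * Suc n) = (cmom (2 * n) / fact (2 * n)) / (real (2 * n + 2))\<^sup>2"
    unfolding c f by (simp add: power2_eq_square del: of_nat_Suc)
  also have "\<dots> = pi / (4 ^ Suc n * (fact (Suc n))\<^sup>2)"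
    unfolding Suc.IH by (simp add: power2_eq_square algebra_simps)
  finally show ?case .
qed (simp add: cmom_0)

text \<open>Termwise integration of the exponential series: odd moments vanish, and
  \<open>cmom_even\<close> turns the even ones into the coefficients of I_0.\<close>

lemma bessel_I0_integral: "integral {0..pi} (\<lambda>y. exp (t * cos (2 * y))) = pi * bessel_I0 t"
proof -
  let ?J = "integral {0..pi} (\<lambda>y. exp (t * cos (2 * y)))"
  let ?f = "\<lambda>m y. (t * cos (2 * y)) ^ m / fact m"
  have cont: "continuous_on {0..pi} (?f m)" for m by (intro continuous_intros) auto
  have int: "(\<integral>y. ?f m y \<partial>PI) = t ^ m / fact m * cmom m" for m
  proof -
    have "(\<integral>y. ?f m y \<partial>PI) = integral {0..pi} (\<lambda>y. t ^ m / fact m * cos (2 * y) ^ m)"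
      unfolding integral_PI(2)[OF cont] by (simp add: power_mult_distrib)
    then show ?thesis by (simp add: cmom_def)
  qed
  have bd: "norm (?f m y) \<le> \<bar>t\<bar> ^ m / fact m" for m y
  proof -
    have "\<bar>t * cos (2 * y)\<bar> ^ m \<le> \<bar>t\<bar> ^ m"
      by (intro power_mono) (auto simp: abs_mult intro: mult_left_le)
    then show ?thesis by (simp add: power_abs divide_right_mono)
  qed
  have sm: "summable (\<lambda>m. \<bar>t\<bar> ^ m / fact m)"
    using summable_exp[of "\<bar>t\<bar>"] by (simp add: divide_inverse mult.commute)
  have "(\<lambda>m. \<integral>y. ?f m y \<partial>PI) sums (\<integral>y. (\<Sum>m. ?f m y) \<partial>PI)"
  proof (rule sums_integral)
    show "integrable PI (?f m)" for m by (rule integral_PI(1)[OF cont])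
    show "AE y in PI. summable (\<lambda>m. norm (?f m y))"
      by (rule AE_I2) (rule summable_comparison_test'[OF sm, of 0], use bd in auto)
    show "summable (\<lambda>m. \<integral>y. norm (?f m y) \<partial>PI)"
    proof (rule summable_comparison_test'[OF summable_mult[OF sm, of pi], of 0])
      fix m
      have "(\<integral>y. norm (?f m y) \<partial>PI) \<le> (\<integral>y. \<bar>t\<bar> ^ m / fact m \<partial>PI)"
        by (rule integral_mono[OF integrable_norm[OF integral_PI(1)[OF cont]]]) (use bd in auto)
      also have "\<dots> = pi * (\<bar>t\<bar> ^ m / fact m)"
        by (subst integral_PI(2)) auto
      finally show "norm (\<integral>y. norm (?f m y) \<partial>PI) \<le> pi * (\<bar>t\<bar> ^ m / fact m)"
        by simp
    qed
  qed
  moreover have "(\<Sum>m. ?f m y) = exp (t * cos (2 * y))" for y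
    by (simp add: exp_def scaleR_conv_of_real divide_inverse mult.commute)
  ultimately have S: "(\<lambda>m. t ^ m / fact m * cmom m) sums ?J"
    unfolding int by (simp add: integral_PI(2) continuous_intros)
  have "(\<lambda>n. t ^ (2 * n) / fact (2 * n) * cmom (2 * n)) sums ?J"
  proof (subst sums_mono_reindex[of "\<lambda>n. 2 * n"])
    show "t ^ m / fact m * cmom m = 0" if "m \<notin> range (\<lambda>n. 2 * n)" for m
    proof -
      have "odd m" using that by (auto elim!: evenE)
      then show ?thesis using cmom_odd by (auto elim!: oddE)
    qed
  qed (use S in \<open>auto simp: strict_mono_def\<close>)
  moreover have "t ^ (2 * n) / fact (2 * n) * cmom (2 * n) = pi * ((t / 2) ^ (2 * n) / (fact n)\<^sup>2)" for n
  proof -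
    have "t ^ (2 * n) / fact (2 * n) * cmom (2 * n) = t ^ (2 * n) * (cmom (2 * n) / fact (2 * n))" by simp
    also have "\<dots> = pi * ((t / 2) ^ (2 * n) / (fact n)\<^sup>2)"
      unfolding cmom_even by (simp add: power_divide power_mult)
    finally show ?thesis .
  qed
  ultimately have "(\<lambda>n. pi * ((t / 2) ^ (2 * n) / (fact n)\<^sup>2)) sums ?J"
    by simp
  from sums_divide[OF this, of pi] have "(\<lambda>n. (t / 2) ^ (2 * n) / (fact n)\<^sup>2) sums (?J / pi)"
    by simp
  then show ?thesis unfolding bessel_I0_def by (simp add: sums_iff)
qed

lemma bessel_I0_le_exp: "bessel_I0 t \<le> exp \<bar>t\<bar>"
proof -
  have "integral {0..pi} (\<lambda>y. exp (t * cos (2 * y))) \<le> integral {0..pi} (\<lambda>y. exp \<bar>t\<bar>)"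
  proof (rule integral_le)
    fix y :: real
    have "\<bar>t * cos (2 * y)\<bar> \<le> \<bar>t\<bar> * 1" unfolding abs_mult by (intro mult_left_mono) auto
    then show "exp (t * cos (2 * y)) \<le> exp \<bar>t\<bar>" by (simp add: abs_le_iff)
  qed (auto intro!: integrable_continuous_interval continuous_intros)
  then show ?thesis by (simp add: bessel_I0_integral)
qed

lemma bessel_I0_nonneg: "bessel_I0 t \<ge> 0"
proof -
  have "0 \<le> integral {0..pi} (\<lambda>y. exp (t * cos (2 * y)))"
    by (rule integral_nonneg) (auto intro!: integrable_continuous_interval continuous_intros)
  then show ?thesis by (simp add: bessel_I0_integral zero_le_mult_iff) (use pi_gt_zero in linarith)
qed

section \<open>The product formula for I_0 K_0\<close>

lemma sin_complex_Re_Im: "sin (Complex x y) = Complex (sin x * cosh y) (cos x * sinh y)"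
  and cos_complex_Re_Im: "cos (Complex x y) = Complex (cos x * cosh y) (- sin x * sinh y)"
proof -
  have c: "cos (\<i> * of_real y) = of_real (cosh y)"
    by (simp add: cosh_conv_cos[symmetric] cosh_def scaleR_conv_of_real exp_of_real[symmetric])
  have s: "sin (\<i> * of_real y) = \<i> * of_real (sinh y)"
    by (simp add: sin_exp_eq sinh_def scaleR_conv_of_real exp_of_real[symmetric] exp_minus[symmetric] field_simps)
  have C: "Complex x y = of_real x + \<i> * of_real y" by (simp add: Complex_eq)
  show "sin (Complex x y) = Complex (sin x * cosh y) (cos x * sinh y)"
    unfolding C sin_add c s sin_of_real cos_of_real by (simp add: complex_eq_iff)
  show "cos (Complex x y) = Complex (cos x * cosh y) (- sin x * sinh y)"
    unfolding C cos_add c s sin_of_real cos_of_real by (simp add: complex_eq_iff)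
qed

text \<open>By periodicity the two vertical sides of the rectangle contribute equally, so the
  integral over a horizontal segment of length pi does not depend on its height.\<close>

lemma integral_exp_cos_shift:
  assumes "c \<ge> 0"
  shows "((\<lambda>y. exp (of_real t * cos (2 * Complex y c))) has_integral complex_of_real (pi * bessel_I0 t)) {0..pi}"
proof -
  let ?g = "\<lambda>z. exp (complex_of_real t * cos (2 * z))"
  have "?g holomorphic_on UNIV" by (intro holomorphic_intros)
  then obtain \<Psi> where P: "\<And>z. (\<Psi> has_field_derivative ?g z) (at z)"
    by (rule entire_primitive) (rule that)
  have two: "2 * Complex x y = Complex (2 * x) (2 * y)" for x y
    by (simp add: complex_eq_iff)
  have per: "(\<lambda>y. \<i> * ?g (Complex pi y)) = (\<lambda>y. \<i> * ?g (Complex 0 y))"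
    by (simp add: two cos_complex_Re_Im)
  have "\<Psi> (Complex pi c) - \<Psi> (Complex pi 0) = \<Psi> (Complex 0 c) - \<Psi> (Complex 0 0)"
    using primitive_vertical[OF P assms, of pi] primitive_vertical[OF P assms, of 0]
    unfolding per by (rule has_integral_unique)
  then have eq: "\<Psi> (Complex pi c) - \<Psi> (Complex 0 c) = \<Psi> (Complex pi 0) - \<Psi> (Complex 0 0)"
    by (simp add: algebra_simps)
  have "((\<lambda>y. exp (t * cos (2 * y))) has_integral pi * bessel_I0 t) {0..pi}"
    unfolding bessel_I0_integral[symmetric]
    by (intro integrable_integral integrable_continuous_interval continuous_intros)
  then have "((\<lambda>y. complex_of_real (exp (t * cos (2 * y)))) has_integral of_real (pi * bessel_I0 t)) {0..pi}"
    by (rule has_integral_of_real)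
  moreover have "(\<lambda>y. complex_of_real (exp (t * cos (2 * y)))) = (\<lambda>y. ?g (Complex y 0))"
  proof (rule ext)
    fix y
    have "cos (2 * Complex y 0) = of_real (cos (2 * y))"
      unfolding two cos_complex_Re_Im by (simp add: complex_eq_iff)
    then show "complex_of_real (exp (t * cos (2 * y))) = ?g (Complex y 0)"
      by (simp only: exp_of_real[symmetric] of_real_mult)
  qed
  ultimately have "\<Psi> (Complex pi 0) - \<Psi> (Complex 0 0) = of_real (pi * bessel_I0 t)"
    using primitive_horizontal[OF P pi_ge_zero, of 0] has_integral_unique by metis
  then show ?thesis using primitive_horizontal[OF P pi_ge_zero, of c] eq by simp
qed

text \<open>Since \<open>cosh u - cos (2 y + \<i> u) = 2 sin y sin (y + \<i> u)\<close>, moving the path of integration of the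
  \<open>\<pi>\<close>-periodic function \<open>exp (t cos (2 y))\<close> by \<open>\<i> u / 2\<close> turns \<open>exp (- t cosh u) \<pi> I\<^sub>0(t)\<close> into an integral of \<open>nker\<close>.\<close>
definition nker :: "real \<Rightarrow> real \<Rightarrow> real \<Rightarrow> real" where
  "nker t u y = exp (- 2 * t * (sin y)\<^sup>2 * cosh u) * cos (2 * t * sin y * cos y * sinh u)"

lemma nker_eq: "nker t u y = Re (exp (- of_real (2 * t * sin y) * sin (Complex y u)))"
  by (simp add: nker_def sin_complex_Re_Im Re_exp power2_eq_square mult_ac)

lemma integral_nker_y:
  assumes "u \<ge> 0"
  shows "(\<integral>y. nker t u y \<partial>PI) = pi * bessel_I0 t * exp (- t * cosh u)"
proof -
  have "((\<lambda>y. exp (- of_real (t * cosh u)) * exp (of_real t * cos (2 * Complex y (u / 2)))) has_integral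
     exp (- of_real (t * cosh u)) * complex_of_real (pi * bessel_I0 t)) {0..pi}"
    by (intro has_integral_mult_right integral_exp_cos_shift) (use assms in simp)
  from has_integral_Re[OF this]
  have "((\<lambda>y. Re (exp (- of_real (t * cosh u)) * exp (of_real t * cos (2 * Complex y (u / 2))))) has_integral
     exp (- (t * cosh u)) * (pi * bessel_I0 t)) {0..pi}"
    by (simp add: Re_exp)
  moreover have "Re (exp (- of_real (t * cosh u)) * exp (of_real t * cos (2 * Complex y (u / 2)))) = nker t u y" for y
  proof -
    have "- of_real (t * cosh u) + of_real t * cos (2 * Complex y (u / 2)) = - of_real (2 * t * sin y) * sin (Complex y u)"
    proof -
      have two: "2 * Complex y (u / 2) = Complex (2 * y) u" by (simp add: complex_eq_iff)
      show ?thesis unfolding two cos_complex_Re_Im sin_complex_Re_Im sin_double cos_double_sin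
        by (simp add: complex_eq_iff power2_eq_square algebra_simps)
    qed
    then show ?thesis unfolding nker_eq by (simp only: mult_exp_exp)
  qed
  ultimately have "((\<lambda>y. nker t u y) has_integral exp (- (t * cosh u)) * (pi * bessel_I0 t)) {0..pi}"
    by simp
  moreover have "(\<integral>y. nker t u y \<partial>PI) = integral {0..pi} (\<lambda>y. nker t u y)"
    unfolding nker_def by (intro integral_PI continuous_intros)
  ultimately show ?thesis by (simp add: integral_unique mult.commute)
qed

lemma nker_symmetric: "nker t u (pi - y) = nker t u y"
  by (simp add: nker_def)

lemma norm_nker_le: "\<bar>nker t u y\<bar> \<le> exp (- 2 * t * (sin y)\<^sup>2 * cosh u)"
  by (simp add: nker_def abs_mult mult_left_le)

text \<open>The kernel is the real part of exp (- \<tau> sin z) on the vertical line Re z = y. The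
  line is moved to Re z = pi/2, where sin z = cosh u and the integrand is that of
  \<open>bessel_K0\<close>. The bottom side is real and drops out of the imaginary part of the
  primitive; on the top side sin x \<ge> sin y, since y \<le> x \<le> pi/2, and this gives the
  decay.\<close>

lemma integral_nker_u_aux:
  assumes t: "t > 0" and y: "0 < y" "y \<le> pi / 2"
  shows "(\<integral>u. nker t u y \<partial>HL) = bessel_K0 (2 * t * sin y)"
proof -
  let ?n = "\<lambda>u. nker t u y"
  define \<tau> where "\<tau> = 2 * t * sin y"
  let ?B = "\<lambda>R. exp (- \<tau> * sin y * cosh R) * (pi / 2)"
  let ?k = "\<lambda>u. exp (- \<tau> * cosh u)"
  have siny: "sin y > 0" using y by (intro sin_gt_zero) auto
  have \<tau>: "\<tau> > 0" using t siny by (simp add: \<tau>_def)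
  let ?g = "\<lambda>z. exp (- complex_of_real \<tau> * sin z)"
  have "?g holomorphic_on UNIV" by (intro holomorphic_intros)
  then obtain \<Psi> where P: "\<And>z. (\<Psi> has_field_derivative ?g z) (at z)"
    by (rule entire_primitive) (rule that)
  have ker: "nker t u y = Re (?g (Complex y u))" for u
    by (simp add: nker_eq \<tau>_def)
  have "integrable HL ?n"
  proof (rule Bochner_Integration.integrable_bound[OF integrable_K0])
    show "2 * t * (sin y)\<^sup>2 > 0" using t siny by simp
    show "?n \<in> borel_measurable HL"
      unfolding nker_def by (intro borel_measurable_HL borel_measurable_continuous_onI continuous_intros)
    show "AE u in HL. norm (nker t u y) \<le> norm (exp (- (2 * t * (sin y)\<^sup>2) * cosh u))"
      by (rule AE_I2) (use norm_nker_le[of t _ y] in simp)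
  qed
  note L1 = HL_tendsto[OF this]
  note L2 = HL_tendsto[OF integrable_K0[OF \<tau>], folded bessel_K0_eq[OF \<tau>]]
  have "((\<lambda>R. integral {0..R} ?n - integral {0..R} ?k) \<longlongrightarrow> 0) at_top"
  proof (rule Lim_null_comparison)
    show "((\<lambda>R. ?B R) \<longlongrightarrow> 0) at_top"
      using \<tau> siny unfolding cosh_field_def by real_asymp
    have "norm (integral {0..R} ?n - integral {0..R} ?k) \<le> ?B R"
      if R: "R \<ge> 0" for R
    proof -
      have I: "integral {0..R} (\<lambda>u. Re (?g (Complex x u))) = Im (\<Psi> (Complex x R) - \<Psi> (Complex x 0))" for x
        using has_integral_Im[OF primitive_vertical[OF P R, of x]] by (simp add: integral_unique)
      have g2: "Re (?g (Complex (pi / 2) u)) = exp (- \<tau> * cosh u)" for u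
        by (simp add: sin_complex_Re_Im Re_exp)
      have "((\<lambda>x. Im (?g (Complex x 0))) has_integral Im (\<Psi> (Complex (pi / 2) 0) - \<Psi> (Complex y 0))) {y..pi/2}"
        by (intro has_integral_Im primitive_horizontal[OF P] y)
      moreover have "(\<lambda>x. Im (?g (Complex x 0))) = (\<lambda>x. 0)"
        by (simp add: sin_complex_Re_Im Im_exp)
      ultimately have r0: "Im (\<Psi> (Complex (pi / 2) 0) - \<Psi> (Complex y 0)) = 0"
        using has_integral_unique[OF has_integral_0] by metis
      have "norm (\<Psi> (Complex (pi / 2) R) - \<Psi> (Complex y R)) \<le> exp (- \<tau> * sin y * cosh R) * measure lborel {y..pi/2}"
      proof (rule has_integral_bound_real[OF _ finite.emptyI primitive_horizontal[OF P y(2)]])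
        fix x assume x: "x \<in> {y..pi / 2} - {}"
        have "sin y \<le> sin x" using x y by (intro sin_monotone_2pi_le) auto
        then have "\<tau> * sin y * cosh R \<le> \<tau> * sin x * cosh R"
          using \<tau> by (intro mult_right_mono mult_left_mono) auto
        then show "norm (?g (Complex x R)) \<le> exp (- \<tau> * sin y * cosh R)"
          by (simp add: sin_complex_Re_Im)
      qed simp
      also have "\<dots> \<le> ?B R"
        using y by (intro mult_left_mono) auto
      finally have b: "norm (\<Psi> (Complex (pi / 2) R) - \<Psi> (Complex y R)) \<le> ?B R" .
      have eq: "integral {0..R} ?n - integral {0..R} ?k
        = - Im (\<Psi> (Complex (pi / 2) R) - \<Psi> (Complex y R))"
        unfolding ker g2[symmetric] I using r0 by simp
      show ?thesis
        unfolding eq norm_minus_cancel real_norm_def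
        using b abs_Im_le_cmod[of "\<Psi> (Complex (pi / 2) R) - \<Psi> (Complex y R)"] by linarith
    qed
    then show "\<forall>\<^sub>F R in at_top. norm (integral {0..R} ?n - integral {0..R} ?k) \<le> ?B R"
      by (rule eventually_at_top_linorderI)
  qed
  then have "((\<lambda>R. integral {0..R} ?n) \<longlongrightarrow> bessel_K0 \<tau>) at_top"
    by (rule Lim_transform[OF L2])
  with L1 show ?thesis unfolding \<tau>_def by (rule tendsto_unique[OF trivial_limit_at_top_linorder])
qed

lemma integral_nker_u:
  assumes t: "t > 0" and y: "0 < y" "y < pi"
  shows "(\<integral>u. nker t u y \<partial>HL) = bessel_K0 (2 * t * sin y)"
proof (cases "y \<le> pi / 2")
  case False
  then have "(\<integral>u. nker t u (pi - y) \<partial>HL) = bessel_K0 (2 * t * sin (pi - y))"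
    using y by (intro integral_nker_u_aux[OF t]) auto
  then show ?thesis by (simp add: nker_symmetric)
qed (use integral_nker_u_aux[OF t] y in auto)

text \<open>Trades exponential decay for a small negative power. A power of a product factors, which
  supplies the product majorants in cosh u and sin y that Fubini needs.\<close>

lemma exp_minus_le_powr:
  assumes "x > 0" "0 \<le> a" "a \<le> (1::real)"
  shows "exp (- x) \<le> x powr (- a)"
proof (cases "x \<le> 1")
  case True
  have "1 powr (- a) \<le> x powr (- a)" using assms True by (intro powr_mono2') auto
  moreover have "exp (- x) \<le> 1" using assms by simp
  ultimately show ?thesis by (metis order_trans powr_one_eq_one)
next
  case False
  have "x powr a \<le> x powr 1" using assms False by (intro powr_mono) auto
  also have "x powr 1 = x" using assms by simp
  also have "x \<le> exp x" using exp_ge_add_one_self[of x] by linarith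
  finally have "inverse (exp x) \<le> inverse (x powr a)" using assms by (intro le_imp_inverse_le) auto
  then show ?thesis by (simp add: exp_minus powr_minus)
qed

lemma integrable_cosh_powr:
  assumes "a > 0" shows "integrable HL (\<lambda>u. cosh u powr (- a))"
proof (rule Bochner_Integration.integrable_bound[OF integrable_mult_right[OF integrable_HL_exp[OF assms], of "2 powr a"]])
  show "(\<lambda>u. cosh u powr (- a)) \<in> borel_measurable HL"
    by (rule borel_measurable_HL) measurable
  show "AE u in HL. norm (cosh u powr (- a)) \<le> norm (2 powr a * exp (- a * u))"
  proof (rule AE_I2)
    fix u :: real
    have "exp u / 2 \<le> cosh u" by (simp add: cosh_def)
    then have "cosh u powr (- a) \<le> (exp u / 2) powr (- a)" using assms by (intro powr_mono2') auto
    also have "\<dots> = 2 powr a * exp (- a * u)"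
      by (simp add: powr_divide powr_minus_divide exp_powr_real exp_minus field_simps)
    finally show "norm (cosh u powr (- a)) \<le> norm (2 powr a * exp (- a * u))" by simp
  qed
qed

text \<open>From sin y \<ge> y - y^3 / 6 and y \<le> 2. The slope only enters the constant in the
  comparison with y^(-1/2).\<close>

lemma sin_ge_third:
  assumes "0 \<le> y" "y \<le> pi / 2" shows "sin y \<ge> y / 3"
proof -
  have "\<bar>sin y - (\<Sum>m<3. sin_coeff m * y ^ m)\<bar> \<le> inverse (fact 3) * \<bar>y\<bar> ^ 3"
    by (rule Maclaurin_sin_bound)
  moreover have "(\<Sum>m<3. sin_coeff m * y ^ m) = y"
    by (simp add: sin_coeff_def eval_nat_numeral)
  moreover have "inverse (fact 3) * \<bar>y\<bar> ^ 3 = y ^ 3 / 6"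
    using assms by (simp add: eval_nat_numeral field_simps)
  ultimately have "sin y \<ge> y - y ^ 3 / 6" by linarith
  moreover have "y ^ 3 / 6 \<le> 2 * y / 3"
  proof -
    have "y \<le> 2" using assms pi_half_less_two by linarith
    then have "y * y \<le> 2 * 2" using assms by (intro mult_mono) auto
    then have "y * (y * y) \<le> y * 4" using assms by (intro mult_left_mono) auto
    then show ?thesis by (simp add: eval_nat_numeral)
  qed
  ultimately show ?thesis by linarith
qed

lemma AE_PI: "AE y in PI. 0 < y \<and> y < pi"
proof -
  have "AE y in lborel. y \<noteq> 0 \<and> y \<noteq> pi"
    using AE_lborel_singleton[of 0] AE_lborel_singleton[of pi] by eventually_elim simp
  then have "AE y in lborel. y \<in> {0..pi} \<longrightarrow> 0 < y \<and> y < pi"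
    by (rule eventually_mono) auto
  then show ?thesis
    unfolding PI_def by (subst AE_restrict_space_iff) auto
qed

lemma integrable_PI_I:
  fixes f :: "real \<Rightarrow> real"
  assumes "f \<in> borel_measurable borel" "\<And>x. x \<in> {0..pi} \<Longrightarrow> 0 \<le> f x" "(f has_integral I) {0..pi}"
  shows "integrable PI f"
  using assms borel_measurable_PI[OF assms(1)] unfolding PI_def
  by (intro integrable_restrict_space_nonneg) auto

lemma integrable_PI_reflect:
  fixes f :: "real \<Rightarrow> real"
  assumes "integrable PI f" shows "integrable PI (\<lambda>y. f (pi - y))"
proof -
  have "integrable lborel (\<lambda>x. indicator {0..pi} x *\<^sub>R f x)"
    using assms by (simp add: PI_def integrable_restrict_space)
  from lborel_integrable_real_affine[OF this, of "-1" pi]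
  have "integrable lborel (\<lambda>x. indicator {0..pi} (pi - x) *\<^sub>R f (pi - x))" by simp
  moreover have "indicator {0..pi} (pi - x) = (indicator {0..pi} x :: real)" for x
    by (auto simp: indicator_def)
  ultimately show ?thesis by (simp add: PI_def integrable_restrict_space)
qed

lemma integrable_sin_powr: "integrable PI (\<lambda>y. sin y powr (- (1 / 2)))"
proof -
  have 1: "integrable PI (\<lambda>y. y powr (- (1 / 2)))"
    by (rule integrable_PI_I[OF _ _ has_integral_powr_from_0]) auto
  have 2: "integrable PI (\<lambda>y. (pi - y) powr (- (1 / 2)))"
    by (rule integrable_PI_reflect[OF 1])
  show ?thesis
  proof (rule Bochner_Integration.integrable_bound[OF Bochner_Integration.integrable_add[OF integrable_mult_right[OF 1] integrable_mult_right[OF 2], of "3 powr (1/2)" "3 powr (1/2)"]])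
    show "(\<lambda>y. sin y powr (- (1 / 2))) \<in> borel_measurable PI"
      by (rule borel_measurable_PI) measurable
    have b: "sin y powr (- (1 / 2)) \<le> 3 powr (1/2) * y powr (- (1 / 2))" if "0 < y" "y \<le> pi / 2" for y
    proof -
      have "sin y powr (- (1 / 2)) \<le> (y / 3) powr (- (1 / 2))"
        using sin_ge_third[of y] that by (intro powr_mono2') auto
      also have "\<dots> = 3 powr (1/2) * y powr (- (1 / 2))"
        using that by (simp add: powr_divide powr_minus_divide)
      finally show ?thesis .
    qed
    show "AE y in PI. norm (sin y powr (- (1 / 2))) \<le> norm (3 powr (1/2) * y powr (- (1 / 2)) + 3 powr (1/2) * (pi - y) powr (- (1 / 2)))"
      using AE_PI
    proof eventually_elim
      case (elim y)
      show ?case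
      proof (cases "y \<le> pi / 2")
        case True
        then show ?thesis using b[of y] elim by (simp add: add_increasing2)
      next
        case False
        then have "sin (pi - y) powr (- (1 / 2)) \<le> 3 powr (1/2) * (pi - y) powr (- (1 / 2))"
          using elim by (intro b) auto
        then show ?thesis by (simp add: add_increasing)
      qed
    qed
  qed
qed

lemmas measurable_pair_HP = measurable_pair_coarser[OF ident_measurable_HL ident_measurable_PI]

lemma integrable_cosh_sin:
  assumes "a > 0"
  shows "integrable (HL \<Otimes>\<^sub>M PI) (\<lambda>(u, y). cosh u powr (- a) * sin y powr (- (1 / 2)))"
proof (rule HP.Fubini_integrable)
  show "(\<lambda>(u, y). cosh u powr (- a) * sin y powr (- (1 / 2))) \<in> borel_measurable (HL \<Otimes>\<^sub>M PI)"
    by (rule measurable_pair_HP) measurable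
  show "integrable HL (\<lambda>u. \<integral>y. norm (case (u, y) of (u, y) \<Rightarrow> cosh u powr (- a) * sin y powr (- (1 / 2))) \<partial>PI)"
    by (simp add: integrable_cosh_powr[OF assms])
  show "AE u in HL. integrable PI (\<lambda>y. case (u, y) of (u, y) \<Rightarrow> cosh u powr (- a) * sin y powr (- (1 / 2)))"
    by (simp add: integrable_sin_powr)
qed

lemma integrable_HP_bound:
  assumes "a > 0" "f \<in> borel_measurable (borel \<Otimes>\<^sub>M borel)"
    "\<And>u y. 0 \<le> u \<Longrightarrow> 0 < y \<Longrightarrow> y < pi \<Longrightarrow> \<bar>f (u, y)\<bar> \<le> C * (cosh u powr (- a) * sin y powr (- (1 / 2)))"
  shows "integrable (HL \<Otimes>\<^sub>M PI) (f :: real \<times> real \<Rightarrow> real)"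
proof (rule Bochner_Integration.integrable_bound[OF integrable_mult_right[OF integrable_cosh_sin[OF assms(1)], of C]])
  show "f \<in> borel_measurable (HL \<Otimes>\<^sub>M PI)" by (rule measurable_pair_HP) fact
  have "AE p in HL \<Otimes>\<^sub>M PI. 0 < snd p \<and> snd p < pi"
  proof (rule HP.AE_pair_measure)
    have [measurable]: "snd \<in> borel_measurable (HL \<Otimes>\<^sub>M PI)"
      by (rule measurable_pair_HP) measurable
    show "{p \<in> space (HL \<Otimes>\<^sub>M PI). 0 < snd p \<and> snd p < pi} \<in> sets (HL \<Otimes>\<^sub>M PI)"
      by measurable
    show "AE x in HL. AE y in PI. 0 < snd (x, y) \<and> snd (x, y) < pi"
      using AE_PI by simp
  qed
  moreover have "AE p in HL \<Otimes>\<^sub>M PI. p \<in> space (HL \<Otimes>\<^sub>M PI)" by (rule AE_space)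
  ultimately show "AE p in HL \<Otimes>\<^sub>M PI. norm (f p) \<le> norm (C * (case p of (u, y) \<Rightarrow> cosh u powr (- a) * sin y powr (- (1 / 2))))"
  proof eventually_elim
    case (elim p)
    obtain u y where p: "p = (u, y)" by (cases p)
    have "\<bar>f (u, y)\<bar> \<le> C * (cosh u powr (- a) * sin y powr (- (1 / 2)))"
      using elim by (intro assms(3)) (auto simp: p space_pair_measure)
    then show ?case by (simp add: p)
  qed
qed

lemma bessel_I0_K0_product:
  assumes t: "t > 0"
  shows "pi * bessel_I0 t * bessel_K0 t = (\<integral>y. (\<integral>u. nker t u y \<partial>HL) \<partial>PI)"
    and "(\<lambda>y. \<integral>u. nker t u y \<partial>HL) \<in> borel_measurable PI"
proof -
  have int: "integrable (HL \<Otimes>\<^sub>M PI) (\<lambda>(u, y). nker t u y)"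
  \<comment> \<open>The kernel changes sign, so absolute integrability needs a majorant. It decays
    in (sin y)^2, and exponent 1/4 turns this into the integrable singularity (sin
    y)^(-1/2).\<close>
  proof (rule integrable_HP_bound[where a="1/4" and C="(2 * t) powr (- (1/4))"])
    show "(\<lambda>(u, y). nker t u y) \<in> borel_measurable (borel \<Otimes>\<^sub>M borel)"
      unfolding nker_def borel_prod by (intro borel_measurable_continuous_onI) (auto simp: case_prod_unfold intro!: continuous_intros)
    fix u y :: real assume y: "0 < y" "y < pi"
    have s: "sin y > 0" using y by (rule sin_gt_zero)
    have "\<bar>nker t u y\<bar> \<le> exp (- (2 * t * (sin y)\<^sup>2 * cosh u))" using norm_nker_le[of t u y] by simp
    also have "\<dots> \<le> (2 * t * (sin y)\<^sup>2 * cosh u) powr (- (1/4))"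
      using t s by (intro exp_minus_le_powr) auto
    also have "\<dots> = (2 * t) powr (- (1/4)) * (cosh u powr (- (1/4)) * sin y powr (- (1/2)))"
      using t s by (simp add: powr_mult powr_powr flip: powr_numeral)
    finally show "\<bar>case (u, y) of (u, y) \<Rightarrow> nker t u y\<bar> \<le> (2 * t) powr (- (1/4)) * (cosh u powr (- (1/4)) * sin y powr (- (1/2)))"
      by simp
  qed simp
  have "(\<integral>u. (\<integral>y. nker t u y \<partial>PI) \<partial>HL) = (\<integral>y. (\<integral>u. nker t u y \<partial>HL) \<partial>PI)"
    using HP.Fubini_integral[OF int] by simp
  moreover have "(\<integral>u. (\<integral>y. nker t u y \<partial>PI) \<partial>HL) = (\<integral>u. pi * bessel_I0 t * exp (- t * cosh u) \<partial>HL)"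
    by (rule Bochner_Integration.integral_cong) (auto simp: integral_nker_y)
  moreover have "\<dots> = pi * bessel_I0 t * bessel_K0 t"
    by (simp add: bessel_K0_eq[OF t])
  ultimately show "pi * bessel_I0 t * bessel_K0 t = (\<integral>y. (\<integral>u. nker t u y \<partial>HL) \<partial>PI)" by simp
  show "(\<lambda>y. \<integral>u. nker t u y \<partial>HL) \<in> borel_measurable PI"
    using borel_measurable_integrable[OF HP.integrable_snd[OF int]] by simp
qed

text \<open>The imaginary part of L(- i t). Classically it is pi/2 times the difference of I_0 and
  the modified Struve function of order 0.\<close>

definition Vfun :: "real \<Rightarrow> real" where
  "Vfun t = integral {0..pi / 2} (\<lambda>y. exp (- t * sin y))"

lemma Vfun_eq: "2 * Vfun t = (\<integral>y. exp (- t * sin y) \<partial>PI)"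
proof -
  let ?f = "\<lambda>y. exp (- t * sin y)"
  have c: "continuous_on A ?f" for A by (intro continuous_intros)
  have i: "?f integrable_on {a..b}" for a b by (rule integrable_continuous_interval[OF c])
  have "(\<integral>y. ?f y \<partial>PI) = integral {0..pi} ?f" by (rule integral_PI(2)[OF c])
  also have "\<dots> = integral {0..pi/2} ?f + integral {pi/2..pi} ?f"
    by (rule Henstock_Kurzweil_Integration.integral_combine[symmetric]) (use i in auto)
  also have "integral {pi/2..pi} ?f = integral {0..pi/2} ?f"
  proof -
    have "(?f has_integral integral {0..pi/2} ?f) (cbox 0 (pi/2))"
      using integrable_integral[OF i] by simp
    from has_integral_affinity[OF this, of "-1" pi]
    have "((\<lambda>y. ?f (- y + pi)) has_integral integral {0..pi/2} ?f) ((\<lambda>x. pi - x) ` {0..pi/2})"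
      by simp
    moreover have "(\<lambda>x. pi - x) ` {0..pi/2} = {pi/2..pi}"
      using image_diff_atLeastAtMost[of pi 0 "pi/2"] by simp
    ultimately show ?thesis by (simp add: integral_unique)
  qed
  finally show ?thesis by (simp add: Vfun_def)
qed

text \<open>The kernel exp (- 2 t cosh u sin y) and \<open>nker\<close> are different functions of
  (u, y), but both integrate over u to \<open>bessel_K0\<close> at 2 t sin y. Two applications of
  Fubini therefore link the integral of \<open>Vfun\<close> to the product of I_0 and K_0.\<close>

lemma bessel_I0_K0_Vfun:
  assumes t: "t > 0"
  shows "pi * bessel_I0 t * bessel_K0 t = 2 * (\<integral>x. Vfun (2 * t * cosh x) \<partial>HL)"
proof -
  let ?h = "\<lambda>u y. exp (- (2 * t * cosh u) * sin y)"
  have int: "integrable (HL \<Otimes>\<^sub>M PI) (\<lambda>(u, y). ?h u y)"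
  proof (rule integrable_HP_bound[where a="1/2" and C="(2 * t) powr (- (1/2))"])
    show "(\<lambda>(u, y). ?h u y) \<in> borel_measurable (borel \<Otimes>\<^sub>M borel)"
      unfolding borel_prod by (intro borel_measurable_continuous_onI) (auto simp: case_prod_unfold intro!: continuous_intros)
    fix u y :: real assume y: "0 < y" "y < pi"
    have s: "sin y > 0" using y by (rule sin_gt_zero)
    have "exp (- (2 * t * cosh u * sin y)) \<le> (2 * t * cosh u * sin y) powr (- (1/2))"
      using t s by (intro exp_minus_le_powr) auto
    also have "\<dots> = (2 * t) powr (- (1/2)) * (cosh u powr (- (1/2)) * sin y powr (- (1/2)))"
      using t s by (simp add: powr_mult)
    finally show "\<bar>case (u, y) of (u, y) \<Rightarrow> ?h u y\<bar> \<le> (2 * t) powr (- (1/2)) * (cosh u powr (- (1/2)) * sin y powr (- (1/2)))"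
      by simp
  qed simp
  have "2 * (\<integral>x. Vfun (2 * t * cosh x) \<partial>HL) = (\<integral>x. 2 * Vfun (2 * t * cosh x) \<partial>HL)" by simp
  also have "\<dots> = (\<integral>u. (\<integral>y. ?h u y \<partial>PI) \<partial>HL)"
    unfolding Vfun_eq ..
  also have "\<dots> = (\<integral>y. (\<integral>u. ?h u y \<partial>HL) \<partial>PI)"
    using HP.Fubini_integral[OF int] by simp
  also have "\<dots> = (\<integral>y. (\<integral>u. nker t u y \<partial>HL) \<partial>PI)"
  proof (rule integral_cong_AE)
    show "(\<lambda>y. \<integral>u. ?h u y \<partial>HL) \<in> borel_measurable PI"
      using borel_measurable_integrable[OF HP.integrable_snd[OF int]] by simp
    show "AE y in PI. (\<integral>u. ?h u y \<partial>HL) = (\<integral>u. nker t u y \<partial>HL)"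
      using AE_PI
    proof eventually_elim
      case (elim y)
      then have "2 * t * sin y > 0" using t sin_gt_zero[of y] by simp
      from bessel_K0_eq[OF this] show ?case
        using elim by (simp add: mult_ac integral_nker_u[OF t])
    qed
    show "(\<lambda>y. \<integral>u. nker t u y \<partial>HL) \<in> borel_measurable PI"
      by (rule bessel_I0_K0_product(2)[OF t])
  qed
  finally show ?thesis unfolding bessel_I0_K0_product(1)[OF t] by simp
qed

section \<open>The boundary value function\<close>

lemma integrable_inverse_cosh_power:
  assumes "k > 0" shows "integrable HL (\<lambda>x. inverse (cosh x) ^ k)"
proof (rule Bochner_Integration.integrable_bound[OF integrable_cosh_powr[of "real k"]])
  show "(\<lambda>x. inverse (cosh x) ^ k) \<in> borel_measurable HL"
    by (rule borel_measurable_HL) measurable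
  have "inverse (cosh x) ^ k = cosh x powr (- real k)" for x :: real
    by (simp add: powr_minus powr_realpow power_inverse)
  then show "AE x in HL. norm (inverse (cosh x) ^ k) \<le> norm (cosh x powr (- real k))"
    by simp
qed (use assms in simp)

definition sech_moment :: "nat \<Rightarrow> real" where
  "sech_moment n = (\<integral>x. inverse (cosh x) ^ (2 * n + 1) \<partial>HL)"

lemma sech_moment_0: "sech_moment 0 = pi / 2"
proof -
  let ?c = "\<lambda>x::real. inverse (cosh x) ^ 1"
  have i: "integrable HL ?c"
    by (rule integrable_inverse_cosh_power) simp
  have "integral {0..R} ?c = arctan (sinh R)" if "R \<ge> 0" for R
  proof (rule integral_unique)
    have "(?c has_integral arctan (sinh R) - arctan (sinh 0)) {0..R}"
    proof (rule fundamental_theorem_of_calculus[OF that])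
      fix x :: real
      have "1 + (sinh x)\<^sup>2 = (cosh x)\<^sup>2" by (simp add: cosh_square_eq)
      then have "inverse (1 + (sinh x)\<^sup>2) * cosh x = inverse (cosh x) ^ 1"
        using cosh_pos[of x] by (simp add: power2_eq_square field_simps)
      moreover have "((\<lambda>x. arctan (sinh x)) has_real_derivative inverse (1 + (sinh x)\<^sup>2) * cosh x) (at x within {0..R})"
        by (auto intro!: derivative_eq_intros)
      ultimately show "((\<lambda>x. arctan (sinh x)) has_vector_derivative inverse (cosh x) ^ 1) (at x within {0..R})"
        by (simp add: has_real_derivative_iff_has_vector_derivative)
    qed
    then show "(?c has_integral arctan (sinh R)) {0..R}" by simp
  qed
  then have "\<forall>\<^sub>F R in at_top. integral {0..R} ?c = arctan (sinh R)"
    by (rule eventually_at_top_linorderI)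
  with HL_tendsto[OF i] have "((\<lambda>R. arctan (sinh R)) \<longlongrightarrow> (\<integral>x. inverse (cosh x) ^ 1 \<partial>HL)) at_top"
    by (rule Lim_transform_eventually)
  moreover have "((\<lambda>R::real. arctan (sinh R)) \<longlongrightarrow> pi / 2) at_top"
    unfolding sinh_field_def by real_asymp
  ultimately have "(\<integral>x. inverse (cosh x) ^ 1 \<partial>HL) = pi / 2"
    by (rule tendsto_unique[OF trivial_limit_at_top_linorder])
  then show ?thesis by (simp add: sech_moment_def)
qed

text \<open>The difference of the two sides is the integral of the derivative of sinh x / (cosh
  x)^(2 n + 2), which vanishes at 0 and at infinity.\<close>

lemma sech_moment_Suc: "real (2 * n + 2) * sech_moment (Suc n) = real (2 * n + 1) * sech_moment n"
proof -
  let ?f = "\<lambda>x::real. real (2 * n + 2) * inverse (cosh x) ^ (2 * Suc n + 1) - real (2 * n + 1) * inverse (cosh x) ^ (2 * n + 1)"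
  let ?F = "\<lambda>x::real. sinh x * inverse (cosh x) ^ (2 * n + 2)"
  have i: "integrable HL ?f"
    by (intro Bochner_Integration.integrable_diff integrable_mult_right integrable_inverse_cosh_power) auto
  have D: "(?F has_real_derivative ?f x) (at x within A)" for x A
  proof -
    define c where "c = inverse (cosh x)"
    let ?d = "- (sinh x * (c * c)) * c ^ (2 * n + 1)"
    have c: "cosh x * c = 1" by (simp add: c_def)
    have "((\<lambda>x. inverse (cosh x)) has_real_derivative - (sinh x * (c * c))) (at x within A)"
      by (auto intro!: derivative_eq_intros simp: c_def)
    note this[THEN DERIV_power_Suc, of "2 * n + 1"]
    moreover have "(sinh has_real_derivative cosh x) (at x within A)"
      by (auto intro!: derivative_eq_intros)
    ultimately
    have "((\<lambda>x. sinh x * inverse (cosh x) ^ Suc (2 * n + 1)) has_real_derivative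
       cosh x * c ^ Suc (2 * n + 1) + (1 + real (2 * n + 1)) * ?d * sinh x) (at x within A)"
      unfolding c_def by (rule DERIV_mult[rotated])
    moreover have "cosh x * c ^ Suc (2 * n + 1) + (1 + real (2 * n + 1)) * ?d * sinh x = ?f x"
    proof -
      have "(sinh x * c) * (sinh x * c) = (cosh x * c) * (cosh x * c) - c * c"
        using cosh_square_eq[of x] by (simp add: power2_eq_square algebra_simps)
      then have s: "(sinh x * c) * (sinh x * c) = 1 - c * c" unfolding c by simp
      have "cosh x * c ^ Suc (2 * n + 1) = (cosh x * c) * c ^ (2 * n + 1)" by (simp add: mult_ac)
      then have 1: "cosh x * c ^ Suc (2 * n + 1) = c ^ (2 * n + 1)" unfolding c by simp
      have "(1 + real (2 * n + 1)) * ?d * sinh x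
         = - (real (2 * n + 2) * c ^ (2 * n + 1) * ((sinh x * c) * (sinh x * c)))" by (simp add: algebra_simps)
      then have 2: "(1 + real (2 * n + 1)) * ?d * sinh x
         = - (real (2 * n + 2) * c ^ (2 * n + 1) * (1 - c * c))" unfolding s .
      show ?thesis unfolding 1 2 c_def[symmetric] by (simp add: algebra_simps)
    qed
    ultimately show ?thesis by simp
  qed
  have "integral {0..R} ?f = ?F R" if "R \<ge> 0" for R
  proof (rule integral_unique)
    have "(?f has_integral ?F R - ?F 0) {0..R}"
      by (rule fundamental_theorem_of_calculus[OF that]) (use D in \<open>simp only: has_real_derivative_iff_has_vector_derivative\<close>)
    then show "(?f has_integral ?F R) {0..R}" by simp
  qed
  then have "\<forall>\<^sub>F R in at_top. integral {0..R} ?f = ?F R"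
    by (rule eventually_at_top_linorderI)
  with HL_tendsto[OF i] have "(?F \<longlongrightarrow> (\<integral>x. ?f x \<partial>HL)) at_top"
    by (rule Lim_transform_eventually)
  moreover have "(?F \<longlongrightarrow> 0) at_top"
  proof (rule Lim_null_comparison)
    show "((\<lambda>R::real. inverse (cosh R)) \<longlongrightarrow> 0) at_top"
      unfolding cosh_field_def by real_asymp
    have "norm (?F R) \<le> inverse (cosh R)" if "R \<ge> 0" for R
    proof -
      have c: "inverse (cosh R) \<le> 1" using cosh_real_ge_1[of R] by (simp add: inverse_le_1_iff)
      have "sinh R \<le> cosh R" by (simp add: sinh_def cosh_def)
      then have "sinh R * inverse (cosh R) \<le> 1" by (simp add: field_simps)
      moreover have "inverse (cosh R) ^ (2 * n + 1) \<le> inverse (cosh R)"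
        using c power_decreasing[of 1 "2 * n + 1" "inverse (cosh R)"] by simp
      ultimately have "sinh R * inverse (cosh R) * inverse (cosh R) ^ (2 * n + 1) \<le> 1 * inverse (cosh R)"
        using that by (intro mult_mono) auto
      then show ?thesis using that by (simp add: mult_ac)
    qed
    then show "\<forall>\<^sub>F R in at_top. norm (?F R) \<le> inverse (cosh R)"
      by (rule eventually_at_top_linorderI)
  qed
  ultimately have "(\<integral>x. ?f x \<partial>HL) = 0"
    by (rule tendsto_unique[OF trivial_limit_at_top_linorder])
  moreover have "(\<integral>x. ?f x \<partial>HL) = real (2 * n + 2) * sech_moment (Suc n) - real (2 * n + 1) * sech_moment n"
  proof -
    have 1: "integrable HL (\<lambda>x::real. real (2 * n + 2) * inverse (cosh x) ^ (2 * Suc n + 1))"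
      "integrable HL (\<lambda>x::real. real (2 * n + 1) * inverse (cosh x) ^ (2 * n + 1))"
      by (intro integrable_mult_right integrable_inverse_cosh_power; simp)+
    show ?thesis
      unfolding sech_moment_def
      by (simp only: Bochner_Integration.integral_diff[OF 1] integral_mult_right_zero)
  qed
  ultimately show ?thesis by simp
qed

lemma odd_dfact_Suc: "odd_dfact (Suc n) = odd_dfact n * (2 * n + 1)"
  by (simp add: odd_dfact_def)

lemma sech_moment_eq: "sech_moment n = pi / 2 * of_nat (odd_dfact n) / (2 ^ n * fact n)"
proof (induction n)
  case 0
  then show ?case by (simp add: sech_moment_0 odd_dfact_def)
next
  case (Suc n)
  have "sech_moment (Suc n) = real (2 * n + 1) * sech_moment n / real (2 * n + 2)"
    using sech_moment_Suc[of n] by (simp add: field_simps)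
  then show ?case unfolding Suc.IH odd_dfact_Suc by (simp add: field_simps)
qed

lemma fact_double: "fact (2 * n) = (of_nat (odd_dfact n) * 2 ^ n * fact n :: real)"
proof (induction n)
  case (Suc n)
  have "fact (2 * Suc n) = real (2 * n + 2) * (real (2 * n + 1) * fact (2 * n))"
    by (simp add: algebra_simps)
  then show ?case unfolding Suc.IH odd_dfact_Suc by (simp add: algebra_simps)
qed (simp add: odd_dfact_def)

text \<open>The integrand of 2 L(2 w cosh x) after the scaling \<rho> = 2 cosh x * y, chosen so that
  the exponential exp (- \<open>om\<close> w \<rho>) no longer depends on x. The factor 1 / cosh x
  comes from 2 dy = d\<rho> / cosh x.\<close>

definition psi :: "real \<Rightarrow> real \<Rightarrow> complex" where
  "psi \<rho> x = om * of_real (inverse (cosh x)) * isq (\<rho> / (2 * cosh x))"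

definition Phi :: "real \<Rightarrow> complex" where
  "Phi \<rho> = (\<integral>x. psi \<rho> x \<partial>HL)"

text \<open>Defined with the order of integration already exchanged: as a single Laplace transform Q
  inherits holomorphy and its expansion from \<open>Phi\<close>. The form with \<open>Lfun\<close>
  is recovered in \<open>Qfun_eq\<close>.\<close>

definition Qfun :: "complex \<Rightarrow> complex" where
  "Qfun w = Laplace Phi (om * w)"

lemma psi_measurable_pair: "(\<lambda>(\<rho>, x). psi \<rho> x) \<in> borel_measurable (borel \<Otimes>\<^sub>M borel)"
  unfolding psi_def by measurable

lemma psi_measurable: "psi \<rho> \<in> borel_measurable HL"
  unfolding psi_def by (rule borel_measurable_HL) measurable

lemma norm_psi_le: "norm (psi \<rho> x) \<le> inverse (cosh x)"
  using norm_isq_le_1[of "\<rho> / (2 * cosh x)"] by (simp add: psi_def norm_mult norm_inverse mult_left_le)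

lemma norm_psi_le_powr:
  assumes "\<rho> > 0" "0 < \<eta>" "\<eta> \<le> 1"
  shows "norm (psi \<rho> x) \<le> 2 * \<rho> powr (\<eta> - 1) * cosh x powr (- \<eta>)"
proof -
  have "norm (psi \<rho> x) = inverse (cosh x) * norm (isq (\<rho> / (2 * cosh x)))"
    by (simp add: psi_def norm_mult norm_inverse)
  also have "\<dots> \<le> inverse (cosh x) * (\<rho> / (2 * cosh x)) powr (- (1 - \<eta>))"
    using assms by (intro mult_left_mono norm_isq_le_powr) auto
  also have "(\<rho> / (2 * cosh x)) powr (- (1 - \<eta>)) = \<rho> powr (\<eta> - 1) * (2 powr (1 - \<eta>) * cosh x powr (1 - \<eta>))"
    using assms by (simp add: powr_divide powr_mult powr_minus_divide powr_diff field_simps)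
  also have "inverse (cosh x) * (\<rho> powr (\<eta> - 1) * (2 powr (1 - \<eta>) * cosh x powr (1 - \<eta>))) = 2 powr (1 - \<eta>) * \<rho> powr (\<eta> - 1) * cosh x powr (- \<eta>)"
    by (simp add: powr_diff powr_minus field_simps)
  also have "\<dots> \<le> 2 * \<rho> powr (\<eta> - 1) * cosh x powr (- \<eta>)"
    using powr_mono[of "1 - \<eta>" 1 2] assms by (intro mult_right_mono) auto
  finally show ?thesis .
qed

lemma integrable_psi: "integrable HL (psi \<rho>)"
  by (rule Bochner_Integration.integrable_bound[OF integrable_inverse_cosh_power[of 1]])
     (use norm_psi_le in \<open>auto intro!: psi_measurable\<close>)

lemma Phi_measurable: "Phi \<in> borel_measurable HL"
proof -
  have "(\<lambda>\<rho>. \<integral>x. psi \<rho> x \<partial>HL) \<in> borel_measurable HL"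
    by (rule HL.borel_measurable_lebesgue_integral, rule measurable_pair_HLHL, rule psi_measurable_pair)
  then show ?thesis unfolding Phi_def[abs_def] .
qed

lemma norm_Phi_le: "norm (Phi \<rho>) \<le> pi / 2"
proof -
  have "norm (Phi \<rho>) \<le> (\<integral>x. inverse (cosh x) ^ 1 \<partial>HL)"
    unfolding Phi_def
    by (rule norm_lebesgue_integral_le[OF integrable_inverse_cosh_power]) (use norm_psi_le in auto)
  then show ?thesis using sech_moment_0 by (simp add: sech_moment_def)
qed

lemma norm_Phi_le_powr:
  assumes "0 < \<eta>" "\<eta> \<le> 1"
  shows "\<exists>C\<ge>0. \<forall>\<rho>>0. norm (Phi \<rho>) \<le> C * \<rho> powr (\<eta> - 1)"
proof (intro exI[of _ "2 * (\<integral>x. cosh x powr (- \<eta>) \<partial>HL)"] conjI allI impI)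
  show "0 \<le> 2 * (\<integral>x. cosh x powr (- \<eta>) \<partial>HL)" by (simp add: integral_nonneg_AE)
  fix \<rho> :: real assume \<rho>: "\<rho> > 0"
  have "norm (Phi \<rho>) \<le> (\<integral>x. 2 * \<rho> powr (\<eta> - 1) * cosh x powr (- \<eta>) \<partial>HL)"
    unfolding Phi_def
    by (rule norm_lebesgue_integral_le) (use norm_psi_le_powr[OF \<rho> assms] integrable_cosh_powr assms in auto)
  then show "norm (Phi \<rho>) \<le> 2 * (\<integral>x. cosh x powr (- \<eta>) \<partial>HL) * \<rho> powr (\<eta> - 1)"
    by (simp add: mult_ac)
qed

lemma integrable_exp_Phi:
  assumes "c > 0" shows "integrable HL (\<lambda>x. exp (- c * x) * norm (Phi x))"
proof (rule Bochner_Integration.integrable_bound[OF integrable_mult_right[OF integrable_HL_exp[OF assms], of "pi / 2"]])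
  show "(\<lambda>x. exp (- c * x) * norm (Phi x)) \<in> borel_measurable HL"
    using Phi_measurable ident_measurable_HL by measurable
  show "AE x in HL. norm (exp (- c * x) * norm (Phi x)) \<le> norm (pi / 2 * exp (- c * x))"
    by (rule AE_I2) (use norm_Phi_le in \<open>simp add: abs_mult\<close>)
qed

definition HPl :: "complex set" where "HPl = {w. Re (om * w) > 0}"

lemma HPl_halfspace: "HPl = {w. inner (cnj om) w > 0}"
  by (auto simp: HPl_def inner_complex_def)

lemma convex_HPl: "convex HPl" and open_HPl: "open HPl"
  unfolding HPl_halfspace by (rule convex_halfspace_gt, rule open_halfspace_gt)

lemma Qfun_holomorphic: "Qfun holomorphic_on HPl"
proof (rule holomorphic_onI)
  fix w assume "w \<in> HPl"
  then have "Re (om * w) > 0" by (simp add: HPl_def)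
  from Laplace_deriv[OF Phi_measurable integrable_exp_Phi this]
  have "(Laplace Phi has_field_derivative Laplace (\<lambda>x. - of_real x * Phi x) (om * w)) (at (om * w))" .
  then have "((\<lambda>w. Laplace Phi (om * w)) has_field_derivative Laplace (\<lambda>x. - of_real x * Phi x) (om * w) * om) (at w)"
    by (rule DERIV_chain2) (auto intro!: derivative_eq_intros)
  then show "Qfun field_differentiable at w within HPl"
    unfolding Qfun_def[abs_def] field_differentiable_def by (blast intro: has_field_derivative_at_within)
qed

text \<open>An arbitrarily small negative power stands in for the logarithmic growth at 0: with
  \<open>Phi\<close> bounded by a multiple of \<rho>^(\<eta> - 1) the Laplace integral becomes a
  Gamma integral. Leaving \<eta> free lets it be adapted to the power to which Q is raised.\<close>

lemma norm_Qfun_le: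
  assumes "0 < \<eta>" "\<eta> \<le> 1"
  shows "\<exists>C\<ge>0. \<forall>w\<in>HPl. norm (Qfun w) \<le> C * Re (om * w) powr (- \<eta>)"
proof -
  obtain C where C: "C \<ge> 0" "\<And>\<rho>. \<rho> > 0 \<Longrightarrow> norm (Phi \<rho>) \<le> C * \<rho> powr (\<eta> - 1)"
    using norm_Phi_le_powr[OF assms] by blast
  have "norm (Qfun w) \<le> (C * Gamma \<eta>) * Re (om * w) powr (- \<eta>)" if "w \<in> HPl" for w
  proof -
    define c where "c = Re (om * w)"
    have c: "c > 0" using that by (simp add: c_def HPl_def)
    have "norm (Qfun w) \<le> (\<integral>x. norm (exp (- (om * w) * of_real x) * Phi x) \<partial>HL)"
      unfolding Qfun_def Laplace_def by (rule integral_norm_bound)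
    also have "\<dots> = (\<integral>x. exp (- c * x) * norm (Phi x) \<partial>HL)"
    proof -
      have "Re (- (om * w) * of_real x) = - c * x" for x
        by (simp add: c_def algebra_simps)
      then show ?thesis by (simp only: norm_mult norm_exp_eq_Re)
    qed
    also have "\<dots> \<le> (\<integral>x. C * (x powr (\<eta> - 1) * exp (- c * x)) \<partial>HL)"
    proof (rule integral_mono_AE)
      show "integrable HL (\<lambda>x. C * (x powr (\<eta> - 1) * exp (- c * x)))"
        using Gamma_HL(1)[OF c assms(1)] by simp
      show "AE x in HL. exp (- c * x) * norm (Phi x) \<le> C * (x powr (\<eta> - 1) * exp (- c * x))"
        using AE_HL_pos
      proof eventually_elim
        case (elim x)
        have "norm (Phi x) * exp (- c * x) \<le> C * x powr (\<eta> - 1) * exp (- c * x)"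
          using C(2)[OF elim] by (rule mult_right_mono) simp
        then show ?case by (simp add: mult_ac)
      qed
    qed (rule integrable_exp_Phi[OF c])
    also have "\<dots> = C * (Gamma \<eta> / c powr \<eta>)"
      using Gamma_HL(2)[OF c assms(1)] by simp
    finally show ?thesis by (simp add: c_def powr_minus_divide)
  qed
  moreover have "Gamma \<eta> > 0" using assms by (intro Gamma_real_pos)
  ultimately show ?thesis using C(1) by (intro exI[of _ "C * Gamma \<eta>"]) auto
qed

section \<open>The asymptotic expansion of Q\<close>

definition qcoef :: "nat \<Rightarrow> real" where
  "qcoef n = pi / 2 * (-4) ^ n * (of_nat (odd_dfact n) ^ 3 / (2 ^ (5 * n) * fact n))"

text \<open>On the right the coefficient as it arises: binomial coefficient, (1/2)^(2 n) from the
  scaling, moment of 1 / cosh, Laplace transform of a power. The definition isolates instead the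
  coefficient of the series behind \<open>IKM_gamma\<close>, up to the factor pi/2 and the rescaling
  by -4.\<close>

lemma qcoef_eq: "qcoef n = bcoef n * (1 / 4) ^ n * sech_moment n * fact (2 * n)"
proof -
  have "(2::real) ^ (5 * n) = 2 ^ n * (4 ^ n * 4 ^ n)"
    unfolding power_mult power_mult_distrib[symmetric] by simp
  moreover have "(-4::real) ^ n = (-1) ^ n * 4 ^ n"
    unfolding power_mult_distrib[symmetric] by simp
  ultimately show ?thesis
    unfolding qcoef_def bcoef_def sech_moment_eq fact_double
    by (simp add: power_one_over field_simps power3_eq_cube)
qed

text \<open>\<open>isq_expansion\<close> at y = \<rho> / (2 cosh x), integrated over x. As the
  remainder there is bounded for all y, this one holds for all \<rho>.\<close>

lemma Phi_expansion:
  "\<exists>C\<ge>0. \<forall>\<rho>. norm (Phi \<rho> - (\<Sum>n<N. om * of_real (bcoef n * (1 / 4) ^ n * sech_moment n) * \<i> ^ n * of_real (\<rho> ^ (2 * n)))) \<le> C * \<bar>\<rho>\<bar> ^ (2 * N)"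
proof -
  obtain C where C: "C \<ge> 0" "\<And>y. norm (isq y - (\<Sum>n<N. of_real (bcoef n) * (\<i> * of_real (y\<^sup>2)) ^ n)) \<le> C * \<bar>y\<bar> ^ (2 * N)"
    using isq_expansion[of N] by blast
  let ?E = "\<lambda>y::real. \<Sum>n<N. of_real (bcoef n) * (\<i> * of_real (y\<^sup>2)) ^ n"
  let ?S = "\<lambda>\<rho>. \<Sum>n<N. om * of_real (bcoef n * (1 / 4) ^ n * sech_moment n) * \<i> ^ n * complex_of_real (\<rho> ^ (2 * n))"
  have "norm (Phi \<rho> - ?S \<rho>)
     \<le> C * (1 / 4) ^ N * sech_moment N * \<bar>\<rho>\<bar> ^ (2 * N)" for \<rho>
  proof -
    let ?t = "\<lambda>n x. om * of_real (bcoef n * (1 / 4) ^ n) * \<i> ^ n * of_real (\<rho> ^ (2 * n)) * of_real (inverse (cosh x) ^ (2 * n + 1))"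
    have it: "integrable HL (?t n)" for n
      by (intro integrable_mult_right integrable_of_real integrable_inverse_cosh_power) simp
    have "?S \<rho>
        = (\<Sum>n<N. \<integral>x. ?t n x \<partial>HL)"
    proof (rule sum.cong[OF refl])
      fix n
      have "(\<integral>x. ?t n x \<partial>HL) = om * of_real (bcoef n * (1 / 4) ^ n) * \<i> ^ n * of_real (\<rho> ^ (2 * n)) * of_real (sech_moment n)"
        by (simp only: integral_mult_right_zero integral_complex_of_real sech_moment_def)
      then show "om * of_real (bcoef n * (1 / 4) ^ n * sech_moment n) * \<i> ^ n * of_real (\<rho> ^ (2 * n)) = (\<integral>x. ?t n x \<partial>HL)"
        by (simp only: of_real_mult mult_ac)
    qed
    also have "\<dots> = (\<integral>x. (\<Sum>n<N. ?t n x) \<partial>HL)"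
      by (rule Bochner_Integration.integral_sum[symmetric]) (rule it)
    finally have S: "?S \<rho> = (\<integral>x. (\<Sum>n<N. ?t n x) \<partial>HL)" .
    have "Phi \<rho> - ?S \<rho>
        = (\<integral>x. psi \<rho> x - (\<Sum>n<N. ?t n x) \<partial>HL)"
      unfolding S Phi_def
      by (rule Bochner_Integration.integral_diff[OF integrable_psi Bochner_Integration.integrable_sum[OF it], symmetric])
    also have "norm \<dots> \<le> (\<integral>x. C * (1 / 4) ^ N * \<bar>\<rho>\<bar> ^ (2 * N) * inverse (cosh x) ^ (2 * N + 1) \<partial>HL)"
    proof (rule norm_lebesgue_integral_le)
      show "integrable HL (\<lambda>x. C * (1 / 4) ^ N * \<bar>\<rho>\<bar> ^ (2 * N) * inverse (cosh x) ^ (2 * N + 1))"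
        by (intro integrable_mult_right integrable_inverse_cosh_power) simp
      fix x :: real
      let ?y = "\<rho> / (2 * cosh x)"
      have y2: "?y\<^sup>2 = (1 / 4) * \<rho>\<^sup>2 * (inverse (cosh x))\<^sup>2"
      proof -
        have "?y = (1 / 2) * \<rho> * inverse (cosh x)" by (simp add: field_simps)
        moreover have "((1::real) / 2)\<^sup>2 = 1 / 4" by (simp add: power2_eq_square)
        ultimately show ?thesis by (simp only: power_mult_distrib)
      qed
      have y2n: "(?y\<^sup>2) ^ n = (1 / 4) ^ n * \<rho> ^ (2 * n) * inverse (cosh x) ^ (2 * n)" for n
        unfolding y2 power_mult_distrib power_mult ..
      have "?t n x = om * of_real (inverse (cosh x)) * (of_real (bcoef n) * (\<i> * of_real (?y\<^sup>2)) ^ n)" for n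
      proof -
        have "om * of_real (inverse (cosh x)) * (of_real (bcoef n) * (\<i> * of_real (?y\<^sup>2)) ^ n)
          = om * of_real (inverse (cosh x)) * (of_real (bcoef n) * (\<i> ^ n * of_real ((?y\<^sup>2) ^ n)))"
          by (simp only: power_mult_distrib of_real_power)
        also have "\<dots> = ?t n x"
          unfolding y2n by (simp only: of_real_mult power_add power_one_right mult_ac)
        finally show ?thesis by (rule sym)
      qed
      then have "psi \<rho> x - (\<Sum>n<N. ?t n x) = om * of_real (inverse (cosh x)) * (isq ?y - ?E ?y)"
        by (simp only: psi_def right_diff_distrib sum_distrib_left)
      also have "norm \<dots> \<le> inverse (cosh x) * (C * \<bar>?y\<bar> ^ (2 * N))"
        using C(2)[of ?y] by (simp add: norm_mult norm_inverse mult_left_mono del: of_real_power)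
      also have "\<bar>?y\<bar> ^ (2 * N) = (1 / 4) ^ N * \<bar>\<rho>\<bar> ^ (2 * N) * inverse (cosh x) ^ (2 * N)"
      proof -
        have e: "\<bar>z\<bar> ^ (2 * N) = z ^ (2 * N)" for z :: real by (simp add: power_even_abs)
        have "?y ^ (2 * N) = (?y\<^sup>2) ^ N" by (rule power_mult)
        then show ?thesis unfolding e y2n .
      qed
      finally show "norm (psi \<rho> x - (\<Sum>n<N. ?t n x)) \<le> C * (1 / 4) ^ N * \<bar>\<rho>\<bar> ^ (2 * N) * inverse (cosh x) ^ (2 * N + 1)"
        by (simp add: mult_ac)
    qed
    also have "\<dots> = C * (1 / 4) ^ N * sech_moment N * \<bar>\<rho>\<bar> ^ (2 * N)"
      unfolding sech_moment_def by simp
    finally show ?thesis .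
  qed
  moreover have "sech_moment N \<ge> 0" unfolding sech_moment_def by (rule integral_nonneg_AE) simp
  ultimately show ?thesis using C(1) by (intro exI[of _ "C * (1 / 4) ^ N * sech_moment N"]) auto
qed

lemma integrable_Laplace_power:
  assumes "Re v > 0" shows "integrable HL (\<lambda>x. exp (- v * of_real x) * of_real (x ^ n))"
proof (rule integrable_Laplace[OF _ _ order_refl])
  show "(\<lambda>x. complex_of_real (x ^ n)) \<in> borel_measurable HL"
    by (rule borel_measurable_HL) measurable
  have "integrable HL (\<lambda>x. norm (x ^ n * exp (- Re v * x)))"
    by (rule integrable_norm[OF power_exp_HL(1)[OF assms]])
  then show "integrable HL (\<lambda>x. exp (- Re v * x) * norm (complex_of_real (x ^ n)))"
    by (simp add: abs_mult mult.commute norm_power power_abs)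
qed

text \<open>Watson's lemma without splitting the range of integration, since the expansion of
  \<open>Phi\<close> has a global remainder bound.\<close>

lemma Qfun_expansion:
  "\<exists>C\<ge>0. \<forall>w\<in>HPl. norm (Qfun w - (\<Sum>n<N. of_real (qcoef n) / w ^ (2 * n + 1))) \<le> C / Re (om * w) ^ (2 * N + 1)"
proof -
  let ?a = "\<lambda>n. om * of_real (bcoef n * (1 / 4) ^ n * sech_moment n) * \<i> ^ n"
  obtain C where C: "C \<ge> 0" "\<And>\<rho>. norm (Phi \<rho> - (\<Sum>n<N. ?a n * of_real (\<rho> ^ (2 * n)))) \<le> C * \<bar>\<rho>\<bar> ^ (2 * N)"
    using Phi_expansion[of N] by blast
  have "norm (Qfun w - (\<Sum>n<N. of_real (qcoef n) / w ^ (2 * n + 1))) \<le> C * fact (2 * N) / Re (om * w) ^ (2 * N + 1)"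
    if "w \<in> HPl" for w
  proof -
    define v where "v = om * w"
    have v: "Re v > 0" using that by (simp add: v_def HPl_def)
    have w: "w \<noteq> 0" using v by (auto simp: v_def)
    let ?u = "\<lambda>n x. exp (- v * of_real x) * complex_of_real (x ^ (2 * n))"
    have it: "integrable HL (\<lambda>x. ?a n * ?u n x)" for n
      by (intro integrable_mult_right integrable_Laplace_power v)
    have iP: "integrable HL (\<lambda>x. exp (- v * of_real x) * Phi x)"
      by (rule integrable_Laplace[OF Phi_measurable integrable_exp_Phi[OF v] order_refl])
    have trm: "of_real (qcoef n) / w ^ (2 * n + 1) = (\<integral>x. ?a n * ?u n x \<partial>HL)" for n
    proof -
      have "(\<integral>x. ?a n * ?u n x \<partial>HL) = ?a n * Laplace (\<lambda>x. of_real (x ^ (2 * n))) v"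
        unfolding Laplace_def by (rule integral_mult_right_zero)
      also have "\<dots> = ?a n * (fact (2 * n) / v ^ Suc (2 * n))"
        by (simp only: Laplace_power[OF v])
      also have "v ^ Suc (2 * n) = om * \<i> ^ n * w ^ (2 * n + 1)"
      proof -
        \<comment> \<open>The square of \<open>om\<close> is i, which cancels the i^n in the
          expansion of \<open>Phi\<close>; this is why the coefficients of Q are real.\<close>
        have "om ^ (2 * n) = \<i> ^ n" by (simp only: power_mult om_power2)
        then show ?thesis by (simp add: v_def power_mult_distrib mult_ac)
      qed
      also have "?a n * (fact (2 * n) / (om * \<i> ^ n * w ^ (2 * n + 1))) = of_real (bcoef n * (1 / 4) ^ n * sech_moment n) * fact (2 * n) / w ^ (2 * n + 1)"
        using w by (simp add: field_simps)
      finally show ?thesis unfolding qcoef_eq by simp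
    qed
    have "Qfun w - (\<Sum>n<N. of_real (qcoef n) / w ^ (2 * n + 1))
      = (\<integral>x. exp (- v * of_real x) * Phi x \<partial>HL) - (\<Sum>n<N. \<integral>x. ?a n * ?u n x \<partial>HL)"
      unfolding trm by (simp only: Qfun_def Laplace_def v_def)
    also have "(\<Sum>n<N. \<integral>x. ?a n * ?u n x \<partial>HL)
      = (\<integral>x. (\<Sum>n<N. ?a n * ?u n x) \<partial>HL)"
      by (rule Bochner_Integration.integral_sum[symmetric]) (rule it)
    also have "(\<integral>x. exp (- v * of_real x) * Phi x \<partial>HL) - \<dots>
      = (\<integral>x. exp (- v * of_real x) * Phi x - (\<Sum>n<N. ?a n * ?u n x) \<partial>HL)"
      by (rule Bochner_Integration.integral_diff[OF iP Bochner_Integration.integrable_sum[OF it], symmetric])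
    also have "norm \<dots> \<le> (\<integral>x. C * (x ^ (2 * N) * exp (- Re v * x)) \<partial>HL)"
    proof (rule norm_lebesgue_integral_le)
      show "integrable HL (\<lambda>x. C * (x ^ (2 * N) * exp (- Re v * x)))"
        by (intro integrable_mult_right power_exp_HL v)
      fix x :: real
      have "exp (- v * of_real x) * Phi x - (\<Sum>n<N. ?a n * ?u n x)
         = exp (- v * of_real x) * (Phi x - (\<Sum>n<N. ?a n * of_real (x ^ (2 * n))))"
        unfolding right_diff_distrib sum_distrib_left by (simp only: mult.left_commute)
      also have "norm \<dots> = exp (- Re v * x) * norm (Phi x - (\<Sum>n<N. ?a n * of_real (x ^ (2 * n))))"
        by (simp add: norm_mult)
      also have "\<dots> \<le> exp (- Re v * x) * (C * \<bar>x\<bar> ^ (2 * N))"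
        by (rule mult_left_mono[OF C(2)]) simp
      also have "\<bar>x\<bar> ^ (2 * N) = x ^ (2 * N)"
        by (simp add: power_even_abs)
      also have "exp (- Re v * x) * (C * x ^ (2 * N)) = C * (x ^ (2 * N) * exp (- Re v * x))"
        by (simp only: mult_ac)
      finally show "norm (exp (- v * of_real x) * Phi x - (\<Sum>n<N. ?a n * ?u n x))
         \<le> C * (x ^ (2 * N) * exp (- Re v * x))" .
    qed
    also have "\<dots> = C * fact (2 * N) / Re v ^ (2 * N + 1)"
      using power_exp_HL(2)[OF v, of "2 * N"] by simp
    finally show ?thesis by (simp add: v_def)
  qed
  then show ?thesis using C(1) by (intro exI[of _ "C * fact (2 * N)"]) auto
qed

text \<open>Fubini in (\<rho>, x) with majorant exp (- Re v \<rho>) / cosh x, followed by undoing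
  the scaling built into \<open>psi\<close>.\<close>

lemma Qfun_eq:
  assumes "w \<in> HPl"
  shows "integrable HL (\<lambda>x. 2 * Lfun (2 * of_real (cosh x) * w))"
    "Qfun w = (\<integral>x. 2 * Lfun (2 * of_real (cosh x) * w) \<partial>HL)"
proof -
  let ?L = "\<lambda>x. 2 * Lfun (2 * of_real (cosh x) * w)"
  define v where "v = om * w"
  let ?h = "\<lambda>\<rho> x. exp (- v * of_real \<rho>) * psi \<rho> x"
  have v: "Re v > 0" using assms by (simp add: v_def HPl_def)
  have int: "integrable (HL \<Otimes>\<^sub>M HL) (\<lambda>(\<rho>, x). ?h \<rho> x)"
  proof (rule HL2.Fubini_integrable)
    show "(\<lambda>(\<rho>, x). ?h \<rho> x) \<in> borel_measurable (HL \<Otimes>\<^sub>M HL)"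
      by (rule measurable_pair_HLHL) (unfold psi_def, measurable)
    show "AE \<rho> in HL. integrable HL (\<lambda>x. case (\<rho>, x) of (\<rho>, x) \<Rightarrow> ?h \<rho> x)"
      by (simp add: integrable_psi)
    show "integrable HL (\<lambda>\<rho>. \<integral>x. norm (case (\<rho>, x) of (\<rho>, x) \<Rightarrow> ?h \<rho> x) \<partial>HL)"
    proof (rule Bochner_Integration.integrable_bound[OF integrable_mult_right[OF integrable_HL_exp[OF v], of "pi / 2"]])
      show "(\<lambda>\<rho>. \<integral>x. norm (case (\<rho>, x) of (\<rho>, x) \<Rightarrow> ?h \<rho> x) \<partial>HL) \<in> borel_measurable HL"
        by (rule HL.borel_measurable_lebesgue_integral, rule measurable_pair_HLHL) (unfold psi_def, measurable)
      have "(\<integral>x. norm (?h \<rho> x) \<partial>HL) \<le> pi / 2 * exp (- Re v * \<rho>)" for \<rho>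
      proof -
        have "(\<integral>x. norm (?h \<rho> x) \<partial>HL) \<le> (\<integral>x. exp (- Re v * \<rho>) * inverse (cosh x) ^ 1 \<partial>HL)"
        proof (rule integral_mono)
          show "integrable HL (\<lambda>x. norm (?h \<rho> x))"
            by (intro integrable_norm integrable_mult_right integrable_psi)
          show "integrable HL (\<lambda>x. exp (- Re v * \<rho>) * inverse (cosh x) ^ 1)"
            by (intro integrable_mult_right integrable_inverse_cosh_power) simp
        qed (use norm_psi_le in \<open>simp add: norm_mult\<close>)
        also have "\<dots> = pi / 2 * exp (- Re v * \<rho>)"
          using sech_moment_0 by (simp add: sech_moment_def)
        finally show ?thesis .
      qed
      then show "AE \<rho> in HL. norm (\<integral>x. norm (case (\<rho>, x) of (\<rho>, x) \<Rightarrow> ?h \<rho> x) \<partial>HL) \<le> norm (pi / 2 * exp (- Re v * \<rho>))"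
        by (simp add: integral_nonneg_AE)
    qed
  qed
  have inner: "(\<integral>\<rho>. ?h \<rho> x \<partial>HL) = ?L x" for x
  proof -
    have "(\<integral>\<rho>. ?h \<rho> x \<partial>HL)
      = (2 * cosh x) *\<^sub>R (\<integral>\<sigma>. exp (- v * of_real (2 * cosh x * \<sigma>)) * psi (2 * cosh x * \<sigma>) x \<partial>HL)"
      by (rule HL_scale(2)) simp
    also have "(\<lambda>\<sigma>. exp (- v * of_real (2 * cosh x * \<sigma>)) * psi (2 * cosh x * \<sigma>) x)
      = (\<lambda>\<sigma>. of_real (inverse (cosh x)) * (exp (- (om * (2 * of_real (cosh x) * w)) * of_real \<sigma>) * (om * isq \<sigma>)))"
      by (simp add: psi_def v_def mult_ac)
    also have "(\<integral>\<sigma>. of_real (inverse (cosh x)) * (exp (- (om * (2 * of_real (cosh x) * w)) * of_real \<sigma>) * (om * isq \<sigma>)) \<partial>HL)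
      = of_real (inverse (cosh x)) * Lfun (2 * of_real (cosh x) * w)"
      unfolding Lfun_def Laplace_def by (rule integral_mult_right_zero)
    also have "(2 * cosh x) *\<^sub>R (of_real (inverse (cosh x)) * Lfun (2 * of_real (cosh x) * w)) = ?L x"
      by (simp add: scaleR_conv_of_real)
    finally show ?thesis .
  qed
  show "integrable HL ?L"
    using HL2.integrable_snd[OF int] unfolding inner .
  have "Qfun w = (\<integral>\<rho>. (\<integral>x. ?h \<rho> x \<partial>HL) \<partial>HL)"
    unfolding Qfun_def Laplace_def Phi_def v_def by simp
  also have "\<dots> = (\<integral>x. (\<integral>\<rho>. ?h \<rho> x \<partial>HL) \<partial>HL)"
    using HL2.Fubini_integral[OF int] by simp
  finally show "Qfun w = (\<integral>x. ?L x \<partial>HL)"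
    unfolding inner .
qed

lemma Qfun_real:
  assumes "x > 0" shows "Im (Qfun (of_real x)) = 0"
proof -
  have "of_real x \<in> HPl" using assms by (simp add: HPl_def Re_om)
  note Q = Qfun_eq[OF this]
  have "Im (Qfun (of_real x)) = (\<integral>u. Im (2 * Lfun (2 * of_real (cosh u) * of_real x)) \<partial>HL)"
    unfolding Q(2) by (rule integral_Im[OF Q(1), symmetric])
  also have "\<dots> = (\<integral>u. 0 \<partial>HL)"
  proof (rule Bochner_Integration.integral_cong[OF refl])
    fix u
    have "2 * complex_of_real (cosh u) * of_real x = of_real (2 * cosh u * x)" by simp
    then show "Im (2 * Lfun (2 * of_real (cosh u) * of_real x)) = 0"
      using Lfun_real[of "2 * cosh u * x"] assms by simp
  qed
  finally show ?thesis by simp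
qed

lemma Qfun_imag:
  assumes t: "t > 0"
  shows "Qfun (- \<i> * of_real t) = of_real ((bessel_K0 t)\<^sup>2) + \<i> * of_real (pi * bessel_I0 t * bessel_K0 t)"
proof -
  let ?w = "- \<i> * complex_of_real t"
  have "?w \<in> HPl" using t by (simp add: HPl_def Im_om)
  note Q = Qfun_eq[OF this]
  have L: "2 * Lfun (2 * of_real (cosh x) * (?w)) = Complex (2 * bessel_K0 (2 * t * cosh x)) (2 * Vfun (2 * t * cosh x))" for x
  proof -
    have "2 * of_real (cosh x) * (?w) = - \<i> * of_real (2 * t * cosh x)" by simp
    moreover have "2 * t * cosh x > 0" using t by simp
    ultimately have "Lfun (2 * of_real (cosh x) * (?w)) = of_real (bessel_K0 (2 * t * cosh x)) + \<i> * of_real (Vfun (2 * t * cosh x))"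
      unfolding Vfun_def by (simp only: Lfun_imag)
    then show ?thesis by (simp add: complex_eq_iff)
  qed
  have "Re (Qfun (?w)) = (\<integral>x. Re (2 * Lfun (2 * of_real (cosh x) * (?w))) \<partial>HL)"
    unfolding Q(2) by (rule integral_Re[OF Q(1), symmetric])
  also have "\<dots> = (bessel_K0 t)\<^sup>2"
    unfolding L using bessel_K0_square(2)[OF t] by simp
  finally have 1: "Re (Qfun (?w)) = (bessel_K0 t)\<^sup>2" .
  have "Im (Qfun (?w)) = (\<integral>x. Im (2 * Lfun (2 * of_real (cosh x) * (?w))) \<partial>HL)"
    unfolding Q(2) by (rule integral_Im[OF Q(1), symmetric])
  also have "\<dots> = pi * bessel_I0 t * bessel_K0 t"
    unfolding L using bessel_I0_K0_Vfun[OF t] by simp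
  finally have 2: "Im (Qfun (?w)) = pi * bessel_I0 t * bessel_K0 t" .
  show ?thesis
  proof (rule complex_eqI)
    show "Re (Qfun (?w)) = Re (of_real ((bessel_K0 t)\<^sup>2) + \<i> * of_real (pi * bessel_I0 t * bessel_K0 t))"
      unfolding 1 by simp
    show "Im (Qfun (?w)) = Im (of_real ((bessel_K0 t)\<^sup>2) + \<i> * of_real (pi * bessel_I0 t * bessel_K0 t))"
      unfolding 2 by simp
  qed
qed

section \<open>Powers of truncated expansions\<close>

lemma trunc_product_sum:
  fixes X :: "'a::real_normed_field"
  assumes "norm X \<le> 1"
  shows "norm ((\<Sum>i<N. fps_nth A i * X ^ i) * (\<Sum>j<N. fps_nth B j * X ^ j) - (\<Sum>n<N. fps_nth (A * B) n * X ^ n))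
     \<le> (\<Sum>i<N. norm (fps_nth A i)) * (\<Sum>j<N. norm (fps_nth B j)) * norm X ^ N"
proof -
  let ?g = "\<lambda>p. norm (fps_nth A (fst p)) * norm (fps_nth B (snd p)) * norm X ^ N"
  let ?D = "\<Sum>n<N. fps_nth (A * B) n * X ^ n"
  let ?f = "\<lambda>(i, j). fps_nth A i * fps_nth B j * X ^ (i + j)"
  let ?S = "{..<N} \<times> {..<N}"
  let ?T = "{(i, j). i + j < N}"
  have T: "?T \<subseteq> ?S" by auto
  then have fT: "finite ?T" by (rule finite_subset) simp
  have "(\<Sum>i<N. fps_nth A i * X ^ i) * (\<Sum>j<N. fps_nth B j * X ^ j) = sum ?f ?S"
    by (simp add: sum_product sum.cartesian_product power_add mult_ac)
  moreover have "?D = sum ?f ?T"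
  proof -
    have "sum ?f ?T = (\<Sum>n<N. \<Sum>i\<le>n. fps_nth A i * fps_nth B (n - i) * X ^ (i + (n - i)))"
      using sum.triangle_reindex[of "\<lambda>i j. fps_nth A i * fps_nth B j * X ^ (i + j)" N] by simp
    also have "\<dots> = ?D"
      by (intro sum.cong refl) (simp add: fps_mult_nth sum_distrib_right atLeast0AtMost)
    finally show ?thesis by simp
  qed
  moreover have "sum ?f ?S - sum ?f ?T = sum ?f (?S - ?T)"
    using T by (intro sum_diff[symmetric]) auto
  moreover have "norm (sum ?f (?S - ?T)) \<le> (\<Sum>p\<in>?S - ?T. ?g p)"
  proof (rule sum_norm_le)
    fix p assume p: "p \<in> ?S - ?T"
    obtain i j where ij: "p = (i, j)" by (cases p)
    \<comment> \<open>The truncated series of the product is the triangle inside the square of index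
      pairs; every pair outside the triangle carries at least N powers of X.\<close>
    have "N \<le> i + j" using p ij by auto
    then have "norm X ^ (i + j) \<le> norm X ^ N" using assms by (intro power_decreasing) auto
    then show "norm (?f p) \<le> ?g p"
      by (simp add: ij norm_mult norm_power mult_left_mono)
  qed
  moreover have "\<dots> \<le> (\<Sum>p\<in>?S. ?g p)"
    by (rule sum_mono2) auto
  moreover have "\<dots> = (\<Sum>i<N. norm (fps_nth A i)) * (\<Sum>j<N. norm (fps_nth B j)) * norm X ^ N"
    by (simp only: sum_distrib_right[symmetric] sum_product sum.cartesian_product case_prod_unfold)
  ultimately show ?thesis by simp
qed

lemma trunc_mult:
  fixes X :: "'a::real_normed_field"
  assumes X: "norm X \<le> 1" and C: "0 \<le> C1" "0 \<le> C2"
    and Y: "norm (Y1 - (\<Sum>i<N. fps_nth A i * X ^ i)) \<le> C1 * norm X ^ N"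
      "norm (Y2 - (\<Sum>i<N. fps_nth B i * X ^ i)) \<le> C2 * norm X ^ N"
  defines "a \<equiv> (\<Sum>i<N. norm (fps_nth A i))" and "b \<equiv> (\<Sum>i<N. norm (fps_nth B i))"
  shows "norm (Y1 * Y2 - (\<Sum>n<N. fps_nth (A * B) n * X ^ n)) \<le> (C1 * (b + C2) + a * C2 + a * b) * norm X ^ N"
proof -
  let ?T = "\<Sum>n<N. fps_nth (A * B) n * X ^ n"
  define u where "u = (\<Sum>i<N. fps_nth A i * X ^ i)"
  define v where "v = (\<Sum>i<N. fps_nth B i * X ^ i)"
  have X1: "norm X ^ n \<le> 1" for n using X by (intro power_le_one) auto
  have bd: "norm (\<Sum>i<N. fps_nth A i * X ^ i) \<le> (\<Sum>i<N. norm (fps_nth A i))" for A :: "'a fps"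
    by (rule sum_norm_le) (use X1 in \<open>simp add: norm_mult norm_power mult_left_le\<close>)
  have "norm Y2 \<le> norm (Y2 - v) + norm v" using norm_triangle_ineq[of "Y2 - v" v] by simp
  also have "\<dots> \<le> C2 * 1 + b"
    using Y(2) bd[of B] X1[of N] mult_left_mono[OF X1[of N] C(2)] unfolding v_def b_def by linarith
  finally have Y2: "norm Y2 \<le> b + C2" by simp
  have "Y1 * Y2 - ?T = (Y1 - u) * Y2 + u * (Y2 - v) + (u * v - ?T)"
    by (simp add: algebra_simps)
  also have "norm \<dots> \<le> norm ((Y1 - u) * Y2) + norm (u * (Y2 - v)) + norm (u * v - ?T)"
    by (rule order_trans[OF norm_triangle_ineq add_right_mono[OF norm_triangle_ineq]])
  also have "\<dots> \<le> (C1 * norm X ^ N) * (b + C2) + a * (C2 * norm X ^ N) + a * b * norm X ^ N"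
  proof (intro add_mono)
    show "norm ((Y1 - u) * Y2) \<le> (C1 * norm X ^ N) * (b + C2)"
      unfolding norm_mult using Y(1) Y2 C by (intro mult_mono) (auto simp: u_def)
    show "norm (u * (Y2 - v)) \<le> a * (C2 * norm X ^ N)"
      unfolding norm_mult using Y(2) bd[of A] by (intro mult_mono) (auto simp: u_def v_def a_def intro: sum_nonneg)
    show "norm (u * v - ?T) \<le> a * b * norm X ^ N"
      unfolding u_def v_def a_def b_def by (rule trunc_product_sum[OF X])
  qed
  finally show ?thesis by (simp add: algebra_simps)
qed

text \<open>The constant is chosen before X and Y, so an expansion that is uniform in w yields one
  of its M-th power that is again uniform.\<close>

lemma trunc_power:
  fixes A :: "'a::real_normed_field fps"
  assumes "C \<ge> 0"
  shows "\<exists>C'\<ge>0. \<forall>X Y. norm X \<le> 1 \<longrightarrow> norm (Y - (\<Sum>i<N. fps_nth A i * X ^ i)) \<le> C * norm X ^ N \<longrightarrow>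
    norm (Y ^ M - (\<Sum>i<N. fps_nth (A ^ M) i * X ^ i)) \<le> C' * norm X ^ N"
proof (induction M)
  case 0
  have "norm (1 - (\<Sum>i<N. fps_nth (1 :: 'a fps) i * X ^ i)) \<le> 1 * norm X ^ N" for X :: 'a
  proof (cases N)
    case (Suc m)
    have "(\<Sum>i<N. fps_nth (1 :: 'a fps) i * X ^ i) = 1"
      unfolding Suc lessThan_Suc_eq_insert_0 by (simp add: sum.insert_if image_iff sum.reindex)
    then show ?thesis by simp
  qed simp
  then show ?case by (intro exI[of _ 1]) simp
next
  case (Suc M)
  then obtain C' where C': "C' \<ge> 0" "\<And>X Y. norm X \<le> 1 \<Longrightarrow> norm (Y - (\<Sum>i<N. fps_nth A i * X ^ i)) \<le> C * norm X ^ N \<Longrightarrow>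
    norm (Y ^ M - (\<Sum>i<N. fps_nth (A ^ M) i * X ^ i)) \<le> C' * norm X ^ N" by blast
  define a where "a = (\<Sum>i<N. norm (fps_nth A i))"
  define b where "b = (\<Sum>i<N. norm (fps_nth (A ^ M) i))"
  have ab: "a \<ge> 0" "b \<ge> 0" by (auto simp: a_def b_def intro: sum_nonneg)
  show ?case
  proof (intro exI[of _ "C * (b + C') + a * C' + a * b"] conjI allI impI)
    show "0 \<le> C * (b + C') + a * C' + a * b" using ab C'(1) assms by simp
    fix X Y :: 'a assume X: "norm X \<le> 1" and Y: "norm (Y - (\<Sum>i<N. fps_nth A i * X ^ i)) \<le> C * norm X ^ N"
    from trunc_mult[OF X assms C'(1) Y C'(2)[OF X Y]]
    show "norm (Y ^ Suc M - (\<Sum>i<N. fps_nth (A ^ Suc M) i * X ^ i)) \<le> (C * (b + C') + a * C' + a * b) * norm X ^ N"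
      by (simp add: a_def b_def)
  qed
qed

text \<open>A constant factor and a rescaling of the variable commute with powers. With c = pi/2 and
  d = -4 this ties the powers of \<open>Qseries\<close> to the rational series behind
  \<open>IKM_gamma\<close>.\<close>

lemma fps_power_scaled:
  fixes B :: "complex fps" and G :: "rat fps"
  assumes "\<And>n. fps_nth B n = c * d ^ n * of_real (of_rat (fps_nth G n))"
  shows "fps_nth (B ^ M) n = c ^ M * d ^ n * of_real (of_rat (fps_nth (G ^ M) n))"
proof (induction M arbitrary: n)
  case 0
  then show ?case by simp
next
  case (Suc M)
  have "fps_nth (B ^ Suc M) n = (\<Sum>i=0..n. (c * d ^ i * of_real (of_rat (fps_nth G i))) * (c ^ M * d ^ (n - i) * of_real (of_rat (fps_nth (G ^ M) (n - i)))))"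
    by (simp add: fps_mult_nth assms Suc.IH)
  also have "\<dots> = (\<Sum>i=0..n. c ^ Suc M * d ^ n * of_real (of_rat (fps_nth G i * fps_nth (G ^ M) (n - i))))"
  proof (rule sum.cong[OF refl])
    fix i assume "i \<in> {0..n}"
    then have "d ^ n = d ^ i * d ^ (n - i)" by (simp flip: power_add)
    then show "(c * d ^ i * of_real (of_rat (fps_nth G i))) * (c ^ M * d ^ (n - i) * of_real (of_rat (fps_nth (G ^ M) (n - i))))
      = c ^ Suc M * d ^ n * of_real (of_rat (fps_nth G i * fps_nth (G ^ M) (n - i)))"
      by (simp add: of_rat_mult mult_ac)
  qed
  also have "\<dots> = c ^ Suc M * d ^ n * of_real (of_rat (fps_nth (G ^ Suc M) n))"
    by (simp add: fps_mult_nth of_rat_sum sum_distrib_left)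
  finally show ?case .
qed

definition Qseries :: "complex fps" where
  "Qseries = Abs_fps (\<lambda>n. of_real (qcoef n))"

lemma Qseries_power:
  assumes "k = 2 * M"
  shows "fps_nth (Qseries ^ M) n = of_real ((pi / 2) ^ M * (-4) ^ n * of_rat (IKM_gamma k n))"
proof -
  define G where "G = Abs_fps (\<lambda>n. of_nat (odd_dfact n) ^ 3 / (2 ^ (5 * n) * fact n) :: rat)"
  have "fps_nth Qseries n = of_real (pi / 2) * of_real (- 4) ^ n * of_real (of_rat (fps_nth G n))" for n
  proof -
    have "of_rat (fps_nth G n) = of_nat (odd_dfact n) ^ 3 / (2 ^ (5 * n) * (fact n :: real))"
    proof -
      have "of_rat (fact n) = (fact n :: real)"
        using of_rat_of_nat_eq[of "fact n", where 'a=real] by simp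
      then show ?thesis by (simp add: G_def of_rat_divide of_rat_mult of_rat_power)
    qed
    then show ?thesis by (simp add: Qseries_def qcoef_def)
  qed
  from fps_power_scaled[OF this, of M n] show ?thesis
    by (simp add: IKM_gamma_def G_def assms)
qed

text \<open>Multiplication by \<open>om\<close> rotates the closed fourth quadrant to arguments
  between - pi/4 and pi/4, where the real part is at least |w| / sqrt 2; the constant 1/2 is a
  convenient lower bound.\<close>

lemma quadrant_Re_ge:
  assumes "Re w \<ge> 0" "Im w \<le> 0"
  shows "Re (om * w) \<ge> norm w / 2"
proof -
  have "norm w \<le> Re w - Im w" using cmod_le[of w] assms by simp
  moreover have "Re (om * w) = sqrt 2 / 2 * (Re w - Im w)" by (simp add: Re_om Im_om algebra_simps)
  moreover have "1 / 2 * (Re w - Im w) \<le> sqrt 2 / 2 * (Re w - Im w)"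
    using assms by (intro mult_right_mono) auto
  ultimately show ?thesis by simp
qed

lemma quadrant_in_HPl:
  assumes "Re w \<ge> 0" "Im w \<le> 0" "w \<noteq> 0" shows "w \<in> HPl"
proof -
  have "0 < norm w / 2" using assms(3) by simp
  also have "\<dots> \<le> Re (om * w)" by (rule quadrant_Re_ge[OF assms(1,2)])
  finally show ?thesis unfolding HPl_def by blast
qed

definition quad :: "complex set" where "quad = {w. Re w \<ge> 0 \<and> Im w \<le> 0 \<and> w \<noteq> 0}"

text \<open>The factor w makes the expansion a power series in 1 / w^2, the form that
  \<open>trunc_power\<close> takes; its exponents are then all even.\<close>

lemma Qfun_quad_expansion:
  "\<exists>C\<ge>0. \<forall>w\<in>quad. norm (w * Qfun w - (\<Sum>n<N. fps_nth Qseries n * (inverse (w\<^sup>2)) ^ n)) \<le> C * norm (inverse (w\<^sup>2)) ^ N"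
proof -
  obtain C where C: "C \<ge> 0" "\<And>w. w \<in> HPl \<Longrightarrow> norm (Qfun w - (\<Sum>n<N. of_real (qcoef n) / w ^ (2 * n + 1))) \<le> C / Re (om * w) ^ (2 * N + 1)"
    using Qfun_expansion[of N] by blast
  have "norm (w * Qfun w - (\<Sum>n<N. fps_nth Qseries n * (inverse (w\<^sup>2)) ^ n)) \<le> C * 2 ^ (2 * N + 1) * norm (inverse (w\<^sup>2)) ^ N"
    if "w \<in> quad" for w
  proof -
    have w: "Re w \<ge> 0" "Im w \<le> 0" "w \<noteq> 0" using that by (auto simp: quad_def)
    have "w * (of_real (qcoef n) / w ^ (2 * n + 1)) = fps_nth Qseries n * (inverse (w\<^sup>2)) ^ n" for n
      using w(3) by (simp add: Qseries_def power_inverse power_mult divide_inverse)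
    then have "w * Qfun w - (\<Sum>n<N. fps_nth Qseries n * (inverse (w\<^sup>2)) ^ n) = w * (Qfun w - (\<Sum>n<N. of_real (qcoef n) / w ^ (2 * n + 1)))"
      by (simp add: right_diff_distrib sum_distrib_left)
    also have "norm \<dots> \<le> norm w * (C / Re (om * w) ^ (2 * N + 1))"
      unfolding norm_mult using C(2)[OF quadrant_in_HPl[OF w]] by (rule mult_left_mono) simp
    also have "\<dots> \<le> norm w * (C / (norm w / 2) ^ (2 * N + 1))"
    proof -
      define c where "c = Re (om * w)"
      have "norm w / 2 \<le> c" "c > 0"
        using quadrant_Re_ge[OF w(1,2)] quadrant_in_HPl[OF w] unfolding HPl_def c_def by blast+
      then show ?thesis
        unfolding c_def[symmetric] using C(1) w(3)
        by (intro mult_left_mono divide_left_mono power_mono mult_pos_pos zero_less_power) auto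
    qed
    also have "\<dots> = C * 2 ^ (2 * N + 1) * norm (inverse (w\<^sup>2)) ^ N"
    proof -
      have n: "norm (inverse (w\<^sup>2)) ^ N = inverse (norm w ^ (2 * N))"
        by (simp add: norm_inverse norm_power power_inverse power_mult)
      show ?thesis
        unfolding n
      proof -
        have "(norm w / 2) ^ (2 * N + 1) = norm w ^ (2 * N) * norm w / 2 ^ (2 * N + 1)"
          by (simp add: power_divide)
        then show "norm w * (C / (norm w / 2) ^ (2 * N + 1)) = C * 2 ^ (2 * N + 1) * inverse (norm w ^ (2 * N))"
          using w(3) by (simp only:) (simp add: field_simps)
      qed
    qed
    finally show ?thesis .
  qed
  then show ?thesis using C(1) by (intro exI[of _ "C * 2 ^ (2 * N + 1)"]) auto
qed

lemma imag_even_power: "(\<i> * of_real b) ^ (2 * l) = of_real ((-1) ^ l * b ^ (2 * l))"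
proof -
  have "(\<i> * of_real b)\<^sup>2 = of_real (- (b\<^sup>2))" by (simp add: power_mult_distrib)
  then have "(\<i> * of_real b) ^ (2 * l) = of_real ((- (b\<^sup>2)) ^ l)" by (simp only: power_mult of_real_power)
  also have "(- (b\<^sup>2)) ^ l = (-1) ^ l * b ^ (2 * l)" unfolding power_mult by (rule power_minus)
  finally show ?thesis .
qed

text \<open>Odd powers of i b are purely imaginary, so only the even binomial indices contribute to
  the real part.\<close>

lemma Re_even_power:
  fixes a b :: real
  shows "Re ((of_real a + \<i> * of_real b) ^ (2 * m)) = (\<Sum>j\<le>m. of_nat ((2 * m) choose (2 * j)) * (-1) ^ j * b ^ (2 * j) * a ^ (2 * m - 2 * j))"
proof -
  let ?f = "\<lambda>k. Re (of_nat ((2 * m) choose k) * (\<i> * of_real b) ^ k * of_real a ^ (2 * m - k))"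
  have "Re ((of_real a + \<i> * of_real b) ^ (2 * m)) = (\<Sum>k\<le>2 * m. ?f k)"
    unfolding add.commute[of "of_real a"] binomial_ring Re_sum ..
  also have "\<dots> = (\<Sum>k\<in>(\<lambda>j. 2 * j) ` {..m}. ?f k)"
  proof (rule sum.mono_neutral_right)
    show "\<forall>k\<in>{..2 * m} - (\<lambda>j. 2 * j) ` {..m}. ?f k = 0"
    proof
      fix k assume k: "k \<in> {..2 * m} - (\<lambda>j. 2 * j) ` {..m}"
      have "odd k" using k by (auto elim!: evenE)
      then obtain l where l: "k = 2 * l + 1" by (auto elim: oddE)
      have "(\<i> * of_real b) ^ k = \<i> * of_real ((-1) ^ l * b ^ k)"
        unfolding l power_add imag_even_power by simp
      then have "of_nat ((2 * m) choose k) * (\<i> * of_real b) ^ k * of_real a ^ (2 * m - k)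
         = \<i> * of_real (of_nat ((2 * m) choose k) * ((-1) ^ l * b ^ k) * a ^ (2 * m - k))"
        by simp
      then show "?f k = 0" by (simp only: Re_i_times Im_complex_of_real)
    qed
  qed auto
  also have "\<dots> = (\<Sum>j\<le>m. ?f (2 * j))"
    by (subst sum.reindex) (auto simp: inj_on_def)
  also have "\<dots> = (\<Sum>j\<le>m. of_nat ((2 * m) choose (2 * j)) * (-1) ^ j * b ^ (2 * j) * a ^ (2 * m - 2 * j))"
  proof (rule sum.cong[OF refl])
    fix j
    have "of_nat ((2 * m) choose (2 * j)) * (\<i> * of_real b) ^ (2 * j) * of_real a ^ (2 * m - 2 * j)
         = of_real (of_nat ((2 * m) choose (2 * j)) * ((-1) ^ j * b ^ (2 * j)) * a ^ (2 * m - 2 * j))"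
      unfolding imag_even_power by simp
    then show "?f (2 * j) = of_nat ((2 * m) choose (2 * j)) * (-1) ^ j * b ^ (2 * j) * a ^ (2 * m - 2 * j)"
      by (simp only: Re_complex_of_real mult.assoc)
  qed
  finally show ?thesis .
qed

section \<open>Contour integration\<close>

text \<open>The chord from s to - i s takes the place of the quarter circle: it stays in the
  quadrant at distance between s/2 and s from 0, and along a segment the mean value bound for the
  primitive replaces an arc integral.\<close>

lemma polygon_bound:
  fixes g \<Psi> :: "complex \<Rightarrow> complex"
  assumes prim: "\<And>z. z \<in> HPl \<Longrightarrow> (\<Psi> has_field_derivative g z) (at z)"
    and s: "s > 0" and bd: "\<And>w. w \<in> quad \<Longrightarrow> s / 2 \<le> norm w \<Longrightarrow> norm w \<le> s \<Longrightarrow> norm (g w) \<le> B"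
  shows "norm (\<Psi> (- \<i> * of_real s) - \<Psi> (of_real s)) \<le> B * (2 * s)"
proof -
  let ?S = "closed_segment (of_real s) (- \<i> * of_real s) :: complex set"
  have S: "w \<in> quad \<and> s / 2 \<le> norm w \<and> norm w \<le> s" if "w \<in> ?S" for w
  proof -
    obtain u where u: "0 \<le> u" "u \<le> 1" "w = (1 - u) *\<^sub>R of_real s + u *\<^sub>R (- \<i> * of_real s)"
      using \<open>w \<in> ?S\<close> unfolding closed_segment_def by blast
    have re: "Re w = (1 - u) * s" and im: "Im w = - (u * s)" by (simp_all add: u(3))
    have 1: "Re w \<ge> 0" "Im w \<le> 0" using u s by (auto simp: re im)
    have 2: "Re w - Im w = s" by (simp add: re im algebra_simps)
    have 3: "norm w \<le> s" using cmod_le[of w] 1 2 by simp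
    have 4: "s / 2 \<le> norm w"
      using 1 2 abs_Re_le_cmod[of w] abs_Im_le_cmod[of w] by linarith
    then have "w \<noteq> 0" using s by auto
    then show ?thesis using 1 3 4 by (simp add: quad_def)
  qed
  have "norm (\<Psi> (- \<i> * of_real s) - \<Psi> (of_real s)) \<le> B * norm (- \<i> * of_real s - of_real s)"
  proof (rule field_differentiable_bound[of ?S \<Psi> g])
    fix z assume "z \<in> ?S"
    then have "z \<in> quad" using S by blast
    then have "z \<in> HPl" using quadrant_in_HPl by (simp add: quad_def)
    then show "(\<Psi> has_field_derivative g z) (at z within ?S)"
      by (rule has_field_derivative_at_within[OF prim])
  qed (use S bd in auto)
  also have "\<dots> \<le> B * (2 * s)"
  proof (rule mult_left_mono)
    show "norm (- \<i> * of_real s - of_real s) \<le> 2 * s"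
      using norm_triangle_ineq4[of "- \<i> * of_real s" "of_real s"] s by (simp add: norm_mult)
    have "of_real s \<in> quad" using s by (simp add: quad_def)
    then have "norm (g (of_real s)) \<le> B" using s by (intro bd) auto
    then show "B \<ge> 0" by (rule order_trans[OF norm_ge_zero])
  qed
  finally show ?thesis .
qed

text \<open>On the negative imaginary axis dw = - i dt, so the real part of g is, up to sign, the
  derivative of Im \<Psi>. On the positive real axis g is real and Im \<Psi> is constant; only the
  two chords remain.\<close>

lemma Re_axis_integral:
  fixes g \<Psi> :: "complex \<Rightarrow> complex"
  assumes prim: "\<And>z. z \<in> HPl \<Longrightarrow> (\<Psi> has_field_derivative g z) (at z)"
    and real: "\<And>x. x > 0 \<Longrightarrow> Im (g (of_real x)) = 0"
    and d: "0 < \<delta>" "\<delta> \<le> R"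
  shows "((\<lambda>t. Re (g (- \<i> * of_real t))) has_integral
     Im (\<Psi> (- \<i> * of_real \<delta>) - \<Psi> (of_real \<delta>)) - Im (\<Psi> (- \<i> * of_real R) - \<Psi> (of_real R))) {\<delta>..R}"
proof -
  let ?p = "\<lambda>t. \<Psi> (- \<i> * of_real t)"
  have "((\<lambda>t. - \<i> * g (- \<i> * of_real t)) has_integral ?p R - ?p \<delta>) {\<delta>..R}"
  proof (rule fundamental_theorem_of_calculus[OF d(2)])
    fix t assume t: "t \<in> {\<delta>..R}"
    have "((\<lambda>t. - \<i> * of_real t) has_vector_derivative - \<i>) (at t within {\<delta>..R})"
      by (auto intro!: derivative_eq_intros)
    moreover have "- \<i> * of_real t \<in> HPl" using t d by (intro quadrant_in_HPl) auto
    ultimately have "(\<Psi> \<circ> (\<lambda>t. - \<i> * of_real t) has_vector_derivative - \<i> * g (- \<i> * of_real t)) (at t within {\<delta>..R})"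
      by (intro field_vector_diff_chain_within has_field_derivative_at_within[OF prim])
    then show "((\<lambda>t. \<Psi> (- \<i> * of_real t)) has_vector_derivative - \<i> * g (- \<i> * of_real t)) (at t within {\<delta>..R})"
      by (simp only: o_def)
  qed
  from has_integral_Im[OF this]
  have 1: "((\<lambda>t. - Re (g (- \<i> * of_real t))) has_integral Im (?p R - ?p \<delta>)) {\<delta>..R}"
    by simp
  have "((\<lambda>x. g (of_real x)) has_integral \<Psi> (of_real R) - \<Psi> (of_real \<delta>)) {\<delta>..R}"
  proof (rule fundamental_theorem_of_calculus[OF d(2)])
    fix t assume t: "t \<in> {\<delta>..R}"
    have "(of_real has_vector_derivative (1::complex)) (at t within {\<delta>..R})"
      by (auto intro!: derivative_eq_intros)
    moreover have "of_real t \<in> HPl" using t d by (intro quadrant_in_HPl) auto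
    ultimately have "(\<Psi> \<circ> of_real has_vector_derivative 1 * g (of_real t)) (at t within {\<delta>..R})"
      by (intro field_vector_diff_chain_within has_field_derivative_at_within[OF prim])
    then show "((\<lambda>t. \<Psi> (of_real t)) has_vector_derivative g (of_real t)) (at t within {\<delta>..R})"
      by (simp only: o_def mult_1)
  qed
  from has_integral_Im[OF this]
  have "((\<lambda>x. Im (g (of_real x))) has_integral Im (\<Psi> (of_real R) - \<Psi> (of_real \<delta>))) {\<delta>..R}" .
  moreover have "((\<lambda>x. Im (g (of_real x))) has_integral 0) {\<delta>..R}"
    by (rule has_integral_is_0) (use real d in auto)
  ultimately have 2: "Im (\<Psi> (of_real R) - \<Psi> (of_real \<delta>)) = 0"
    by (rule has_integral_unique)
  have "((\<lambda>t. Re (g (- \<i> * of_real t))) has_integral - Im (?p R - ?p \<delta>)) {\<delta>..R}"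
    using has_integral_neg[OF 1] by simp
  moreover have "- Im (?p R - ?p \<delta>) = Im (?p \<delta> - \<Psi> (of_real \<delta>)) - Im (?p R - \<Psi> (of_real R))"
    using 2 by simp
  ultimately show ?thesis by simp
qed

text \<open>N counts the subtracted terms. As a truncated difference it is 0 for i \<le> r, so the
  convergent and the regularized case share one contour argument.\<close>

locale IKM_setup =
  fixes r k i M N :: nat
  assumes k: "k = 4 * r + 4" and M: "M = 2 * r + 2" and N: "N = i - r"
begin

text \<open>The part of the expansion of Q^M w^(2i) with nonnegative exponents 2i - M - 2n. When
  there are any terms, these exponents equal 2 (N - 1 - n).\<close>

definition ppoly :: "complex \<Rightarrow> complex" where
  "ppoly w = (\<Sum>n<N. of_real ((pi / 2) ^ M * (-4) ^ n * of_rat (IKM_gamma k n)) * w ^ (2 * (N - 1 - n)))"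

definition gfun :: "complex \<Rightarrow> complex" where
  "gfun w = Qfun w ^ M * w ^ (2 * i) - ppoly w"

lemma gfun_holomorphic: "gfun holomorphic_on HPl"
  unfolding gfun_def ppoly_def by (intro holomorphic_intros Qfun_holomorphic)

lemma gfun_real: "x > 0 \<Longrightarrow> Im (gfun (of_real x)) = 0"
proof -
  assume "x > 0"
  then have "Qfun (of_real x) = of_real (Re (Qfun (of_real x)))"
    using Qfun_real[of x] by (simp add: complex_eq_iff)
  then obtain q where q: "Qfun (of_real x) = of_real q" by blast
  have "gfun (of_real x) = of_real (q ^ M * x ^ (2 * i) - (\<Sum>n<N. ((pi / 2) ^ M * (-4) ^ n * of_rat (IKM_gamma k n)) * x ^ (2 * (N - 1 - n))))"
    unfolding gfun_def ppoly_def q by simp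
  then show ?thesis by (simp only: Im_complex_of_real)
qed

text \<open>After N terms the remainder is of order |w|^(2i - M - 2N), and this exponent is at most
  -2.\<close>

lemma gfun_far:
  "\<exists>C\<ge>0. \<forall>w\<in>quad. norm w \<ge> 1 \<longrightarrow> norm (gfun w) \<le> C / (norm w)\<^sup>2"
proof -
  obtain C where C: "C \<ge> 0" "\<And>w. w \<in> quad \<Longrightarrow> norm (w * Qfun w - (\<Sum>n<N. fps_nth Qseries n * (inverse (w\<^sup>2)) ^ n)) \<le> C * norm (inverse (w\<^sup>2)) ^ N"
    using Qfun_quad_expansion[of N] by blast
  obtain C' where C': "C' \<ge> 0" "\<And>X Y. norm X \<le> 1 \<Longrightarrow> norm (Y - (\<Sum>n<N. fps_nth Qseries n * X ^ n)) \<le> C * norm X ^ N \<Longrightarrow>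
    norm (Y ^ M - (\<Sum>n<N. fps_nth (Qseries ^ M) n * X ^ n)) \<le> C' * norm X ^ N"
    using trunc_power[OF C(1), of Qseries N M] by blast
  have "norm (gfun w) \<le> C' / (norm w)\<^sup>2" if w: "w \<in> quad" "norm w \<ge> 1" for w
  proof -
    have w0: "w \<noteq> 0" using w by auto
    define X where "X = inverse (w\<^sup>2)"
  let ?T = "\<Sum>n<N. fps_nth (Qseries ^ M) n * X ^ n"
    have nX: "norm X = inverse ((norm w)\<^sup>2)" by (simp add: X_def norm_inverse norm_power)
    have "norm X \<le> 1" unfolding nX using w(2) by (simp add: inverse_le_1_iff)
    from C'(2)[OF this] C(2)[OF w(1)]
    have b: "norm ((w * Qfun w) ^ M - ?T) \<le> C' * norm X ^ N"
      by (simp add: X_def)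
    have "ppoly w = w ^ (2 * i) / w ^ M * ?T"
    proof -
      have "of_real ((pi / 2) ^ M * (-4) ^ n * of_rat (IKM_gamma k n)) * w ^ (2 * (N - 1 - n)) = w ^ (2 * i) / w ^ M * (fps_nth (Qseries ^ M) n * X ^ n)"
        if n: "n < N" for n
      proof -
        have "2 * (N - 1 - n) + M + 2 * n = 2 * i" using n N M by simp
        then have "w ^ (2 * i) = w ^ (2 * (N - 1 - n)) * w ^ M * w ^ (2 * n)"
          by (simp only: power_add[symmetric])
        moreover have "X ^ n = inverse (w ^ (2 * n))" by (simp add: X_def power_inverse power_mult)
        ultimately have "w ^ (2 * i) / w ^ M * X ^ n = w ^ (2 * (N - 1 - n))" using w0 by simp
        moreover have "fps_nth (Qseries ^ M) n = of_real ((pi / 2) ^ M * (-4) ^ n * of_rat (IKM_gamma k n))"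
          by (rule Qseries_power) (simp add: k M)
        ultimately show ?thesis by (metis mult.left_commute)
      qed
      then show ?thesis unfolding ppoly_def sum_distrib_left by (intro sum.cong) auto
    qed
    moreover have "Qfun w ^ M * w ^ (2 * i) = w ^ (2 * i) / w ^ M * (w * Qfun w) ^ M"
      using w0 by (simp add: power_mult_distrib)
    ultimately have "gfun w = w ^ (2 * i) / w ^ M * ((w * Qfun w) ^ M - ?T)"
      unfolding gfun_def by (simp only: right_diff_distrib)
    then have "norm (gfun w) = norm w ^ (2 * i) / norm w ^ M * norm ((w * Qfun w) ^ M - ?T)"
      by (simp only: norm_mult norm_divide norm_power)
    also have "\<dots> \<le> norm w ^ (2 * i) / norm w ^ M * (C' * norm X ^ N)"
      by (rule mult_left_mono[OF b]) simp
    also have "\<dots> = C' * (norm w ^ (2 * i) / (norm w ^ M * norm w ^ (2 * N)))"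
    proof -
      have "norm X ^ N = inverse (norm w ^ (2 * N))" by (simp add: nX power_inverse flip: power_mult)
      then show ?thesis by (simp add: divide_inverse mult_ac)
    qed
    also have "\<dots> \<le> C' * (1 / (norm w)\<^sup>2)"
    proof (rule mult_left_mono[OF _ C'(1)])
      \<comment> \<open>Equality for i \<ge> r. For i < r the truncated difference N is 0 and 2i + 2
        already lies below M.\<close>
      have "2 * i + 2 \<le> M + 2 * N" using N M by simp
      then have "norm w ^ (2 * i + 2) \<le> norm w ^ (M + 2 * N)" using w(2) by (rule power_increasing)
      then show "norm w ^ (2 * i) / (norm w ^ M * norm w ^ (2 * N)) \<le> 1 / (norm w)\<^sup>2"
        using w0 by (simp add: power_add field_simps power2_eq_square)
    qed
    finally show ?thesis by simp
  qed
  then show ?thesis using C'(1) by blast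
qed

lemma Qfun_power_bound:
  "\<exists>C\<ge>0. \<forall>w\<in>quad. norm (Qfun w) ^ M \<le> C * norm w powr (- (1 / 2))"
proof -
  \<comment> \<open>Chosen so that the M-th power of |w|^(-\<eta>) is |w|^(-1/2), which is
    integrable at 0.\<close>
  define \<eta> where "\<eta> = 1 / (2 * real M)"
  have M0: "M > 0" using M by simp
  have eta: "0 < \<eta>" "\<eta> \<le> 1" using M0 by (auto simp: \<eta>_def field_simps)
  obtain C where C: "C \<ge> 0" "\<And>w. w \<in> HPl \<Longrightarrow> norm (Qfun w) \<le> C * Re (om * w) powr (- \<eta>)"
    using norm_Qfun_le[OF eta] by blast
  have "norm (Qfun w) ^ M \<le> C ^ M * 2 powr (1 / 2) * norm w powr (- (1 / 2))" if "w \<in> quad" for w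
  proof -
    have w: "Re w \<ge> 0" "Im w \<le> 0" "w \<noteq> 0" using that by (auto simp: quad_def)
    have "norm (Qfun w) \<le> C * Re (om * w) powr (- \<eta>)"
      by (rule C(2)[OF quadrant_in_HPl[OF w]])
    also have "\<dots> \<le> C * (norm w / 2) powr (- \<eta>)"
      using eta w quadrant_Re_ge[OF w(1,2)] by (intro mult_left_mono[OF _ C(1)] powr_mono2') auto
    finally have "norm (Qfun w) ^ M \<le> (C * (norm w / 2) powr (- \<eta>)) ^ M"
      by (rule power_mono) simp
    also have "\<dots> = C ^ M * (norm w / 2) powr (- \<eta> * real M)"
      using w(3) by (simp add: power_mult_distrib powr_power mult.commute)
    also have "- \<eta> * real M = - (1 / 2)" using M0 by (simp add: \<eta>_def)
    also have "(norm w / 2) powr (- (1 / 2)) = 2 powr (1 / 2) * norm w powr (- (1 / 2))"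
      by (simp add: powr_divide powr_minus_divide)
    finally show ?thesis by simp
  qed
  then show ?thesis using C(1) by (intro exI[of _ "C ^ M * 2 powr (1 / 2)"]) auto
qed

lemma gfun_near:
  "\<exists>C\<ge>0. \<forall>w\<in>quad. norm w \<le> 1 \<longrightarrow> norm (gfun w) \<le> C * norm w powr (- (1 / 2))"
proof -
  obtain C where C: "C \<ge> 0" "\<And>w. w \<in> quad \<Longrightarrow> norm (Qfun w) ^ M \<le> C * norm w powr (- (1 / 2))"
    using Qfun_power_bound by blast
  define D where "D = (\<Sum>n<N. \<bar>(pi / 2) ^ M * (-4) ^ n * of_rat (IKM_gamma k n)\<bar>)"
  have D: "D \<ge> 0" unfolding D_def by (rule sum_nonneg) simp
  have "norm (gfun w) \<le> (C + D) * norm w powr (- (1 / 2))" if w: "w \<in> quad" "norm w \<le> 1" for w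
  proof -
    have w0: "w \<noteq> 0" using w by (simp add: quad_def)
    have w1: "norm w ^ n \<le> 1" for n using w(2) by (intro power_le_one) auto
    have p1: "1 \<le> norm w powr (- (1 / 2))"
      using powr_mono2'[of "- (1/2)" "norm w" 1] w(2) w0 by simp
    have "norm (gfun w) \<le> norm (Qfun w ^ M * w ^ (2 * i)) + norm (ppoly w)"
      unfolding gfun_def by (rule norm_triangle_ineq4)
    also have "norm (Qfun w ^ M * w ^ (2 * i)) \<le> norm (Qfun w) ^ M * 1"
      unfolding norm_mult norm_power by (rule mult_left_mono[OF w1]) simp
    also have "norm (Qfun w) ^ M * 1 \<le> C * norm w powr (- (1 / 2))" using C(2)[OF w(1)] by simp
    also have "norm (ppoly w) \<le> D"
      unfolding ppoly_def D_def
    proof (rule sum_norm_le)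
      fix n
      show "norm (of_real ((pi / 2) ^ M * (-4) ^ n * of_rat (IKM_gamma k n)) * w ^ (2 * (N - 1 - n))) \<le> \<bar>(pi / 2) ^ M * (-4) ^ n * of_rat (IKM_gamma k n)\<bar>"
        unfolding norm_mult norm_power norm_of_real by (rule mult_left_le[OF w1]) simp
    qed
    also have "D \<le> D * norm w powr (- (1 / 2))" using mult_left_mono[OF p1 D] by simp
    finally show ?thesis by (simp add: distrib_right)
  qed
  then show ?thesis using C(1) D by (intro exI[of _ "C + D"]) auto
qed

text \<open>Each chord has length at most twice its radius. Near 0 the bound |w|^(-1/2) leaves a
  multiple of sqrt \<delta>, and far out |w|^(-2) leaves a multiple of 1/R.\<close>

lemma gfun_axis_bound:
  "\<exists>C\<ge>0. \<forall>\<delta> R. 0 < \<delta> \<longrightarrow> \<delta> \<le> 1 \<longrightarrow> 2 \<le> R \<longrightarrow>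
     \<bar>integral {\<delta>..R} (\<lambda>t. Re (gfun (- \<i> * of_real t)))\<bar> \<le> C * sqrt \<delta> + C / R"
proof -
  let ?g = "\<lambda>t. Re (gfun (- \<i> * of_real t))"
  obtain A where A: "A \<ge> 0" "\<And>w. w \<in> quad \<Longrightarrow> norm w \<ge> 1 \<Longrightarrow> norm (gfun w) \<le> A / (norm w)\<^sup>2"
    using gfun_far by blast
  obtain B where B: "B \<ge> 0" "\<And>w. w \<in> quad \<Longrightarrow> norm w \<le> 1 \<Longrightarrow> norm (gfun w) \<le> B * norm w powr (- (1 / 2))"
    using gfun_near by blast
  obtain \<Psi> where P: "\<And>z. z \<in> HPl \<Longrightarrow> (\<Psi> has_field_derivative gfun z) (at z within HPl)"
    using holomorphic_convex_primitive'[OF convex_HPl open_HPl gfun_holomorphic] by blast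
  have P': "(\<Psi> has_field_derivative gfun z) (at z)" if "z \<in> HPl" for z
    using P[OF that] at_within_open[OF that open_HPl] by simp
  let ?P = "\<lambda>s. \<Psi> (- \<i> * of_real s) - \<Psi> (of_real s)"
  have "\<bar>integral {\<delta>..R} ?g\<bar> \<le> (4 * B) * sqrt \<delta> + (8 * A) / R"
    if d: "0 < \<delta>" "\<delta> \<le> 1" "2 \<le> R" for \<delta> R
  proof -
    have "norm (?P \<delta>) \<le> (B * (\<delta> / 2) powr (- (1 / 2))) * (2 * \<delta>)"
    proof (rule polygon_bound[OF P' d(1)])
      fix w assume w: "w \<in> quad" "\<delta> / 2 \<le> norm w" "norm w \<le> \<delta>"
      have "norm (gfun w) \<le> B * norm w powr (- (1 / 2))" using w d by (intro B(2)) auto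
      also have "\<dots> \<le> B * (\<delta> / 2) powr (- (1 / 2))" using w d by (intro mult_left_mono[OF _ B(1)] powr_mono2') auto
      finally show "norm (gfun w) \<le> B * (\<delta> / 2) powr (- (1 / 2))" .
    qed
    also have "\<dots> \<le> (4 * B) * sqrt \<delta>"
    proof -
      have "(\<delta> / 2) powr (- (1 / 2)) * \<delta> = sqrt 2 * sqrt \<delta>"
      proof -
        have "(\<delta> / 2) powr (- (1 / 2)) = sqrt 2 / sqrt \<delta>"
          using d by (simp add: powr_minus_divide powr_divide powr_half_sqrt)
        then have "(\<delta> / 2) powr (- (1 / 2)) * \<delta> = sqrt 2 * (\<delta> / sqrt \<delta>)" by simp
        then show ?thesis using d by (simp add: real_div_sqrt)
      qed
      moreover have "sqrt 2 \<le> 2" by (simp add: real_le_lsqrt)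
      then have "sqrt 2 * sqrt \<delta> \<le> 2 * sqrt \<delta>" using d by (intro mult_right_mono) auto
      ultimately have "B * ((\<delta> / 2) powr (- (1 / 2)) * \<delta>) \<le> B * (2 * sqrt \<delta>)"
        using B(1) by (intro mult_left_mono) auto
      then show ?thesis by (simp add: mult_ac)
    qed
    finally have 1: "norm (?P \<delta>) \<le> (4 * B) * sqrt \<delta>" .
    have R: "R > 0" using d by simp
    have "norm (?P R) \<le> (A / (R / 2)\<^sup>2) * (2 * R)"
    proof (rule polygon_bound[OF P' R])
      fix w assume w: "w \<in> quad" "R / 2 \<le> norm w" "norm w \<le> R"
      have "norm (gfun w) \<le> A / (norm w)\<^sup>2" using w d by (intro A(2)) auto
      also have "\<dots> \<le> A / (R / 2)\<^sup>2" using w R by (intro divide_left_mono[OF _ A(1)] power_mono mult_pos_pos zero_less_power) auto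
      finally show "norm (gfun w) \<le> A / (R / 2)\<^sup>2" .
    qed
    also have "\<dots> = (8 * A) / R" using R by (simp add: power2_eq_square)
    finally have 2: "norm (?P R) \<le> (8 * A) / R" .
    have "(?g has_integral
     Im (?P \<delta>) - Im (?P R)) {\<delta>..R}"
      by (rule Re_axis_integral[OF P' gfun_real]) (use d in auto)
    then have "integral {\<delta>..R} ?g = Im (?P \<delta>) - Im (?P R)"
      by (rule integral_unique)
    then show ?thesis
      using 1 2 abs_Im_le_cmod[of "?P \<delta>"] abs_Im_le_cmod[of "?P R"]
      by linarith
  qed
  moreover have "(4 * B) * sqrt \<delta> + (8 * A) / R \<le> (4 * B + 8 * A) * sqrt \<delta> + (4 * B + 8 * A) / R" if "0 < \<delta>" "2 \<le> R" for \<delta> R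
    using that A(1) B(1) by (intro add_mono mult_right_mono divide_right_mono) auto
  ultimately show ?thesis
    using A(1) B(1) by (intro exI[of _ "4 * B + 8 * A"] conjI allI impI) (simp, meson order_trans)
qed

end

section \<open>Moment functions and their integrability\<close>

lemma bessel_K0_decay:
  assumes "t \<ge> 1" shows "bessel_K0 t \<le> exp 1 * bessel_K0 1 * exp (- t)"
proof -
  have "bessel_K0 t \<le> (\<integral>u. exp (1 - t) * exp (- 1 * cosh u) \<partial>HL)"
    unfolding bessel_K0_eq[of t, OF less_le_trans[OF zero_less_one assms]]
  proof (rule integral_mono)
    show "integrable HL (\<lambda>u. exp (- t * cosh u))" using assms by (intro integrable_K0) simp
    show "integrable HL (\<lambda>u. exp (1 - t) * exp (- 1 * cosh u))" by (intro integrable_mult_right integrable_K0) simp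
    fix u :: real
    have "(t - 1) * 1 \<le> (t - 1) * cosh u" using assms cosh_real_ge_1[of u] by (intro mult_left_mono) auto
    then show "exp (- t * cosh u) \<le> exp (1 - t) * exp (- 1 * cosh u)"
      by (simp add: algebra_simps flip: exp_add)
  qed
  also have "\<dots> = exp (1 - t) * bessel_K0 1" by (simp add: bessel_K0_eq)
  also have "\<dots> = exp 1 * bessel_K0 1 * exp (- t)" by (simp add: exp_diff exp_minus divide_inverse)
  finally show ?thesis .
qed

context IKM_setup
begin

text \<open>The guard \<open>t > 0\<close> removes the junk value of \<open>bessel_K0\<close> at 0.\<close>
definition moment_fun :: "nat \<Rightarrow> real \<Rightarrow> real" where
  "moment_fun j t = (if t > 0 then bessel_I0 t ^ (2 * j) * bessel_K0 t ^ (k - 2 * j) * t ^ (2 * i) else 0)"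

lemma moment_fun_nonneg: "moment_fun j t \<ge> 0"
  using bessel_K0_nonneg[of t] bessel_I0_nonneg[of t] by (simp add: moment_fun_def)

lemma Re_Qfun_imag: "t > 0 \<Longrightarrow> Re (Qfun (- \<i> * of_real t)) = (bessel_K0 t)\<^sup>2"
  and Im_Qfun_imag: "t > 0 \<Longrightarrow> Im (Qfun (- \<i> * of_real t)) = pi * bessel_I0 t * bessel_K0 t"
  by (simp_all only: Qfun_imag) simp_all

lemma moment_fun_eq:
  assumes "t > 0" "j \<le> r + 1"
  shows "moment_fun j t = (bessel_I0 t * bessel_K0 t) ^ (2 * j) * ((bessel_K0 t)\<^sup>2) ^ (M - 2 * j) * t ^ (2 * i)"
proof -
  have "k - 2 * j = 2 * j + 2 * (M - 2 * j)" using assms(2) k M by simp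
  then have "bessel_K0 t ^ (k - 2 * j) = bessel_K0 t ^ (2 * j) * ((bessel_K0 t)\<^sup>2) ^ (M - 2 * j)"
    by (simp only: power_add power_mult)
  then show ?thesis using assms(1) by (simp add: moment_fun_def power_mult_distrib mult_ac)
qed

lemma continuous_on_Qfun_imag: "continuous_on {0<..} (\<lambda>t. Qfun (- \<i> * of_real t))"
  by (rule continuous_on_compose2[OF holomorphic_on_imp_continuous_on[OF Qfun_holomorphic]])
     (auto intro!: continuous_intros quadrant_in_HPl)

text \<open>Read off from the continuity of Q on the negative imaginary axis: the square of K_0 is
  the real part, and I_0 K_0 the imaginary part divided by pi.\<close>

lemma moment_fun_measurable:
  assumes "j \<le> r + 1" shows "moment_fun j \<in> borel_measurable borel"
proof -
  let ?f = "\<lambda>t. (Im (Qfun (- \<i> * of_real t)) / pi) ^ (2 * j) * Re (Qfun (- \<i> * of_real t)) ^ (M - 2 * j) * t ^ (2 * i)"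
  have "continuous_on {0<..} ?f"
    by (intro continuous_intros continuous_on_Qfun_imag) auto
  then have "(\<lambda>t. indicator {0<..} t *\<^sub>R ?f t) \<in> borel_measurable borel"
    by (rule borel_measurable_continuous_on_indicator[rotated]) simp
  moreover have "moment_fun j = (\<lambda>t. indicator {0<..} t *\<^sub>R ?f t)"
  proof (rule ext)
    fix t
    show "moment_fun j t = indicator {0<..} t *\<^sub>R ?f t"
    proof (cases "t > 0")
      case True
      show ?thesis
        unfolding moment_fun_eq[OF True assms] Re_Qfun_imag[OF True] Im_Qfun_imag[OF True] using True by simp
    qed (simp add: moment_fun_def)
  qed
  ultimately show ?thesis by simp
qed

text \<open>Both I_0 K_0 and the square of K_0 are at most |Q|, so the bound on Q^M also controls
  the singularity of K_0 at 0.\<close>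

lemma moment_fun_bound:
  "\<exists>C\<ge>0. \<forall>t>0. \<forall>j\<le>r + 1. moment_fun j t \<le> C * t powr (- (1 / 2)) * t ^ (2 * i)"
proof -
  obtain C where C: "C \<ge> 0" "\<And>w. w \<in> quad \<Longrightarrow> norm (Qfun w) ^ M \<le> C * norm w powr (- (1 / 2))"
    using Qfun_power_bound by blast
  have "moment_fun j t \<le> C * t powr (- (1 / 2)) * t ^ (2 * i)" if t: "t > 0" and j: "j \<le> r + 1" for t j
  proof -
    define w where "w = - \<i> * complex_of_real t"
    have w: "w \<in> quad" "norm w = t" using t by (auto simp: w_def quad_def norm_mult)
    have nn: "bessel_I0 t * bessel_K0 t \<ge> 0" using bessel_K0_nonneg[OF t] bessel_I0_nonneg by simp
    have "(bessel_I0 t * bessel_K0 t) * 1 \<le> (bessel_I0 t * bessel_K0 t) * pi"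
      using pi_ge_two by (intro mult_left_mono nn) auto
    also have "\<dots> = Im (Qfun w)" unfolding w_def Im_Qfun_imag[OF t] by simp
    also have "\<dots> \<le> norm (Qfun w)" using abs_Im_le_cmod[of "Qfun w"] by linarith
    finally have 1: "bessel_I0 t * bessel_K0 t \<le> norm (Qfun w)" by simp
    have 2: "(bessel_K0 t)\<^sup>2 \<le> norm (Qfun w)"
      using complex_Re_le_cmod[of "Qfun w"] unfolding w_def Re_Qfun_imag[OF t] .
    have "(bessel_I0 t * bessel_K0 t) ^ (2 * j) * ((bessel_K0 t)\<^sup>2) ^ (M - 2 * j) \<le> norm (Qfun w) ^ (2 * j) * norm (Qfun w) ^ (M - 2 * j)"
      using 1 2 nn by (intro mult_mono power_mono) auto
    also have "\<dots> = norm (Qfun w) ^ M" using j M by (simp flip: power_add)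
    also have "\<dots> \<le> C * t powr (- (1 / 2))" using C(2)[OF w(1)] w(2) by simp
    finally show ?thesis unfolding moment_fun_eq[OF t j] using t by (intro mult_right_mono) auto
  qed
  then show ?thesis using C(1) by blast
qed

text \<open>Up to t = 1 the power bound from Q suffices. Beyond it, the growth exp t of I_0 is
  beaten by the decay exp (- t) of K_0 because K_0 occurs more often than I_0 when j \<le>
  r.\<close>

lemma moment_fun_integrable:
  assumes j: "j \<le> r" shows "integrable HL (moment_fun j)"
proof -
  obtain C where C: "C \<ge> 0" "\<And>t. t > 0 \<Longrightarrow> moment_fun j t \<le> C * t powr (- (1 / 2)) * t ^ (2 * i)"
    using moment_fun_bound j by (metis le_SucI Suc_eq_plus1)
  define E where "E = exp 1 * bessel_K0 1"
  have E: "E \<ge> 0" using bessel_K0_nonneg[of 1] by (simp add: E_def)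
  let ?p = "\<lambda>t::real. t powr (1 / 2 - 1) * exp (- 1 * t)"
  let ?x = "\<lambda>t::real. t ^ (2 * i) * exp (- 1 * t)"
  let ?D = "\<lambda>t. C * exp 1 * ?p t + E ^ (k - 2 * j) * ?x t"
  have "integrable HL ?D"
    by (intro Bochner_Integration.integrable_add integrable_mult_right Gamma_HL(1) power_exp_HL(1)) auto
  then show ?thesis
  proof (rule Bochner_Integration.integrable_bound)
    show "moment_fun j \<in> borel_measurable HL"
      by (rule borel_measurable_HL[OF moment_fun_measurable]) (use j in simp)
    show "AE t in HL. norm (moment_fun j t) \<le> norm (?D t)"
      using AE_HL_pos
    proof eventually_elim
      case (elim t)
      have nn: "0 \<le> C * exp 1 * ?p t" "0 \<le> E ^ (k - 2 * j) * ?x t"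
        using C(1) E elim by auto
      have "moment_fun j t \<le> ?D t"
      proof (cases "t \<le> 1")
        case True
        have "moment_fun j t \<le> C * t powr (- (1 / 2)) * t ^ (2 * i)" by (rule C(2)[OF elim])
        also have "\<dots> \<le> C * t powr (- (1 / 2)) * 1"
          using True elim C(1) by (intro mult_left_mono power_le_one) auto
        also have "\<dots> \<le> C * t powr (- (1 / 2)) * (exp 1 * exp (- 1 * t))"
          using True C(1) by (intro mult_left_mono) (auto simp flip: exp_add)
        also have "\<dots> = C * exp 1 * ?p t" by simp
        finally show ?thesis using nn(2) by linarith
      next
        case False
        have "moment_fun j t = bessel_I0 t ^ (2 * j) * bessel_K0 t ^ (k - 2 * j) * t ^ (2 * i)"
          using elim by (simp add: moment_fun_def)
        also have "\<dots> \<le> exp t ^ (2 * j) * (E * exp (- t)) ^ (k - 2 * j) * t ^ (2 * i)"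
        proof (intro mult_right_mono mult_mono power_mono)
          show "bessel_I0 t \<le> exp t" using bessel_I0_le_exp[of t] elim by simp
          show "bessel_K0 t \<le> E * exp (- t)" using bessel_K0_decay[of t] False by (simp add: E_def)
        qed (use elim bessel_K0_nonneg[of t] bessel_I0_nonneg[of t] E in auto)
        also have "\<dots> = E ^ (k - 2 * j) * (t ^ (2 * i) * (exp t ^ (2 * j) * exp (- t) ^ (k - 2 * j)))"
          by (simp add: power_mult_distrib mult_ac)
        also have "\<dots> \<le> E ^ (k - 2 * j) * ?x t"
        proof (intro mult_left_mono)
          \<comment> \<open>The surplus k - 4j is at least 4 here. It is 0 for j = r + 1, the
            central moment, for which this majorant fails.\<close>
          have "k - 2 * j = 2 * j + (k - 4 * j)" using j k by simp
          then have "exp t ^ (2 * j) * exp (- t) ^ (k - 2 * j) = (exp t * exp (- t)) ^ (2 * j) * exp (- t) ^ (k - 4 * j)"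
            by (simp only: power_add power_mult_distrib mult.assoc)
          also have "\<dots> = exp (- t) ^ (k - 4 * j)" by (simp flip: exp_add)
          also have "\<dots> \<le> exp (- t) ^ 1" using j k elim by (intro power_decreasing) auto
          finally show "exp t ^ (2 * j) * exp (- t) ^ (k - 2 * j) \<le> exp (- 1 * t)" by simp
        qed (use elim E in auto)
        finally show ?thesis using nn(1) by linarith
      qed
      then show ?case using moment_fun_nonneg[of j t] by simp
    qed
  qed
qed

lemma moment_fun_integrable_le:
  assumes j: "j \<le> r + 1" shows "integrable HL (\<lambda>t. indicator {..R} t * moment_fun j t)"
proof -
  obtain C where C: "C \<ge> 0" "\<And>t. t > 0 \<Longrightarrow> moment_fun j t \<le> C * t powr (- (1 / 2)) * t ^ (2 * i)"
    using moment_fun_bound j by blast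
  \<comment> \<open>For t \<le> R the factor exp R * exp (- t) is at least 1, so a Gamma integrand
    on the whole half-line can majorise the truncated function.\<close>
  let ?D = "\<lambda>t. C * \<bar>R\<bar> ^ (2 * i) * exp R * (t powr (1 / 2 - 1) * exp (- 1 * t))"
  have "integrable HL ?D"
    by (intro integrable_mult_right Gamma_HL(1)) auto
  then show ?thesis
  proof (rule Bochner_Integration.integrable_bound)
    show "(\<lambda>t. indicator {..R} t * moment_fun j t) \<in> borel_measurable HL"
      by (intro borel_measurable_HL borel_measurable_times moment_fun_measurable j) simp
    show "AE t in HL. norm (indicator {..R} t * moment_fun j t) \<le> norm (?D t)"
      using AE_HL_pos
    proof eventually_elim
      case (elim t)
      show ?case
      proof (cases "t \<le> R")
        case True
        have "moment_fun j t \<le> C * t powr (- (1 / 2)) * t ^ (2 * i)" by (rule C(2)[OF elim])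
        also have "\<dots> \<le> C * t powr (- (1 / 2)) * (\<bar>R\<bar> ^ (2 * i) * (exp R * exp (- 1 * t)))"
        proof (intro mult_left_mono)
          have "t ^ (2 * i) * 1 \<le> \<bar>R\<bar> ^ (2 * i) * (exp R * exp (- 1 * t))"
            using True elim by (intro mult_mono power_mono) (auto simp flip: exp_add)
          then show "t ^ (2 * i) \<le> \<bar>R\<bar> ^ (2 * i) * (exp R * exp (- 1 * t))" by simp
        qed (use C(1) in auto)
        also have "\<dots> = ?D t" by (simp add: mult_ac)
        finally have "moment_fun j t \<le> ?D t" .
        then show ?thesis using moment_fun_nonneg[of j t] True by simp
      qed simp
    qed
  qed
qed

lemma moment_fun_integrable_on:
  assumes j: "j \<le> r + 1" shows "moment_fun j integrable_on {0..R}"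
proof -
  have "(\<lambda>t. indicator {..R} t * moment_fun j t) integrable_on {0..}"
    using integral_HL(1)[OF moment_fun_integrable_le[OF j]] by blast
  then have "(\<lambda>t. indicator {..R} t * moment_fun j t) integrable_on {0..R}"
    by (rule integrable_on_subinterval) auto
  then show ?thesis by (rule integrable_eq) auto
qed

text \<open>The nonnegative powers in the expansion of (I_0 K_0)^M t^(2i) at infinity. It is
  \<open>ppoly\<close> on the negative imaginary axis, stripped of sign and of the factor
  pi^M.\<close>

definition tail_poly :: "real \<Rightarrow> real" where
  "tail_poly t = (\<Sum>n<N. 4 ^ n * of_rat (IKM_gamma k n) / 2 ^ M * t ^ (2 * (N - 1 - n)))"

definition moment_sum :: "real \<Rightarrow> real" where
  "moment_sum t = (\<Sum>j\<le>r. of_nat (M choose (2 * j)) * (-1) ^ j * pi ^ (2 * j) * moment_fun j t)"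

text \<open>The even binomial terms of the real part of Q^M are the moments with j \<le> r,
  collected in \<open>moment_sum\<close>, and the top term j = r + 1, the central one. The factor
  (-1)^i removes the sign of w^(2i) at w = - i t.\<close>

lemma gfun_axis:
  assumes t: "t > 0"
  shows "(-1) ^ i * Re (gfun (- \<i> * of_real t)) = moment_sum t + (-1) ^ (r + 1) * pi ^ M * (moment_fun (r + 1) t - tail_poly t)"
proof -
  let ?g = "\<lambda>n. of_rat (IKM_gamma k n) :: real"
  let ?w = "- \<i> * complex_of_real t"
  let ?q = "Qfun (?w) ^ M * (?w) ^ (2 * i)"
  have pw: "(?w) ^ (2 * l) = of_real ((-1) ^ l * t ^ (2 * l))" for l
    using imag_even_power[of "- t" l] by simp
  have ii: "(-1::real) ^ i * (-1) ^ i = 1" by (simp flip: power_add)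
  have M2: "M = 2 * (r + 1)" using M by simp
  have Q: "(-1) ^ i * Re ?q = moment_sum t + (-1) ^ (r + 1) * pi ^ M * moment_fun (r + 1) t"
  proof -
    have "Re ?q = Re (Qfun (?w) ^ M) * ((-1) ^ i * t ^ (2 * i))"
      unfolding pw by simp
    then have "(-1) ^ i * Re ?q = Re (Qfun (?w) ^ M) * t ^ (2 * i)"
      using ii by simp
    also have "Re (Qfun (?w) ^ M) = (\<Sum>j\<le>r + 1. of_nat (M choose (2 * j)) * (-1) ^ j * (pi * bessel_I0 t * bessel_K0 t) ^ (2 * j) * ((bessel_K0 t)\<^sup>2) ^ (M - 2 * j))"
      unfolding Qfun_imag[OF t] M2 by (rule Re_even_power)
    also have "\<dots> * t ^ (2 * i) = (\<Sum>j\<le>r + 1. of_nat (M choose (2 * j)) * (-1) ^ j * pi ^ (2 * j) * moment_fun j t)"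
      unfolding sum_distrib_right
    proof (rule sum.cong[OF refl])
      fix j assume "j \<in> {..r + 1}"
      then have j: "j \<le> r + 1" by simp
      show "of_nat (M choose (2 * j)) * (-1) ^ j * (pi * bessel_I0 t * bessel_K0 t) ^ (2 * j) * ((bessel_K0 t)\<^sup>2) ^ (M - 2 * j) * t ^ (2 * i)
        = of_nat (M choose (2 * j)) * (-1) ^ j * pi ^ (2 * j) * moment_fun j t"
        unfolding moment_fun_eq[OF t j] by (simp add: power_mult_distrib mult_ac)
    qed
    also have "\<dots> = moment_sum t + (-1) ^ (r + 1) * pi ^ M * moment_fun (r + 1) t"
    proof -
      have c: "M choose (2 * Suc r) = 1" "pi ^ (2 * Suc r) = pi ^ M" using M2 by simp_all
      show ?thesis
        unfolding Suc_eq_plus1[symmetric] sum.atMost_Suc moment_sum_def c by (simp only: of_nat_1 mult_1)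
    qed
    finally show ?thesis .
  qed
  have P: "(-1) ^ i * Re (ppoly (?w)) = (-1) ^ (r + 1) * pi ^ M * tail_poly t"
  proof -
    have "ppoly (?w) = of_real (\<Sum>n<N. (pi / 2) ^ M * (-4) ^ n * ?g n * ((-1) ^ (N - 1 - n) * t ^ (2 * (N - 1 - n))))"
      unfolding ppoly_def pw by (simp only: of_real_sum of_real_mult)
    then have "(-1) ^ i * Re (ppoly (?w)) = (\<Sum>n<N. (-1) ^ i * ((pi / 2) ^ M * (-4) ^ n * ?g n * ((-1) ^ (N - 1 - n) * t ^ (2 * (N - 1 - n)))))"
      by (simp only: Re_complex_of_real sum_distrib_left)
    also have "\<dots> = (-1) ^ (r + 1) * pi ^ M * tail_poly t"
      unfolding tail_poly_def sum_distrib_left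
    proof (rule sum.cong[OF refl])
      fix n assume "n \<in> {..<N}"
      then have n: "n < N" by simp
      have m4: "(-4::real) ^ n = (-1) ^ n * 4 ^ n" unfolding power_mult_distrib[symmetric] by simp
      have sgn: "(-1::real) ^ i * (-1) ^ n * (-1) ^ (N - 1 - n) = (-1) ^ (r + 1)"
      proof -
        \<comment> \<open>All terms of the polynomial acquire the common sign (-1)^(r + 1), the sign
          of the central moment; hence it can be subtracted from that moment alone.\<close>
        have "i + n + (N - 1 - n) = r + 1 + 2 * (N - 1)" using n N by simp
        then show ?thesis by (simp only: power_add[symmetric]) (simp add: power_add)
      qed
      have "(-1) ^ i * (-4) ^ n * (-1) ^ (N - 1 - n) = ((-1) ^ i * (-1) ^ n * (-1) ^ (N - 1 - n)) * (4::real) ^ n"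
        unfolding m4 by (simp only: mult_ac)
      then have "(-1) ^ i * (-4) ^ n * (-1) ^ (N - 1 - n) = (-1) ^ (r + 1) * (4::real) ^ n"
        unfolding sgn .
      then have "((-1) ^ i * (-4) ^ n * (-1) ^ (N - 1 - n)) * ((pi / 2) ^ M * ?g n * t ^ (2 * (N - 1 - n)))
        = ((-1) ^ (r + 1) * 4 ^ n) * ((pi / 2) ^ M * ?g n * t ^ (2 * (N - 1 - n)))"
        by (simp only:)
      then show "(-1) ^ i * ((pi / 2) ^ M * (-4) ^ n * ?g n * ((-1) ^ (N - 1 - n) * t ^ (2 * (N - 1 - n))))
        = (-1) ^ (r + 1) * pi ^ M * (4 ^ n * ?g n / 2 ^ M * t ^ (2 * (N - 1 - n)))"
        by (simp add: power_divide mult_ac)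
    qed
    finally show ?thesis .
  qed
  have "(-1) ^ i * Re (gfun (?w)) = (-1) ^ i * Re ?q - (-1) ^ i * Re (ppoly (?w))"
    unfolding gfun_def minus_complex.sel right_diff_distrib ..
  then show ?thesis unfolding Q P by (simp add: algebra_simps)
qed

lemma moment_sum_integrable: "integrable HL moment_sum"
  unfolding moment_sum_def
  by (intro Bochner_Integration.integrable_sum integrable_mult_right moment_fun_integrable) simp

lemma integrable_on_pieces:
  "moment_sum integrable_on {0..R}" "tail_poly integrable_on {0..R}" "moment_fun (r + 1) integrable_on {0..R}"
proof -
  show "moment_sum integrable_on {0..R}"
    unfolding moment_sum_def by (intro integrable_sum integrable_on_mult_right moment_fun_integrable_on) auto
  show "tail_poly integrable_on {0..R}"
    unfolding tail_poly_def by (intro integrable_continuous_interval continuous_intros)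
  show "moment_fun (r + 1) integrable_on {0..R}"
    by (rule moment_fun_integrable_on) simp
qed

definition regularized :: "real \<Rightarrow> real" where
  "regularized R = integral {0..R} (moment_fun (r + 1)) - integral {0..R} tail_poly"

text \<open>The integral of the whole combination over {0..R} is O(1/R) by the contour bound, while
  that of \<open>moment_sum\<close> converges by integrability. The regularized central part is thus
  forced to converge, without any separate asymptotic study of I_0 K_0.\<close>

lemma regularized_tendsto:
  "(regularized \<longlongrightarrow> (-1) ^ r * (\<integral>t. moment_sum t \<partial>HL) / pi ^ M) at_top"
proof -
  let ?g = "\<lambda>t. Re (gfun (- \<i> * of_real t))"
  obtain C where C: "C \<ge> 0" "\<And>\<delta> R. 0 < \<delta> \<Longrightarrow> \<delta> \<le> 1 \<Longrightarrow> 2 \<le> R \<Longrightarrow>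
     \<bar>integral {\<delta>..R} ?g\<bar> \<le> C * sqrt \<delta> + C / R"
    using gfun_axis_bound by blast
  let ?W = "\<lambda>t. moment_sum t + (-1) ^ (r + 1) * pi ^ M * (moment_fun (r + 1) t - tail_poly t)"
  have iW: "?W integrable_on {0..R}" for R
    by (intro integrable_add integrable_on_mult_right integrable_diff integrable_on_pieces)
  have W: "integral {0..R} ?W = integral {0..R} moment_sum + (-1) ^ (r + 1) * pi ^ M * regularized R" for R
  proof -
    have d: "(\<lambda>t. moment_fun (r + 1) t - tail_poly t) integrable_on {0..R}"
      by (intro integrable_diff integrable_on_pieces)
    show ?thesis
      unfolding regularized_def
        Henstock_Kurzweil_Integration.integral_add[OF integrable_on_pieces(1) integrable_on_mult_right[OF d]]
        Henstock_Kurzweil_Integration.integral_mult_right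
        Henstock_Kurzweil_Integration.integral_diff[OF integrable_on_pieces(3,2)] ..
  qed
  have bd: "\<bar>integral {0..R} ?W\<bar> \<le> C / R" if R: "R \<ge> 2" for R
  proof (rule tendsto_le)
    show "at_right (0::real) \<noteq> bot" by simp
    \<comment> \<open>The contour bound is stated for {\<delta>..R} with \<delta> > 0. At fixed R
      the limit \<delta> \<rightarrow> 0 is justified by continuity of the indefinite
      integral.\<close>
    have "continuous_on {0..R} (\<lambda>x. integral {x..R} ?W)"
      by (rule indefinite_integral_continuous_1'[OF iW])
    then have "((\<lambda>x. integral {x..R} ?W) \<longlongrightarrow> integral {0..R} ?W) (at 0 within {0..R})"
      using R by (auto simp: continuous_on_def)
    then show "((\<lambda>x. \<bar>integral {x..R} ?W\<bar>) \<longlongrightarrow> \<bar>integral {0..R} ?W\<bar>) (at_right 0)"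
      using R by (intro tendsto_rabs) (simp add: at_within_Icc_at_right)
    have "((\<lambda>\<delta>. C * sqrt \<delta> + C / R) \<longlongrightarrow> C * sqrt 0 + C / R) (at_right 0)"
      by (intro tendsto_intros)
    then show "((\<lambda>\<delta>. C * sqrt \<delta> + C / R) \<longlongrightarrow> C / R) (at_right 0)" by simp
    have "\<forall>\<^sub>F \<delta> in at_right (0::real). \<delta> \<in> {0<..<1}"
      by (rule eventually_at_right_real) simp
    then show "\<forall>\<^sub>F \<delta> in at_right 0. \<bar>integral {\<delta>..R} ?W\<bar> \<le> C * sqrt \<delta> + C / R"
    proof (rule eventually_mono)
      fix \<delta> :: real assume d: "\<delta> \<in> {0<..<1}"
      have "integral {\<delta>..R} ?W = integral {\<delta>..R} (\<lambda>t. (-1) ^ i * Re (gfun (- \<i> * of_real t)))"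
        by (rule Henstock_Kurzweil_Integration.integral_cong, rule gfun_axis[symmetric]) (use d in auto)
      also have "\<dots> = (-1) ^ i * integral {\<delta>..R} ?g"
        by simp
      finally have "\<bar>integral {\<delta>..R} ?W\<bar> = \<bar>integral {\<delta>..R} ?g\<bar>"
        by (simp add: abs_mult power_abs)
      then show "\<bar>integral {\<delta>..R} ?W\<bar> \<le> C * sqrt \<delta> + C / R"
        using C(2)[of \<delta> R] d R by simp
    qed
  qed
  have W0: "((\<lambda>R. integral {0..R} ?W) \<longlongrightarrow> 0) at_top"
  proof (rule Lim_null_comparison)
    show "((\<lambda>R. C / R) \<longlongrightarrow> 0) at_top" by real_asymp
    show "\<forall>\<^sub>F R in at_top. norm (integral {0..R} ?W) \<le> C / R"
      by (rule eventually_at_top_linorderI[of 2]) (use bd in simp)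
  qed
  have "((\<lambda>R. (-1) ^ r / pi ^ M * (integral {0..R} moment_sum - integral {0..R} ?W)) \<longlongrightarrow> (-1) ^ r / pi ^ M * ((\<integral>t. moment_sum t \<partial>HL) - 0)) at_top"
    by (intro tendsto_intros W0 HL_tendsto[OF moment_sum_integrable])
  moreover have "(-1) ^ r / pi ^ M * (integral {0..R} moment_sum - integral {0..R} ?W) = regularized R" for R
  proof -
    have "(-1::real) ^ r * (-1) ^ r = 1" by (simp flip: power_add)
    then show ?thesis unfolding W by (simp add: field_simps)
  qed
  ultimately show ?thesis by simp
qed

section \<open>Identification with the Bessel moments\<close>

lemma IKM_eq:
  assumes "integrable HL (moment_fun j)"
  shows "IKM k (2 * j) (2 * i) = (\<integral>t. moment_fun j t \<partial>HL)"
proof -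
  have "IKM k (2 * j) (2 * i) = integral {0<..} (moment_fun j)"
    unfolding IKM_def by (rule Henstock_Kurzweil_Integration.integral_cong) (simp add: moment_fun_def)
  also have "\<dots> = (\<integral>t. moment_fun j t \<partial>HL)"
    using integral_HL(2)[OF assms] by (rule integral_unique)
  finally show ?thesis .
qed

lemma sum_IKM_eq:
  "(\<Sum>j = 0..r. of_nat (M choose (2 * j)) * (-1) ^ j * pi ^ (2 * j) * IKM k (2 * j) (2 * i)) = (\<integral>t. moment_sum t \<partial>HL)"
proof -
  have "(\<integral>t. moment_sum t \<partial>HL) = (\<Sum>j\<le>r. \<integral>t. of_nat (M choose (2 * j)) * (-1) ^ j * pi ^ (2 * j) * moment_fun j t \<partial>HL)"
    unfolding moment_sum_def
    by (intro Bochner_Integration.integral_sum integrable_mult_right moment_fun_integrable) simp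
  also have "\<dots> = (\<Sum>j\<le>r. of_nat (M choose (2 * j)) * (-1) ^ j * pi ^ (2 * j) * IKM k (2 * j) (2 * i))"
    by (intro sum.cong refl) (simp add: IKM_eq moment_fun_integrable)
  finally show ?thesis by (simp add: atLeast0AtMost)
qed

text \<open>With no polynomial to subtract, \<open>regularized\<close> is the truncated integral of
  a nonnegative function. Its convergence gives Lebesgue integrability by monotone convergence, so
  that the gauge integral in \<open>IKM\<close> has the limit as its value and not a default
  one.\<close>

lemma IKM_central:
  assumes "i \<le> r"
  shows "IKM k (2 * r + 2) (2 * i) = (-1) ^ r * (\<integral>t. moment_sum t \<partial>HL) / pi ^ M"
proof -
  let ?f = "moment_fun (r + 1)"
  define L where "L = (-1) ^ r * (\<integral>t. moment_sum t \<partial>HL) / pi ^ M"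
  have "{..<N} = {}" using assms N by simp
  then have tp: "tail_poly = (\<lambda>t. 0)" unfolding tail_poly_def[abs_def] by (simp only: sum.empty)
  have reg: "regularized = (\<lambda>R. integral {0..R} ?f)"
    unfolding regularized_def[abs_def] tp by simp
  have z: "?f t = indicator {0..} t * ?f t" for t
    by (simp add: moment_fun_def indicator_def)
  have HLl: "(\<integral>t. indicator {..y} t * ?f t \<partial>HL) = (\<integral>t. ?f t * indicator {..y} t \<partial>lborel)"
    "integrable lborel (\<lambda>t. ?f t * indicator {..y} t)" for y
  proof -
    have "(\<lambda>t. indicator {0..} t *\<^sub>R (indicator {..y} t * ?f t)) = (\<lambda>t. ?f t * indicator {..y} t)"
      by (rule ext) (simp add: moment_fun_def indicator_def)
    then show "(\<integral>t. indicator {..y} t * ?f t \<partial>HL) = (\<integral>t. ?f t * indicator {..y} t \<partial>lborel)"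
      "integrable lborel (\<lambda>t. ?f t * indicator {..y} t)"
      using moment_fun_integrable_le[of "r + 1" y]
      by (simp_all add: HL_def integral_restrict_space integrable_restrict_space del: real_scaleR_def)
  qed
  have eq: "integral {0..R} ?f = (\<integral>t. ?f t * indicator {..R} t \<partial>lborel)" for R
  proof -
    have "((\<lambda>t. indicator {..R} t * ?f t) has_integral (\<integral>t. indicator {..R} t * ?f t \<partial>HL)) {0..}"
      by (rule integral_HL(1)[OF moment_fun_integrable_le]) simp
    then have "((\<lambda>t. if t \<in> {0..R} then ?f t else 0) has_integral (\<integral>t. indicator {..R} t * ?f t \<partial>HL)) {0..}"
      by (rule has_integral_eq[rotated]) auto
    then have "(?f has_integral (\<integral>t. indicator {..R} t * ?f t \<partial>HL)) {0..R}"
      by (subst (asm) has_integral_restrict) auto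
    then show ?thesis unfolding HLl by (rule integral_unique)
  qed
  have conv: "((\<lambda>y. \<integral>t. ?f t * indicator {..y} t \<partial>lborel) \<longlongrightarrow> L) at_top"
    using regularized_tendsto unfolding reg eq L_def .
  have m: "?f \<in> borel_measurable borel" by (rule moment_fun_measurable) simp
  have nn: "AE t in lborel. 0 \<le> ?f t" by (simp add: moment_fun_nonneg)
  have i: "integrable lborel ?f" "integral\<^sup>L lborel ?f = L"
    using integrable_monotone_convergence_at_top[OF _ nn m HLl(2) conv]
      integral_monotone_convergence_at_top[OF _ nn m HLl(2) conv] by simp_all
  have z': "(\<lambda>t. indicator {0..} t *\<^sub>R ?f t) = ?f"
    using z by (auto simp: fun_eq_iff)
  have iH: "integrable HL ?f" and vH: "(\<integral>t. ?f t \<partial>HL) = L"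
    using i by (simp_all add: HL_def integral_restrict_space integrable_restrict_space z'[unfolded Suc_eq_plus1[symmetric]] del: real_scaleR_def)
  have "IKM k (2 * (r + 1)) (2 * i) = L" unfolding IKM_eq[OF iH] by (rule vH)
  then show ?thesis by (simp add: L_def)
qed

lemma integral_tail_poly:
  assumes "R \<ge> 0"
  shows "integral {0..R} tail_poly = (\<Sum>n<N. 4 ^ n * of_rat (IKM_gamma k n) / 2 ^ M * (R ^ (2 * (N - 1 - n) + 1) / real (2 * (N - 1 - n) + 1)))"
proof (rule integral_unique)
  have P: "((\<lambda>t. t ^ l) has_integral R ^ (l + 1) / real (l + 1)) {0..R}" for l
  proof -
    have "((\<lambda>t. t ^ l) has_integral R ^ (l + 1) / real (l + 1) - 0 ^ (l + 1) / real (l + 1)) {0..R}"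
    proof (rule fundamental_theorem_of_calculus[OF assms])
      fix t
      have "((\<lambda>t. t ^ Suc l / real (l + 1)) has_real_derivative (1 + real l) * (1 * t ^ l) / real (l + 1)) (at t within {0..R})"
        by (intro DERIV_cdivide DERIV_power_Suc DERIV_ident)
      then show "((\<lambda>t. t ^ (l + 1) / real (l + 1)) has_vector_derivative t ^ l) (at t within {0..R})"
        by (simp add: has_real_derivative_iff_has_vector_derivative add.commute)
    qed
    then show ?thesis by simp
  qed
  show "(tail_poly has_integral (\<Sum>n<N. 4 ^ n * of_rat (IKM_gamma k n) / 2 ^ M * (R ^ (2 * (N - 1 - n) + 1) / real (2 * (N - 1 - n) + 1)))) {0..R}"
    unfolding tail_poly_def by (intro has_integral_sum has_integral_mult_right P finite_lessThan)
qed

text \<open>The polynomial in \<open>IKM_reg\<close> is the primitive of \<open>tail_poly\<close>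
  that vanishes at 0, summed in the opposite order; its expression under the limit is therefore
  \<open>regularized\<close>.\<close>

lemma IKM_reg_central:
  assumes "i > r"
  shows "IKM_reg r i = (-1) ^ r * (\<integral>t. moment_sum t \<partial>HL) / pi ^ M"
proof -
  let ?s = "\<lambda>t. (\<Sum>m = 0..i - r - 1. of_rat (IKM_gamma k (i - r - 1 - m)) * t ^ (2 * m + 1) / (2 powi (int k - 2 * int i + 2 * int m) * of_nat (2 * m + 1)))"
  let ?f = "\<lambda>s. (bessel_I0 s * bessel_K0 s) ^ (2 * r + 2) * s ^ (2 * i)"
  have N0: "N = Suc (i - r - 1)" using assms N by simp
  have e: "integral {0<..t} ?f
       - ?s t = regularized t" if t: "t \<ge> 0" for t
  proof -
    have "integral {0<..t} ?f = integral {0<..t} (moment_fun (r + 1))"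
    proof (rule Henstock_Kurzweil_Integration.integral_cong)
      fix s assume "s \<in> {0<..t}"
      then have "s > 0" by simp
      moreover have "k - 2 * (r + 1) = 2 * (r + 1)" using k by simp
      ultimately show "(bessel_I0 s * bessel_K0 s) ^ (2 * r + 2) * s ^ (2 * i) = moment_fun (r + 1) s"
        by (simp add: moment_fun_def power_mult_distrib)
    qed
    also have "\<dots> = integral {0..t} (moment_fun (r + 1))"
      by (rule integral_spike_set; rule negligible_subset[of "{0}"]) auto
    finally have 1: "integral {0<..t} ?f = integral {0..t} (moment_fun (r + 1))" .
    let ?g = "\<lambda>m. of_rat (IKM_gamma k (N - Suc m)) * t ^ (2 * m + 1) / (2 powi (int k - 2 * int i + 2 * int m) * of_nat (2 * m + 1))"
    have "?s t = (\<Sum>m<N. ?g m)"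
      unfolding N0 by (simp add: atLeast0AtMost lessThan_Suc_atMost)
    also have "\<dots> = (\<Sum>n<N. ?g (N - Suc n))"
      \<comment> \<open>The reversal m = N - 1 - n: m counts powers of t, n counts coefficients of
        the series.\<close>
      by (rule sum.nat_diff_reindex[symmetric])
    also have "\<dots> = integral {0..t} tail_poly"
      unfolding integral_tail_poly[OF t]
    proof (rule sum.cong[OF refl])
      fix n assume "n \<in> {..<N}"
      then have n: "n < N" by simp
      have n1: "N - Suc (N - Suc n) = n" using n by simp
      \<comment> \<open>Computed in \<open>int\<close>, as in the \<open>powi\<close> of the
        definition, where no difference is truncated; 2^(M - 2n) is then 2^M / 4^n.\<close>
      have "int k - 2 * int i + 2 * int (N - Suc n) = int M - 2 * int n"
        using n N M k by simp
      then have p: "2 powi (int k - 2 * int i + 2 * int (N - Suc n)) = (2::real) ^ M / 4 ^ n"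
        by (simp add: power_int_diff power_int_mult)
      then show "?g (N - Suc n) = 4 ^ n * of_rat (IKM_gamma k n) / 2 ^ M * (t ^ (2 * (N - 1 - n) + 1) / real (2 * (N - 1 - n) + 1))"
        unfolding n1 p by (simp add: field_simps)
    qed
    finally show ?thesis unfolding 1 regularized_def by simp
  qed
  have k': "4 * r + 4 = k" using k by simp
  show ?thesis
    unfolding IKM_reg_def Let_def k'
  \<comment> \<open>\<open>Lim\<close> is a definite description and has this value only because
    convergence has been proved.\<close>
  proof (rule tendsto_Lim)
    show "((\<lambda>t. integral {0<..t} ?f
       - ?s t) \<longlongrightarrow> (-1) ^ r * (\<integral>t. moment_sum t \<partial>HL) / pi ^ M) at_top"
      by (rule Lim_transform_eventually[OF regularized_tendsto], rule eventually_at_top_linorderI[of 0]) (use e in simp)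
  qed simp
qed

end

theorem mainTheorem1:
  fixes r k i :: nat
  assumes "k = 4 * r + 4" and "i \<le> (k - 1) div 2"
  shows "(\<Sum>j = 0..r. of_nat ((k div 2) choose (2 * j)) * (-1) ^ j * pi ^ (2 * j)
            * IKM k (2 * j) (2 * i))
         = (if i \<le> r then (-1) ^ r * pi ^ (2 * r + 2) * IKM k (2 * r + 2) (2 * i)
            else (-1) ^ r * pi ^ (2 * r + 2) * IKM_reg r i)"
proof -
  interpret IKM_setup r k i "2 * r + 2" "i - r"
    by unfold_locales (use assms in auto)
  have k2: "k div 2 = 2 * r + 2" using assms(1) by simp
  \<comment> \<open>The prefactor in the theorem is inverse to the one in the two central lemmas,
    since the sign (-1)^r squares to 1.\<close>
  have s: "(-1) ^ r * pi ^ (2 * r + 2) * ((-1) ^ r * X / pi ^ (2 * r + 2)) = X" for X :: real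
  proof -
    have "(-1::real) ^ r * (-1) ^ r = 1" by (simp flip: power_add)
    then show ?thesis by (simp add: field_simps)
  qed
  show ?thesis
    unfolding k2 sum_IKM_eq using IKM_central IKM_reg_central s by simp
qed

end
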